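(* Let $\mathcal K$ be a 3-dimensional simplicial complex embedded in $\mathbb R^3$ triangulating a closed bounded domain $\Omega$ with Lipschitz boundary that is homeomorphic to a closed 3-ball. Then $\mathcal K$ is collapsible if and only if there exists a complete acyclic matching of 1-chains on the canonical basis of $\mathcal K$.
   Context: Cells (simplices) of $\mathcal K$ are oriented; $\mathcal K_j$ is the set of $j$-simplices. The canonical basis of the chain complex consists of the simplices themselves. For an edge $e$ and a triangle $f$, write $e\prec f$ iff $e\subset\partial f$ (equivalently the face–edge incidence number is nonzero). A matching of 1-chains on the canonical basis is a set $\mathcal M_1$ of pairs $(e,f)$ with $e$ an edge, $f$ a triangle, $e\prec f$, such that every edge and every triangle belongs to at most one pair. It is acyclic if there is no cycle $f_1\succ e_1\prec f_2\succ\cdots\prec f_h\succ e_h\prec f_1$ with $h\ge2$, all $(e_i,f_i)\in\mathcal M_1$ and the $f_i$ distinct. It is complete if its number of pairs equals the rank of the face–edge incidence matrix $\mathbf C$ (entries $\pm1$ if $e\subset\partial f$ with sign given by orientation, $0$ otherwise). An elementary collapse removes from a complex a pair $(\sigma,\tau)$ of cells with $\sigma\subset\tau$, $\dim\sigma=\dim\tau-1$, such that $\tau$ is the only cell of the complex properly containing $\sigma$ (and hence $\tau$ is maximal). $\mathcal K$ is collapsible if a finite sequence of elementary collapses reduces it to a single vertex. *)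

theory Defs
  imports "HOL-Analysis.Analysis"
begin

type_synonym pt = "real ^ 3"

text \<open>Geometric simplicial complex in R^3, given by the vertex sets of its simplices.\<close>
definition simplicial_complex :: "pt set set \<Rightarrow> bool" where
  "simplicial_complex K \<longleftrightarrow> finite K \<and>
     (\<forall>\<sigma>\<in>K. \<sigma> \<noteq> {} \<and> finite \<sigma> \<and> \<not> affine_dependent \<sigma>) \<and>
     (\<forall>\<sigma>\<in>K. \<forall>\<tau>. \<tau> \<subseteq> \<sigma> \<and> \<tau> \<noteq> {} \<longrightarrow> \<tau> \<in> K) \<and>
     (\<forall>\<sigma>\<in>K. \<forall>\<tau>\<in>K. convex hull \<sigma> \<inter> convex hull \<tau> = convex hull (\<sigma> \<inter> \<tau>))"

definition polyhedron :: "pt set set \<Rightarrow> pt set" where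
  "polyhedron K = \<Union>((\<lambda>\<sigma>. convex hull \<sigma>) ` K)"

definition dim3_complex :: "pt set set \<Rightarrow> bool" where
  "dim3_complex K \<longleftrightarrow> (\<exists>\<sigma>\<in>K. card \<sigma> = 4) \<and> (\<forall>\<sigma>\<in>K. card \<sigma> \<le> 4)"

definition lipschitz_boundary :: "pt set \<Rightarrow> bool" where
  "lipschitz_boundary \<Omega> \<longleftrightarrow>
     (\<forall>p\<in>frontier \<Omega>. \<exists>(U :: pt set) (R :: pt \<Rightarrow> pt) (g :: real^2 \<Rightarrow> real) (L :: real).
        open U \<and> p \<in> U \<and> orthogonal_transformation R \<and> lipschitz_on L UNIV g \<and>
        \<Omega> \<inter> U = {x\<in>U. (R x) $ 3 \<le> g (vector [(R x) $ 1, (R x) $ 2])})"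

definition elem_collapse :: "'a set set \<Rightarrow> 'a set set \<Rightarrow> bool" where
  "elem_collapse K K' \<longleftrightarrow> (\<exists>\<sigma> \<tau>. \<sigma> \<in> K \<and> \<tau> \<in> K \<and> \<sigma> \<subset> \<tau> \<and> card \<tau> = card \<sigma> + 1 \<and>
      (\<forall>\<rho>\<in>K. \<sigma> \<subset> \<rho> \<longrightarrow> \<rho> = \<tau>) \<and> K' = K - {\<sigma>, \<tau>})"

definition collapsible :: "'a set set \<Rightarrow> bool" where
  "collapsible K \<longleftrightarrow> (\<exists>v. elem_collapse\<^sup>*\<^sup>* K {{v}})"

definition edges :: "'a set set \<Rightarrow> 'a set set" where
  "edges K = {e\<in>K. card e = 2}"

definition triangles :: "'a set set \<Rightarrow> 'a set set" where
  "triangles K = {f\<in>K. card f = 3}"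

definition matching1 :: "'a set set \<Rightarrow> ('a set \<times> 'a set) set \<Rightarrow> bool" where
  "matching1 K M \<longleftrightarrow>
     (\<forall>(e,f)\<in>M. e \<in> edges K \<and> f \<in> triangles K \<and> e \<subset> f) \<and>
     (\<forall>p\<in>M. \<forall>q\<in>M. fst p = fst q \<longrightarrow> p = q) \<and>
     (\<forall>p\<in>M. \<forall>q\<in>M. snd p = snd q \<longrightarrow> p = q)"

definition acyclic_matching :: "('a set \<times> 'a set) set \<Rightarrow> bool" where
  "acyclic_matching M \<longleftrightarrow>
     \<not> (\<exists>h::nat. \<exists>ef :: nat \<Rightarrow> 'a set \<times> 'a set. h \<ge> 2 \<and> (\<forall>i<h. ef i \<in> M) \<and>
          inj_on (\<lambda>i. snd (ef i)) {..<h} \<and>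
          (\<forall>i<h. fst (ef i) \<subset> snd (ef (Suc i mod h))))"

text \<open>Orientation: every simplex is oriented by the lexicographic order of its vertices.\<close>
definition lex_less :: "pt \<Rightarrow> pt \<Rightarrow> bool" where
  "lex_less v w \<longleftrightarrow> v$1 < w$1 \<or> (v$1 = w$1 \<and> (v$2 < w$2 \<or> (v$2 = w$2 \<and> v$3 < w$3)))"

text \<open>Face--edge incidence number [f : e]: for f = [v0,v1,v2] (increasing order), the face
  obtained by deleting v_i has sign (-1)^i.\<close>
definition incidence :: "pt set \<Rightarrow> pt set \<Rightarrow> real" where
  "incidence f e = (if e \<subset> f then (-1) ^ card {x\<in>f. \<forall>w\<in>f - e. lex_less x w} else 0)"

definition incidence_rank :: "pt set set \<Rightarrow> nat" where
  "incidence_rank K = Max {card T | T. T \<subseteq> triangles K \<and>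
      (\<forall>c :: pt set \<Rightarrow> real. (\<forall>e\<in>edges K. (\<Sum>f\<in>T. c f * incidence f e) = 0) \<longrightarrow> (\<forall>f\<in>T. c f = 0))}"

definition complete_matching :: "pt set set \<Rightarrow> (pt set \<times> pt set) set \<Rightarrow> bool" where
  "complete_matching K M \<longleftrightarrow> card M = incidence_rank K"

end

theory Submission
  imports Defs
begin

text \<open>
  A collapse pairs off all cells but one vertex. Its edge-triangle pairs form an acyclic matching, and
  each elementary collapse changes the rank of the incidence matrix by one exactly when it removes
  such a pair; hence the matching is complete.

  Conversely, let an acyclic complete matching be given. The boundary modulo 2 of a nonempty set of
  tetrahedra is not zero, and it is not supported on matched triangles, as these are independent. So
  some unmatched triangle is a free face, and all tetrahedra can be collapsed along unmatched
  triangles. If an unmatched triangle remained, completeness would give a nonzero 2-cycle in the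
  remaining 2-complex; since the complement of the ball is connected, this cycle would bound
  tetrahedra, which the collapsing order excludes. The matching then collapses the 2-complex to a graph.
  The graph is connected and has no cycles, because collapses preserve connectedness and the
  vanishing of the first integral cohomology, which holds on the ball since maps from a contractible
  space to the circle have logarithms. So the graph is a tree.
\<close>

section \<open>Barycentric coordinates and sides of a simplex\<close>

text \<open>Completeness speaks of a rank over the reals, while the geometry is reached through
  parities. Acyclicity bridges the gap: with the pairs suitably ordered, the matched edges and
  triangles form a triangular block of the incidence matrix with 1 or -1 on the diagonal. No
  homology groups are formed. One principle takes the place of the second and third homology modulo
  2: the number of full simplices over a generic point changes its parity only across a facet that
  lies in an odd number of them. For tetrahedra of the complex this excludes 3-cycles; for the cone
  over a 2-cycle it produces a filling, as Alexander duality would. Genericity enters because a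
  segment through the intersection of two facet planes crosses several facets at once, and these
  cannot be counted separately. For the final graph, cocycles are preferred to cycles: they extend
  back over a collapsed pair, and on a graph the cocycle of a single edge exhibits this edge as a
  bridge.\<close>

lemma affine_interpolation:
  fixes s :: "'a::euclidean_space set" and y :: "'a \<Rightarrow> real"
  assumes "\<not> affine_dependent s"
  shows "\<exists>a b. \<forall>w\<in>s. a \<bullet> w + b = y w"
proof (cases "s = {}")
  case False
  then obtain p where p: "p \<in> s" by blast
  let ?B = "(\<lambda>x. - p + x) ` (s - {p})"
  have "independent ?B"
    using assms affine_dependent_iff_dependent2[OF p] by simp
  then obtain g where g: "linear g" "\<forall>x\<in>?B. g x = y (p + x) - y p"
    using linear_independent_extend[of ?B "\<lambda>x. y (p + x) - y p"] by blast
  \<comment> \<open>Riesz representation: as \<open>g\<close> is real-valued, its adjoint at 1 is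
    the representing vector.\<close>
  have rep: "g x = adjoint g 1 \<bullet> x" for x
    using adjoint_works[OF g(1), of x 1] by (simp add: inner_commute)
  have "adjoint g 1 \<bullet> w + (y p - adjoint g 1 \<bullet> p) = y w" if w: "w \<in> s" for w
  proof (cases "w = p")
    case False
    with w have "- p + w \<in> ?B" by blast
    then have "g (- p + w) = y w - y p" using g(2) by fastforce
    then have "adjoint g 1 \<bullet> (- p + w) = y w - y p" by (simp only: rep)
    then show ?thesis by (simp add: inner_diff_right)
  qed simp
  then show ?thesis by blast
qed simp

text \<open>The barycentric coordinate of \<^term>\<open>x\<close> at the vertex \<^term>\<open>v\<close>, extended to an affine function on
  the whole space; it is canonical only if \<^term>\<open>t\<close> is a full-dimensional simplex.\<close>
definition bary :: "'a::euclidean_space set \<Rightarrow> 'a \<Rightarrow> 'a \<Rightarrow> real" where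
  "bary t v x = (let c = SOME c. \<forall>w\<in>t. fst c \<bullet> w + snd c = (if w = v then 1 else 0)
     in fst c \<bullet> x + snd c)"

lemma bary_inner: "\<exists>a b. \<forall>x. bary t v x = a \<bullet> x + b"
  unfolding bary_def Let_def by blast

lemma bary_vertex:
  assumes "\<not> affine_dependent t" "w \<in> t"
  shows "bary t v w = (if w = v then 1 else 0)"
proof -
  let ?P = "\<lambda>c. \<forall>w\<in>t. fst c \<bullet> w + snd c = (if w = v then 1 else 0 :: real)"
  obtain a b where "?P (a, b)"
    using affine_interpolation[OF assms(1), of "\<lambda>w. if w = v then 1 else 0"] by auto
  then have "?P (SOME c. ?P c)" by (rule someI[of ?P])
  then show ?thesis using assms(2) unfolding bary_def Let_def by blast
qed

lemma bary_add_scaleR: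
  "bary t v (x + c *\<^sub>R d) = bary t v x + c * (bary t v (x + d) - bary t v x)"
proof -
  obtain a b where "\<And>x. bary t v x = a \<bullet> x + b" using bary_inner by metis
  then show ?thesis by (simp add: inner_right_distrib)
qed

lemma bary_sum:
  assumes "sum u s = 1"
  shows "bary t v (\<Sum>w\<in>s. u w *\<^sub>R w) = (\<Sum>w\<in>s. u w * bary t v w)"
proof -
  obtain a b where ab: "\<And>x. bary t v x = a \<bullet> x + b" using bary_inner by metis
  have "(\<Sum>w\<in>s. u w * bary t v w) = (\<Sum>w\<in>s. u w * (a \<bullet> w)) + sum u s * b"
    by (simp add: ab algebra_simps sum.distrib sum_distrib_left)
  then show ?thesis by (simp add: ab assms inner_sum_right)
qed

lemma continuous_bary: "continuous_on UNIV (bary t v)"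
proof -
  obtain a b where "\<And>x. bary t v x = a \<bullet> x + b" using bary_inner by metis
  then have "bary t v = (\<lambda>x. a \<bullet> x + b)" by auto
  then show ?thesis by (simp add: continuous_intros)
qed

lemma tendsto_bary:
  assumes "(f \<longlongrightarrow> l) F" shows "((\<lambda>x. bary t v (f x)) \<longlongrightarrow> bary t v l) F"
  using continuous_on_tendsto_compose[OF continuous_bary assms] by simp

definition full_simplex :: "'a::euclidean_space set \<Rightarrow> bool" where
  "full_simplex t \<longleftrightarrow> \<not> affine_dependent t \<and> card t = Suc DIM('a)"

lemma full_simplex_finite: "full_simplex t \<Longrightarrow> finite t"
  unfolding full_simplex_def using card.infinite by fastforce

lemma full_simplex_affine_independent: "full_simplex t \<Longrightarrow> \<not> affine_dependent t"
  by (simp add: full_simplex_def)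

lemma bary_unique:
  assumes "\<not> affine_dependent t" "sum u t = 1" "v \<in> t"
  shows "bary t v (\<Sum>w\<in>t. u w *\<^sub>R w) = u v"
proof -
  have "finite t" using assms aff_independent_finite by blast
  have "bary t v (\<Sum>w\<in>t. u w *\<^sub>R w) = (\<Sum>w\<in>t. u w * (if w = v then 1 else 0))"
    unfolding bary_sum[OF assms(2)] using assms(1) by (intro sum.cong) (auto simp: bary_vertex)
  also have "\<dots> = u v" using \<open>finite t\<close> assms(3) by (simp add: if_distrib cong: if_cong)
  finally show ?thesis .
qed

lemma
  assumes "full_simplex (t :: 'a::euclidean_space set)"
  shows sum_bary: "(\<Sum>v\<in>t. bary t v x) = 1"
    and sum_bary_scaleR: "(\<Sum>v\<in>t. bary t v x *\<^sub>R v) = x"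
proof -
  have t: "finite t" "\<not> affine_dependent t"
    using assms full_simplex_finite full_simplex_affine_independent by auto
  have "x \<in> affine hull t"
    using assms affine_independent_span_eq[of t] by (simp add: full_simplex_def)
  then obtain u where u: "sum u t = 1" "(\<Sum>v\<in>t. u v *\<^sub>R v) = x"
    using affine_hull_finite[OF t(1)] by auto
  have "bary t v x = u v" if "v \<in> t" for v
    using bary_unique[OF t(2) u(1) that] u(2) by simp
  then show "(\<Sum>v\<in>t. bary t v x) = 1" "(\<Sum>v\<in>t. bary t v x *\<^sub>R v) = x"
    using u by simp_all
qed

lemma convex_hull_bary_nonneg:
  assumes "\<not> affine_dependent t" "x \<in> convex hull t" "v \<in> t"
  shows "0 \<le> bary t v x"
proof -
  have "finite t" using assms aff_independent_finite by blast
  obtain u where u: "\<forall>v\<in>t. 0 \<le> u v" "sum u t = 1" "(\<Sum>v\<in>t. u v *\<^sub>R v) = x"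
    using assms(2) unfolding convex_hull_finite[OF \<open>finite t\<close>] by blast
  then show ?thesis using bary_unique[OF assms(1) u(2) assms(3)] assms(3) by simp
qed

lemma full_simplex_convex_hull:
  assumes "full_simplex t"
  shows "x \<in> convex hull t \<longleftrightarrow> (\<forall>v\<in>t. 0 \<le> bary t v x)"
proof
  assume "\<forall>v\<in>t. 0 \<le> bary t v x"
  then show "x \<in> convex hull t"
    using sum_bary[OF assms, of x] sum_bary_scaleR[OF assms, of x]
    unfolding convex_hull_finite[OF full_simplex_finite[OF assms]]
    by (intro CollectI exI[of _ "\<lambda>v. bary t v x"]) auto
qed (use assms convex_hull_bary_nonneg full_simplex_affine_independent in blast)

lemma bary_eq_0_on_face:
  assumes "\<not> affine_dependent t" "s \<subseteq> t" "x \<in> convex hull s" "v \<in> t" "v \<notin> s"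
  shows "bary t v x = 0"
proof -
  have "finite s" using assms aff_independent_finite finite_subset by blast
  obtain u where u: "sum u s = 1" "(\<Sum>v\<in>s. u v *\<^sub>R v) = x"
    using assms(3) unfolding convex_hull_finite[OF \<open>finite s\<close>] by blast
  have "bary t v x = (\<Sum>w\<in>s. u w * bary t v w)"
    using bary_sum[OF u(1)] u(2) by metis
  also have "\<dots> = 0"
  proof (intro sum.neutral ballI)
    fix w assume "w \<in> s"
    then have "w \<in> t" "w \<noteq> v" using assms by auto
    then show "u w * bary t v w = 0" using bary_vertex[OF assms(1)] by simp
  qed
  finally show ?thesis .
qed

lemma convex_hull_facet:
  assumes "full_simplex t" "x \<in> convex hull t" "v \<in> t" "bary t v x = 0"
  shows "x \<in> convex hull (t - {v})"
proof -
  have "finite t" using full_simplex_finite[OF assms(1)] .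
  moreover have "sum (\<lambda>w. bary t w x) (t - {v}) = 1" "(\<Sum>w\<in>t - {v}. bary t w x *\<^sub>R w) = x"
    using sum_bary[OF assms(1), of x] sum_bary_scaleR[OF assms(1), of x] assms(3,4)
      sum.remove[OF \<open>finite t\<close> assms(3), of "\<lambda>v. bary t v x"]
      sum.remove[OF \<open>finite t\<close> assms(3), of "\<lambda>v. bary t v x *\<^sub>R v"] by auto
  moreover have "\<forall>w\<in>t - {v}. 0 \<le> bary t w x"
    using assms full_simplex_convex_hull by blast
  ultimately show ?thesis
    unfolding convex_hull_finite[OF finite_Diff[OF \<open>finite t\<close>]]
    by (intro CollectI exI[of _ "\<lambda>w. bary t w x"] conjI)
qed

text \<open>The normal vector is nonzero because the coordinate takes the values 1 and 0 at two
  different vertices.\<close>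

lemma bary_hyperplane:
  assumes "full_simplex (t :: 'a::euclidean_space set)" "v \<in> t"
  shows "\<exists>a b. a \<noteq> 0 \<and> {x. bary t v x = 0} = {x. a \<bullet> x = b}"
proof -
  obtain a b where ab: "\<And>x. bary t v x = a \<bullet> x + b" using bary_inner by metis
  have "card (t - {v}) \<noteq> 0" using assms DIM_positive[where 'a='a] by (simp add: full_simplex_def)
  then have "t - {v} \<noteq> {}" by (metis card.empty)
  then obtain w where w: "w \<in> t" "w \<noteq> v" by blast
  have "bary t v v = 1" "bary t v w = 0"
    using assms w bary_vertex full_simplex_affine_independent by fastforce+
  then have "a \<noteq> 0" by (auto simp: ab)
  moreover have "{x. bary t v x = 0} = {x. a \<bullet> x = - b}" by (auto simp: ab)
  ultimately show ?thesis by blast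
qed

lemma bary_hyperplane_aff_dim:
  assumes "full_simplex (t :: 'a::euclidean_space set)" "v \<in> t"
  shows "affine {x. bary t v x = 0}" "aff_dim {x. bary t v x = 0} = int DIM('a) - 1"
  using bary_hyperplane[OF assms] by (auto simp: affine_hyperplane aff_dim_hyperplane)

text \<open>General position by measure: each of the sets lies in a hyperplane and is negligible, a
  nonempty open set is not.\<close>

lemma avoid_lowdim:
  fixes S :: "'a::euclidean_space set"
  assumes "finite H" "\<And>A. A \<in> H \<Longrightarrow> aff_dim A < DIM('a)" "open S" "S \<noteq> {}"
  obtains x where "x \<in> S" "\<And>A. A \<in> H \<Longrightarrow> x \<notin> A"
proof -
  have "negligible A" if "A \<in> H" for A
    using aff_lowdim_subset_hyperplane[OF assms(2)[OF that]] negligible_hyperplane negligible_subset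
    by metis
  then have "negligible (\<Union>H)" using assms(1) by (simp add: negligible_Union)
  then have "\<not> S \<subseteq> \<Union>H"
    using open_not_negligible[OF assms(3,4)] negligible_subset by blast
  then show thesis using that by blast
qed

lemma eventually_bary_pos:
  assumes "0 < bary t v r"
  shows "\<forall>\<^sub>F c in at_right 0. 0 < bary t v (r + c *\<^sub>R d)"
    "\<forall>\<^sub>F c in at_right 0. 0 < bary t v (r - c *\<^sub>R d)"
proof -
  have "((\<lambda>c. r + c *\<^sub>R d) \<longlongrightarrow> r + 0 *\<^sub>R d) (at_right 0)"
    "((\<lambda>c. r - c *\<^sub>R d) \<longlongrightarrow> r - 0 *\<^sub>R d) (at_right 0)"
    by (intro tendsto_intros)+
  then show "\<forall>\<^sub>F c in at_right 0. 0 < bary t v (r + c *\<^sub>R d)"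
    "\<forall>\<^sub>F c in at_right 0. 0 < bary t v (r - c *\<^sub>R d)"
    using assms by (auto intro!: order_tendstoD(1) tendsto_bary)
qed

lemma eventually_bary_neg:
  assumes "bary t v r < 0"
  shows "\<forall>\<^sub>F c in at_right 0. bary t v (r + c *\<^sub>R d) < 0"
    "\<forall>\<^sub>F c in at_right 0. bary t v (r - c *\<^sub>R d) < 0"
proof -
  have "((\<lambda>c. r + c *\<^sub>R d) \<longlongrightarrow> r + 0 *\<^sub>R d) (at_right 0)"
    "((\<lambda>c. r - c *\<^sub>R d) \<longlongrightarrow> r - 0 *\<^sub>R d) (at_right 0)"
    by (intro tendsto_intros)+
  then show "\<forall>\<^sub>F c in at_right 0. bary t v (r + c *\<^sub>R d) < 0"
    "\<forall>\<^sub>F c in at_right 0. bary t v (r - c *\<^sub>R d) < 0"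
    using assms by (auto intro!: order_tendstoD(2) tendsto_bary)
qed

section \<open>Crossing the boundary of a simplex along a line\<close>

definition on_boundary :: "'a::euclidean_space set \<Rightarrow> 'a \<Rightarrow> bool" where
  "on_boundary t r \<longleftrightarrow> r \<in> convex hull t \<and> (\<exists>v\<in>t. bary t v r = 0)"

text \<open>The truth values \<open>\<beta>\<close> and \<open>\<gamma>\<close> tell whether points
  just ahead of \<open>r\<close> and just behind it lie in the simplex. Only a vanishing coordinate
  can change sign near \<open>r\<close>. On the simplex there is at most one by
  \<open>single\<close>, and by \<open>trans\<close> it does change sign, so the line crosses the
  boundary instead of touching it.\<close>

lemma full_simplex_sides:
  assumes t: "full_simplex t"
    and trans: "\<And>v. v \<in> t \<Longrightarrow> bary t v r = 0 \<Longrightarrow> bary t v (r + d) \<noteq> 0"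
    and single: "r \<in> convex hull t \<Longrightarrow> \<forall>v\<in>t. \<forall>w\<in>t. bary t v r = 0 \<longrightarrow> bary t w r = 0 \<longrightarrow> v = w"
  shows "\<exists>\<beta> \<gamma>. (\<forall>\<^sub>F c in at_right 0. ((r + c *\<^sub>R d \<in> convex hull t) = \<beta>) \<and> ((r - c *\<^sub>R d \<in> convex hull t) = \<gamma>))
     \<and> (\<beta> \<noteq> \<gamma> \<longleftrightarrow> on_boundary t r) \<and> (\<not> on_boundary t r \<longrightarrow> \<beta> = (r \<in> convex hull t))"
proof -
  note hull = full_simplex_convex_hull[OF t]
  have fin: "finite t" using full_simplex_finite[OF t] .
  consider "r \<notin> convex hull t" | "r \<in> convex hull t" "\<not> on_boundary t r" | "on_boundary t r" by blast
  then show ?thesis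
  proof cases
    case 1
    then obtain v where v: "v \<in> t" "bary t v r < 0" using hull by force
    have "\<forall>\<^sub>F c in at_right 0. (r + c *\<^sub>R d \<in> convex hull t) = False \<and> (r - c *\<^sub>R d \<in> convex hull t) = False"
      using eventually_bary_neg(1)[OF v(2), of d] eventually_bary_neg(2)[OF v(2), of d]
    proof eventually_elim
      case (elim c)
      then show ?case using v(1) by (meson hull not_le)
    qed
    then show ?thesis using 1 by (intro exI[of _ False] conjI) (auto simp: on_boundary_def)
  next
    case 2
    then have pos: "\<And>v. v \<in> t \<Longrightarrow> 0 < bary t v r"
      unfolding on_boundary_def hull by (metis order_le_less)
    have "\<forall>\<^sub>F c in at_right 0. \<forall>v\<in>t. 0 < bary t v (r + c *\<^sub>R d)"
      "\<forall>\<^sub>F c in at_right 0. \<forall>v\<in>t. 0 < bary t v (r - c *\<^sub>R d)"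
      using pos fin by (auto intro!: eventually_ball_finite eventually_bary_pos)
    then have "\<forall>\<^sub>F c in at_right 0. (r + c *\<^sub>R d \<in> convex hull t) = True \<and> (r - c *\<^sub>R d \<in> convex hull t) = True"
      by eventually_elim (auto simp: hull less_imp_le)
    then show ?thesis using 2 by (intro exI[of _ True] conjI) auto
  next
    case 3
    then obtain u where r: "r \<in> convex hull t" and u: "u \<in> t" "bary t u r = 0"
      unfolding on_boundary_def by blast
    have pos: "0 < bary t v r" if "v \<in> t - {u}" for v
      using that r hull single[OF r] u by (metis Diff_iff insertCI order_le_less)
    \<comment> \<open>The slope of the vanishing coordinate along the line; its sign decides on
      which side of \<open>r\<close> the simplex lies.\<close>
    let ?k = "bary t u (r + d)"
    have k: "?k \<noteq> 0" using trans u by blast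
    have line: "bary t u (r + c *\<^sub>R d) = c * ?k" "bary t u (r - c *\<^sub>R d) = - (c * ?k)" for c
      using bary_add_scaleR[of t u r c d] bary_add_scaleR[of t u r "-c" d] u(2) by auto
    have "\<forall>\<^sub>F c in at_right 0. \<forall>v\<in>t - {u}. 0 < bary t v (r + c *\<^sub>R d)"
      "\<forall>\<^sub>F c in at_right 0. \<forall>v\<in>t - {u}. 0 < bary t v (r - c *\<^sub>R d)"
      using pos fin by (auto intro!: eventually_ball_finite eventually_bary_pos)
    moreover have "\<forall>\<^sub>F c in at_right (0::real). 0 < c" by (simp add: eventually_at_right_less)
    ultimately have "\<forall>\<^sub>F c in at_right 0. (r + c *\<^sub>R d \<in> convex hull t) = (0 < ?k) \<and> (r - c *\<^sub>R d \<in> convex hull t) = (?k < 0)"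
    proof eventually_elim
      case (elim c)
      have "(r + c *\<^sub>R d \<in> convex hull t) = (0 \<le> bary t u (r + c *\<^sub>R d))"
        "(r - c *\<^sub>R d \<in> convex hull t) = (0 \<le> bary t u (r - c *\<^sub>R d))"
        unfolding hull using elim u(1) by (metis Diff_iff empty_iff insert_iff less_imp_le)+
      then show ?case using k elim(3) by (auto simp: line zero_le_mult_iff mult_le_0_iff)
    qed
    then show ?thesis using 3 k
      by (intro exI[of _ "0 < ?k"] exI[of _ "?k < 0"] conjI) auto
  qed
qed

definition cover_count :: "'a::euclidean_space set set \<Rightarrow> 'a \<Rightarrow> nat" where
  "cover_count T x = card {t \<in> T. x \<in> convex hull t}"

lemma even_card_sum_iff_sym_diff:
  assumes "finite A" "finite B"
  shows "even (card A + card B) \<longleftrightarrow> even (card ((A - B) \<union> (B - A)))"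
proof -
  have "card A = card (A \<inter> B) + card (A - B)" "card B = card (A \<inter> B) + card (B - A)"
    using assms by (metis card_Int_Diff inf_commute)+
  moreover have "card ((A - B) \<union> (B - A)) = card (A - B) + card (B - A)"
    using assms by (intro card_Un_disjoint) auto
  ultimately show ?thesis by auto
qed

text \<open>A simplex contributes differently to the two sides exactly if \<open>r\<close> is on its
  boundary, so the sum of the two counts has the parity of the number of such simplices. The last
  clause serves when \<open>r\<close> is itself one of the generic points to be compared.\<close>

lemma cover_count_sides:
  assumes fin: "finite T" and T: "\<And>t. t \<in> T \<Longrightarrow> full_simplex t"
    and trans: "\<And>t v. t \<in> T \<Longrightarrow> v \<in> t \<Longrightarrow> bary t v r = 0 \<Longrightarrow> bary t v (r + d) \<noteq> 0"
    and single: "\<And>t. t \<in> T \<Longrightarrow> r \<in> convex hull t \<Longrightarrow>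
      \<forall>v\<in>t. \<forall>w\<in>t. bary t v r = 0 \<longrightarrow> bary t w r = 0 \<longrightarrow> v = w"
  obtains m n where
    "\<forall>\<^sub>F c in at_right 0. cover_count T (r + c *\<^sub>R d) = m \<and> cover_count T (r - c *\<^sub>R d) = n"
    "even (m + n) \<longleftrightarrow> even (card {t \<in> T. on_boundary t r})"
    "(\<And>t. t \<in> T \<Longrightarrow> \<not> on_boundary t r) \<Longrightarrow> m = cover_count T r \<and> n = cover_count T r"
proof -
  define R where "R t \<beta> \<gamma> \<longleftrightarrow> (\<forall>\<^sub>F c in at_right 0. ((r + c *\<^sub>R d \<in> convex hull t) = \<beta>) \<and> ((r - c *\<^sub>R d \<in> convex hull t) = \<gamma>))
     \<and> (\<beta> \<noteq> \<gamma> \<longleftrightarrow> on_boundary t r) \<and> (\<not> on_boundary t r \<longrightarrow> \<beta> = (r \<in> convex hull t))" for t \<beta> \<gamma>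
  have "\<exists>\<beta> \<gamma>. R t \<beta> \<gamma>" if t: "t \<in> T" for t
    unfolding R_def using full_simplex_sides[OF T[OF t] trans[OF t] single[OF t]] .
  then have "\<forall>t\<in>T. \<exists>p. R t (fst p) (snd p)" by simp
  then obtain p where p: "\<forall>t\<in>T. R t (fst (p t)) (snd (p t))" by (rule bchoice[THEN exE])
  define \<beta> where "\<beta> t = fst (p t)" for t
  define \<gamma> where "\<gamma> t = snd (p t)" for t
  have R: "R t (\<beta> t) (\<gamma> t)" if "t \<in> T" for t using p that by (simp add: \<beta>_def \<gamma>_def)
  have ev: "\<And>t. t \<in> T \<Longrightarrow> \<forall>\<^sub>F c in at_right 0. ((r + c *\<^sub>R d \<in> convex hull t) = \<beta> t) \<and> ((r - c *\<^sub>R d \<in> convex hull t) = \<gamma> t)"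
    and bd: "\<And>t. t \<in> T \<Longrightarrow> \<beta> t \<noteq> \<gamma> t \<longleftrightarrow> on_boundary t r"
    and nb: "\<And>t. t \<in> T \<Longrightarrow> \<not> on_boundary t r \<Longrightarrow> \<beta> t = (r \<in> convex hull t)"
    using R unfolding R_def by blast+
  let ?A = "{t \<in> T. \<beta> t}" and ?B = "{t \<in> T. \<gamma> t}"
  have "\<forall>\<^sub>F c in at_right 0. \<forall>t\<in>T. ((r + c *\<^sub>R d \<in> convex hull t) = \<beta> t) \<and> ((r - c *\<^sub>R d \<in> convex hull t) = \<gamma> t)"
    using ev fin by (simp add: eventually_ball_finite)
  then have "\<forall>\<^sub>F c in at_right 0. cover_count T (r + c *\<^sub>R d) = card ?A \<and> cover_count T (r - c *\<^sub>R d) = card ?B"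
    by eventually_elim (auto simp: cover_count_def intro!: arg_cong[where f = card])
  moreover have "even (card ?A + card ?B) \<longleftrightarrow> even (card {t \<in> T. on_boundary t r})"
  proof -
    have "(?A - ?B) \<union> (?B - ?A) = {t \<in> T. on_boundary t r}" using bd by blast
    then show ?thesis using even_card_sum_iff_sym_diff[of ?A ?B] fin by simp
  qed
  moreover have "card ?A = cover_count T r \<and> card ?B = cover_count T r"
    if "\<And>t. t \<in> T \<Longrightarrow> \<not> on_boundary t r"
  proof -
    have "?A = {t \<in> T. r \<in> convex hull t}" "?B = {t \<in> T. r \<in> convex hull t}"
      using that bd nb by blast+
    then show ?thesis by (simp add: cover_count_def)
  qed
  ultimately show thesis by (rule that)
qed

section \<open>Parity of coverings by simplices\<close>

lemma full_simplex_facet_subset: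
  assumes "full_simplex t" "full_simplex t'" "v \<in> t" "t - {v} \<subset> t'"
  obtains v' where "v' \<in> t'" "t - {v} = t' - {v'}"
proof -
  have fin: "finite t" "finite t'" using assms full_simplex_finite by auto
  have "card (t' - (t - {v})) = 1"
    using assms fin by (subst card_Diff_subset) (auto simp: full_simplex_def)
  then obtain v' where "t' - (t - {v}) = {v'}" by (rule card_1_singletonE)
  then have "v' \<in> t'" "t - {v} = t' - {v'}" using assms(4) by blast+
  then show thesis by (rule that)
qed

text \<open>The simplices with \<open>r\<close> on their boundary are grouped by the facet that
  contains \<open>r\<close>. This facet is unique by \<open>single\<close>, so the groups are
  disjoint, and each group consists of all simplices of \<open>T\<close> over its facet, an even
  number.\<close>

lemma even_card_on_boundary:
  assumes fin: "finite T" and T: "\<And>t. t \<in> T \<Longrightarrow> full_simplex t"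
    and single: "\<And>t. t \<in> T \<Longrightarrow> r \<in> convex hull t \<Longrightarrow>
      \<forall>v\<in>t. \<forall>w\<in>t. bary t v r = 0 \<longrightarrow> bary t w r = 0 \<longrightarrow> v = w"
    and ev: "\<And>t v. t \<in> T \<Longrightarrow> v \<in> t \<Longrightarrow> r \<in> convex hull (t - {v}) \<Longrightarrow>
      even (card {t' \<in> T. t - {v} \<subset> t'})"
  shows "even (card {t \<in> T. on_boundary t r})"
proof -
  let ?F = "{f. \<exists>t\<in>T. \<exists>v\<in>t. f = t - {v} \<and> r \<in> convex hull f}"
  let ?D = "\<lambda>f. {t \<in> T. f \<subset> t}"
  have facet: "\<exists>v\<in>t. f = t - {v} \<and> r \<in> convex hull t \<and> bary t v r = 0" if f: "f \<in> ?F" and t: "t \<in> ?D f" for f t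
  proof -
    obtain t0 v0 where t0: "t0 \<in> T" "v0 \<in> t0" "f = t0 - {v0}" using f by blast
    have "t \<in> T" "t0 - {v0} \<subset> t" using t t0(3) by auto
    then obtain v where v: "v \<in> t" "f = t - {v}"
      using full_simplex_facet_subset[OF T[OF t0(1)] T t0(2)] t0(3) by metis
    have r: "r \<in> convex hull f" using f by blast
    then have "r \<in> convex hull t" using hull_mono[of f t] v by blast
    moreover have "bary t v r = 0"
      using bary_eq_0_on_face[of t f r v] T[of t] t v r full_simplex_affine_independent by blast
    ultimately show ?thesis using v by blast
  qed
  have "finite ?F"
    by (rule finite_subset[of _ "\<Union>t\<in>T. (\<lambda>v. t - {v}) ` t"])
      (use fin T full_simplex_finite in auto)
  have "{t \<in> T. on_boundary t r} = (\<Union>f\<in>?F. ?D f)"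
  proof (intro equalityI subsetI)
    fix t assume "t \<in> {t \<in> T. on_boundary t r}"
    then obtain v where v: "t \<in> T" "r \<in> convex hull t" "v \<in> t" "bary t v r = 0"
      unfolding on_boundary_def by blast
    then have "r \<in> convex hull (t - {v})" using convex_hull_facet T by metis
    then have "t - {v} \<in> ?F" using v by (intro CollectI bexI[of _ t] bexI[of _ v]) simp_all
    then show "t \<in> (\<Union>f\<in>?F. ?D f)" using v by blast
  next
    fix t assume "t \<in> (\<Union>f\<in>?F. ?D f)"
    then show "t \<in> {t \<in> T. on_boundary t r}" using facet unfolding on_boundary_def by blast
  qed
  moreover have "card (\<Union>f\<in>?F. ?D f) = (\<Sum>f\<in>?F. card (?D f))"
  proof (rule card_UN_disjoint)
    show "\<forall>f\<in>?F. \<forall>g\<in>?F. f \<noteq> g \<longrightarrow> ?D f \<inter> ?D g = {}"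
    proof (intro ballI impI, rule ccontr)
      fix f g assume fg: "f \<in> ?F" "g \<in> ?F" "f \<noteq> g" and "?D f \<inter> ?D g \<noteq> {}"
      then obtain t where t: "t \<in> ?D f" "t \<in> ?D g" by blast
      obtain v w where "v \<in> t" "f = t - {v}" "r \<in> convex hull t" "bary t v r = 0"
        "w \<in> t" "g = t - {w}" "bary t w r = 0"
        using facet[OF fg(1) t(1)] facet[OF fg(2) t(2)] by blast
      then show False using single t(1) fg(3) by blast
    qed
  qed (use fin \<open>finite ?F\<close> in auto)
  moreover have "even (\<Sum>f\<in>?F. card (?D f))"
    using ev by (intro dvd_sum) blast
  ultimately show ?thesis by simp
qed

definition generic_for :: "'a::euclidean_space set set \<Rightarrow> 'a \<Rightarrow> bool" where
  "generic_for T x \<longleftrightarrow> (\<forall>t\<in>T. \<forall>v\<in>t. bary t v x \<noteq> 0)"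

lemma generic_not_on_boundary: "generic_for T r \<Longrightarrow> t \<in> T \<Longrightarrow> \<not> on_boundary t r"
  unfolding generic_for_def on_boundary_def by blast

text \<open>Where the segment crosses a single plane, the simplices on whose boundary the crossing point lies
  are exactly those which are entered or left.\<close>
lemma cover_count_parity_segment:
  assumes fin: "finite T" and T: "\<And>t. t \<in> T \<Longrightarrow> full_simplex t"
    and x: "generic_for T x" and y: "generic_for T y"
    and one_plane: "\<And>t v t' v' r. r \<in> closed_segment x y \<Longrightarrow> t \<in> T \<Longrightarrow> v \<in> t \<Longrightarrow> t' \<in> T \<Longrightarrow> v' \<in> t' \<Longrightarrow>
      bary t v r = 0 \<Longrightarrow> bary t' v' r = 0 \<Longrightarrow> {z. bary t v z = 0} = {z. bary t' v' z = 0}"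
    and ev: "\<And>t v r. r \<in> closed_segment x y \<Longrightarrow> t \<in> T \<Longrightarrow> v \<in> t \<Longrightarrow> r \<in> convex hull (t - {v}) \<Longrightarrow>
      even (card {t' \<in> T. t - {v} \<subset> t'})"
  shows "even (cover_count T x) \<longleftrightarrow> even (cover_count T y)"
proof -
  let ?p = "\<lambda>s::real. x + s *\<^sub>R (y - x)"
  let ?P = "\<lambda>s. generic_for T (?p s)"
  let ?Q = "\<lambda>s. even (cover_count T (?p s)) \<longleftrightarrow> even (cover_count T x)"
  have line: "bary t v (?p s) = bary t v x + s * (bary t v y - bary t v x)" for t v s
    using bary_add_scaleR[of t v x s "y - x"] by simp
  have "finite {s. bary t v (?p s) = 0}" if "t \<in> T" "v \<in> t" for t v
  proof -
    have "bary t v x \<noteq> 0" using x that by (simp add: generic_for_def)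
    then have "s = - bary t v x / (bary t v y - bary t v x)" if "bary t v (?p s) = 0" for s
    proof -
      have "s * (bary t v y - bary t v x) = - bary t v x" using that unfolding line by simp
      moreover from this \<open>bary t v x \<noteq> 0\<close> have "bary t v y - bary t v x \<noteq> 0" by auto
      ultimately show ?thesis by (metis nonzero_eq_divide_eq)
    qed
    then have "{s. bary t v (?p s) = 0} \<subseteq> {- bary t v x / (bary t v y - bary t v x)}" by blast
    then show ?thesis using finite_subset by blast
  qed
  then have "finite (\<Union>t\<in>T. \<Union>v\<in>t. {s. bary t v (?p s) = 0})"
    using fin T full_simplex_finite by (intro finite_UN_I) auto
  then have finbad: "finite {s. \<not> ?P s}"
    by (rule rev_finite_subset) (auto simp: generic_for_def)
  have "?Q 1"
  \<comment> \<open>Local constancy is needed at generic parameters only. They are dense, since each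
    facet plane is met at finitely many parameters.\<close>
  proof (rule connected_induction[where S = "{0..1::real}" and P = ?P and Q = ?Q and a = 0])
    show "\<exists>z. z \<in> A \<and> ?P z" if op: "openin (top_of_set {0..1}) A" and a: "a \<in> A" for A a
    proof -
      obtain e where e: "0 < e" "\<And>s. s \<in> {0..1} \<Longrightarrow> dist s a < e \<Longrightarrow> s \<in> A" and a01: "a \<in> {0..1}"
        using op a unfolding openin_euclidean_subtopology_iff by blast
      let ?I = "{max 0 (a - e/2) .. min 1 (a + e/2)}"
      have "max 0 (a - e/2) < min 1 (a + e/2)" using e(1) a01 by auto
      then have "infinite ?I" by (simp add: infinite_Icc)
      then obtain s where s: "s \<in> ?I" "?P s"
        using finbad by (metis (mono_tags, lifting) finite_subset mem_Collect_eq subsetI)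
      then have "s \<in> A" using e by (intro e(2)) (auto simp: dist_real_def)
      then show ?thesis using s by blast
    qed
    show "\<exists>A. openin (top_of_set {0..1}) A \<and> a \<in> A \<and> (\<forall>s\<in>A. \<forall>s'\<in>A. ?P s \<and> ?P s' \<and> ?Q s \<longrightarrow> ?Q s')"
      if a: "a \<in> {0..1}" for a
    proof -
      let ?r = "?p a" and ?d = "y - x"
      have seg: "?r \<in> closed_segment x y"
        using a by (auto simp: in_segment algebra_simps intro!: exI[of _ a])
      have trans: "bary t v (?r + ?d) \<noteq> 0" if "t \<in> T" "v \<in> t" "bary t v ?r = 0" for t v
      proof -
        have "?r + ?d = ?p (a + 1)" by (simp add: algebra_simps)
        then have "bary t v (?r + ?d) = bary t v y - bary t v x"
          using line[of t v a] line[of t v "a + 1"] that(3) by (simp add: algebra_simps)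
        moreover have "bary t v x \<noteq> 0" using x that by (simp add: generic_for_def)
        ultimately show ?thesis using line[of t v a] that(3) by auto
      qed
      \<comment> \<open>Two coordinates of one simplex with a common zero on the segment would have
        the same zero plane by \<open>one_plane\<close>; but the vertex \<open>w\<close> lies on the
        plane of \<open>v\<close> and not on its own.\<close>
      have single: "\<forall>v\<in>t. \<forall>w\<in>t. bary t v ?r = 0 \<longrightarrow> bary t w ?r = 0 \<longrightarrow> v = w" if t: "t \<in> T" for t
      proof (intro ballI impI, rule ccontr)
        fix v w assume vw: "v \<in> t" "w \<in> t" "bary t v ?r = 0" "bary t w ?r = 0" "v \<noteq> w"
        then have "bary t v w = 0" "bary t w w = 1"
          using bary_vertex[OF full_simplex_affine_independent[OF T[OF t]] vw(2)] by auto
        moreover have "w \<in> {z. bary t w z = 0} \<longleftrightarrow> w \<in> {z. bary t v z = 0}"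
          using one_plane[OF seg t vw(1) t vw(2-4)] by simp
        ultimately show False by simp
      qed
      obtain m n where mn:
        "\<forall>\<^sub>F c in at_right 0. cover_count T (?r + c *\<^sub>R ?d) = m \<and> cover_count T (?r - c *\<^sub>R ?d) = n"
        "even (m + n) \<longleftrightarrow> even (card {t \<in> T. on_boundary t ?r})"
        "(\<And>t. t \<in> T \<Longrightarrow> \<not> on_boundary t ?r) \<Longrightarrow> m = cover_count T ?r \<and> n = cover_count T ?r"
        by (rule cover_count_sides[of T ?r ?d]) (use fin T trans single in simp_all)
      have even_mn: "even (m + n)"
        unfolding mn(2) by (rule even_card_on_boundary[OF fin T single ev[OF seg]])
      obtain \<delta> where \<delta>: "0 < \<delta>"
        "\<And>c. 0 < c \<Longrightarrow> c < \<delta> \<Longrightarrow> cover_count T (?r + c *\<^sub>R ?d) = m \<and> cover_count T (?r - c *\<^sub>R ?d) = n"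
        using mn(1) unfolding eventually_at_right_field by auto
      have near: "even (cover_count T (?p s)) \<longleftrightarrow> even m" if "\<bar>s - a\<bar> < \<delta>" "?P s" for s
      proof -
        consider "s = a" | "a < s" | "s < a" by linarith
        then show ?thesis
        proof cases
          case 1
          then show ?thesis using mn(3) that(2) generic_not_on_boundary by blast
        next
          case 2
          have "?p s = ?r + (s - a) *\<^sub>R ?d" by (simp add: algebra_simps)
          then have "cover_count T (?p s) = m" using \<delta>(2)[of "s - a"] that(1) 2 by (simp only: abs_of_pos diff_gt_0_iff_gt)
          then show ?thesis by simp
        next
          case 3
          have "?p s = ?r - (a - s) *\<^sub>R ?d" by (simp add: algebra_simps)
          then have "cover_count T (?p s) = n" using \<delta>(2)[of "a - s"] that(1) 3 by (simp only: abs_of_neg diff_gt_0_iff_gt diff_less_0_iff_less minus_diff_eq)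
          then show ?thesis using even_mn by simp
        qed
      qed
      let ?A = "{0..1} \<inter> ball a \<delta>"
      have "openin (top_of_set {0..1}) ?A" by (simp add: openin_open_Int)
      moreover have "a \<in> ?A" using a \<delta>(1) by simp
      moreover have "\<forall>s\<in>?A. \<forall>s'\<in>?A. ?P s \<and> ?P s' \<and> ?Q s \<longrightarrow> ?Q s'"
        using near by (auto simp: dist_real_def abs_minus_commute)
      ultimately show ?thesis by blast
    qed
    show "?P 0" "?P 1" using x y by simp_all
  qed auto
  then show ?thesis by simp
qed

lemma finite_planes:
  assumes "finite T" "\<And>t. t \<in> T \<Longrightarrow> full_simplex t"
  shows "finite {A. \<exists>t\<in>T. \<exists>v\<in>t. A = {z. bary t v z = 0}}"
  by (rule finite_subset[of _ "\<Union>t\<in>T. (\<lambda>v. {z. bary t v z = 0}) ` t"])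
    (use assms full_simplex_finite in auto)

text \<open>Connectedness reduces the claim to a small ball. There the segment between two generic
  points may still meet two facet planes in one point. Moving one endpoint slightly prevents this:
  the intersections of two distinct planes, joined to the other endpoint, fill only finitely many
  sets of lower dimension.\<close>

lemma cover_count_parity_connected:
  fixes T :: "'a::euclidean_space set set"
  assumes fin: "finite T" and T: "\<And>t. t \<in> T \<Longrightarrow> full_simplex t"
    and U: "open U" "connected U"
    and odd: "\<And>t v. t \<in> T \<Longrightarrow> v \<in> t \<Longrightarrow> odd (card {t' \<in> T. t - {v} \<subset> t'}) \<Longrightarrow> U \<inter> convex hull (t - {v}) = {}"
    and x: "x \<in> U" "generic_for T x" and y: "y \<in> U" "generic_for T y"
  shows "even (cover_count T x) \<longleftrightarrow> even (cover_count T y)"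
proof -
  define planes where "planes = {A. \<exists>t\<in>T. \<exists>v\<in>t. A = {z. bary t v z = 0}}"
  have fin_planes: "finite planes" unfolding planes_def by (rule finite_planes[OF fin T])
  have planes_dim: "affine A" "aff_dim A = int DIM('a) - 1" if A: "A \<in> planes" for A
  proof -
    obtain t v where "t \<in> T" "v \<in> t" "A = {z. bary t v z = 0}" using A unfolding planes_def by blast
    then show "affine A" "aff_dim A = int DIM('a) - 1" using bary_hyperplane_aff_dim T by blast+
  qed
  have generic_iff: "generic_for T z \<longleftrightarrow> (\<forall>A\<in>planes. z \<notin> A)" for z
    unfolding generic_for_def planes_def by blast
  let ?Q = "\<lambda>z. even (cover_count T z) \<longleftrightarrow> even (cover_count T x)"
  have "?Q y"
  proof (rule connected_induction[where P = "generic_for T" and Q = ?Q and a = x, OF U(2)])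
    show "\<exists>z. z \<in> A \<and> generic_for T z" if "openin (top_of_set U) A" "a \<in> A" for A a
    proof -
      have "open A" using that U(1) openin_open_eq by blast
      then show ?thesis
        using avoid_lowdim[OF fin_planes, of A] planes_dim that(2) generic_iff
        by (metis empty_iff int_ops(2) less_add_one minus_add_cancel uminus_add_conv_diff diff_add_cancel)
    qed
    show "\<exists>A. openin (top_of_set U) A \<and> a \<in> A \<and>
        (\<forall>x'\<in>A. \<forall>y'\<in>A. generic_for T x' \<and> generic_for T y' \<and> ?Q x' \<longrightarrow> ?Q y')" if a: "a \<in> U" for a
    proof -
      obtain e where e: "0 < e" "ball a e \<subseteq> U" using U(1) a by (meson open_contains_ball)
      have same: "even (cover_count T p) \<longleftrightarrow> even (cover_count T q)"
        if p: "p \<in> ball a e" "generic_for T p" and q: "q \<in> ball a e" "generic_for T q" for p q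
      proof -
        \<comment> \<open>In this neighbourhood of \<open>q\<close> all coordinates keep the sign
          they have at \<open>q\<close>, so the covering number does not change.\<close>
        let ?O = "ball a e \<inter> (\<Inter>t\<in>T. \<Inter>v\<in>t. {z. 0 < bary t v z * bary t v q})"
        have "open {z. 0 < bary t v z * bary t v q}" for t v
          by (intro open_Collect_less continuous_intros continuous_on_subset[OF continuous_bary]) auto
        then have "open ?O"
          using fin T full_simplex_finite by (intro open_Int open_INT ballI) auto
        moreover have "q \<in> ?O"
          using q unfolding generic_for_def by (auto simp: zero_less_mult_iff) (metis linorder_neqE_linordered_idom)
        \<comment> \<open>If the segment from \<open>p\<close> to \<open>q'\<close> met two distinct
          planes in one point, then \<open>q'\<close> would lie in the affine span of
          \<open>p\<close> and their intersection, because \<open>p\<close> itself is on neither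
          plane.\<close>
        moreover define H where "H = (\<lambda>(A, B). affine hull (insert p (A \<inter> B))) ` {(A, B). A \<in> planes \<and> B \<in> planes \<and> A \<noteq> B}"
        have "finite H" unfolding H_def
          by (rule finite_imageI, rule finite_subset[of _ "planes \<times> planes"]) (use fin_planes in auto)
        moreover have "aff_dim C < DIM('a)" if C: "C \<in> H" for C
        proof -
          obtain A B where AB: "A \<in> planes" "B \<in> planes" "A \<noteq> B" "C = affine hull (insert p (A \<inter> B))"
            using C unfolding H_def by blast
          have "A \<noteq> {}" using planes_dim(2)[OF AB(1)] DIM_positive[where 'a='a]
            by (metis aff_dim_empty diff_add_cancel of_nat_0_less_iff add.left_inverse less_irrefl)
          have "\<not> A \<subseteq> B" using AB affine_dim_equal[of A B] planes_dim \<open>A \<noteq> {}\<close> by metis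
          then have "affine hull (A \<inter> B) \<subset> affine hull A"
            using planes_dim(1)[OF AB(1)] planes_dim(1)[OF AB(2)]
            by (simp add: affine_hull_eq[THEN iffD2] affine_Int) blast
          then have "aff_dim (A \<inter> B) < int DIM('a) - 1"
            using aff_dim_psubset[of "A \<inter> B" A] planes_dim(2)[OF AB(1)] by simp
          then show ?thesis unfolding AB(4) aff_dim_affine_hull by (simp add: aff_dim_insert)
        qed
        ultimately obtain q' where q': "q' \<in> ?O" "\<And>C. C \<in> H \<Longrightarrow> q' \<notin> C"
          using avoid_lowdim[of H ?O] by blast
        have q'_sign: "0 < bary t v q' * bary t v q" if "t \<in> T" "v \<in> t" for t v
          using q'(1) that by blast
        have gen_q': "generic_for T q'" unfolding generic_for_def using q'_sign by force
        have "cover_count T q' = cover_count T q"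
        proof -
          have "(0 \<le> bary t v q') = (0 \<le> bary t v q)" if "t \<in> T" "v \<in> t" for t v
            using q'_sign[OF that] by (auto simp: zero_less_mult_iff)
          then have "{t \<in> T. q' \<in> convex hull t} = {t \<in> T. q \<in> convex hull t}"
            using T by (auto simp: full_simplex_convex_hull)
          then show ?thesis by (simp add: cover_count_def)
        qed
        moreover have "even (cover_count T p) \<longleftrightarrow> even (cover_count T q')"
        proof (rule cover_count_parity_segment[OF fin T p(2) gen_q'])
          fix t v t' v' r
          assume r: "r \<in> closed_segment p q'" and tv: "t \<in> T" "v \<in> t" "t' \<in> T" "v' \<in> t'"
            and 0: "bary t v r = 0" "bary t' v' r = 0"
          show "{z. bary t v z = 0} = {z. bary t' v' z = 0}" (is "?A = ?B")
          proof (rule ccontr)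
            assume "?A \<noteq> ?B"
            then have C: "affine hull (insert p (?A \<inter> ?B)) \<in> H"
              using tv unfolding H_def planes_def by blast
            obtain c where c: "r = (1 - c) *\<^sub>R p + c *\<^sub>R q'" using r by (auto simp: in_segment)
            have "c \<noteq> 0" using c 0(1) p(2) tv(1,2) by (auto simp: generic_for_def)
            have "c *\<^sub>R q' = r - (1 - c) *\<^sub>R p" using c by simp
            then have "q' = (1 / c) *\<^sub>R (r - (1 - c) *\<^sub>R p)"
              using \<open>c \<noteq> 0\<close> by (metis divide_self_if one_neq_zero scaleR_one scaleR_scaleR times_divide_eq_left mult_1)
            also have "\<dots> = (1 - 1 / c) *\<^sub>R p + (1 / c) *\<^sub>R r"
              using \<open>c \<noteq> 0\<close> by (simp add: algebra_simps)
            also have "\<dots> \<in> affine hull (insert p (?A \<inter> ?B))"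
              using 0 by (intro mem_affine[OF affine_affine_hull] hull_inc) auto
            finally show False using q'(2)[OF C] by blast
          qed
        next
          fix t v r
          assume r: "r \<in> closed_segment p q'" and tv: "t \<in> T" "v \<in> t" "r \<in> convex hull (t - {v})"
          have "q' \<in> ball a e" using q'(1) by simp
          then have "r \<in> ball a e" using r closed_segment_subset[OF p(1) _ convex_ball] by blast
          then show "even (card {t' \<in> T. t - {v} \<subset> t'})" using odd[OF tv(1,2)] e(2) tv(3) by blast
        qed
        ultimately show ?thesis by simp
      qed
      show ?thesis
      proof (intro exI[of _ "ball a e"] conjI ballI impI)
        show "openin (top_of_set U) (ball a e)" using e(2) U(1) by (simp add: openin_open_eq)
        show "a \<in> ball a e" using e(1) by simp
        show "?Q y'" if "x' \<in> ball a e" "y' \<in> ball a e" "generic_for T x' \<and> generic_for T y' \<and> ?Q x'" for x' y'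
          using same[of x' y'] that by simp
      qed
    qed
  qed (use x y in auto)
  then show ?thesis by blast
qed

section \<open>Tetrahedra of a geometric complex\<close>

definition barycenter :: "'a::euclidean_space set \<Rightarrow> 'a" where
  "barycenter s = (\<Sum>v\<in>s. (1 / card s) *\<^sub>R v)"

lemma barycenter_in_convex_hull:
  assumes "finite s" "s \<noteq> {}" shows "barycenter s \<in> convex hull s"
  unfolding barycenter_def convex_hull_finite[OF assms(1)]
  using assms by (intro CollectI exI[of _ "\<lambda>v. 1 / card s"] conjI) simp_all

lemma bary_barycenter:
  assumes "\<not> affine_dependent t" "s \<subseteq> t" "s \<noteq> {}" "v \<in> t"
  shows "bary t v (barycenter s) = (if v \<in> s then 1 / card s else 0)"
proof -
  have fin: "finite s" using assms aff_independent_finite finite_subset by blast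
  have "bary t v (barycenter s) = (\<Sum>w\<in>s. 1 / card s * bary t v w)"
    unfolding barycenter_def using fin assms(3) by (intro bary_sum) auto
  also have "\<dots> = (\<Sum>w\<in>s. 1 / card s * (if w = v then 1 else 0))"
    using assms by (intro sum.cong refl) (simp add: bary_vertex subset_iff)
  also have "\<dots> = (if v \<in> s then 1 / card s else 0)"
    using fin by (simp add: if_distrib cong: if_cong)
  finally show ?thesis .
qed

text \<open>For a full simplex this is its interior; the inequalities make openness and convexity
  immediate.\<close>

definition core :: "'a::euclidean_space set \<Rightarrow> 'a set" where
  "core t = {x. \<forall>v\<in>t. 0 < bary t v x}"

lemma open_core: "finite t \<Longrightarrow> open (core t)"
proof -
  assume "finite t"
  moreover have "core t = (\<Inter>v\<in>t. {x. 0 < bary t v x})" by (auto simp: core_def)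
  moreover have "open {x. 0 < bary t v x}" for v
    by (intro open_Collect_less continuous_bary continuous_intros)
  ultimately show ?thesis by auto
qed

lemma convex_core: "convex (core t)"
proof -
  have "convex {x. 0 < bary t v x}" for v
  proof -
    obtain a b where "\<And>x. bary t v x = a \<bullet> x + b" using bary_inner by metis
    then have "{x. 0 < bary t v x} = {x. a \<bullet> x > - b}" by force
    then show ?thesis by (simp add: convex_halfspace_gt)
  qed
  moreover have "core t = (\<Inter>v\<in>t. {x. 0 < bary t v x})" by (auto simp: core_def)
  ultimately show ?thesis by (simp add: convex_INT)
qed

lemma barycenter_in_core:
  assumes "full_simplex t" shows "barycenter t \<in> core t"
proof -
  have "0 < card t" "t \<noteq> {}" using assms by (auto simp: full_simplex_def)
  then show ?thesis
    using bary_barycenter[OF full_simplex_affine_independent[OF assms]] by (auto simp: core_def)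
qed

lemma core_subset_convex_hull: "full_simplex t \<Longrightarrow> core t \<subseteq> convex hull t"
  by (auto simp: core_def full_simplex_convex_hull less_imp_le)

lemma generic_in_core:
  assumes "full_simplex t" "x \<in> convex hull t" "generic_for {t} x" shows "x \<in> core t"
  using assms unfolding core_def generic_for_def full_simplex_convex_hull[OF assms(1)]
  by (simp add: order_less_le)

text \<open>The hypothesis ensures that the line does not lie in the hyperplane. It then meets the
  hyperplane at most once, and points near \<open>r\<close> other than \<open>r\<close> avoid
  it.\<close>

lemma avoid_hyperplane_near:
  assumes "a \<bullet> (r + d) \<noteq> (b::real)"
  shows "\<forall>\<^sub>F c in at_right 0. a \<bullet> (r + c *\<^sub>R d) \<noteq> b \<and> a \<bullet> (r - c *\<^sub>R d) \<noteq> b"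
proof (cases "a \<bullet> r = b")
  case True
  then have "a \<bullet> d \<noteq> 0" using assms by (simp add: inner_right_distrib)
  have "\<forall>\<^sub>F c in at_right (0::real). 0 < c" by (simp add: eventually_at_right_less)
  then show ?thesis
    by eventually_elim (use True \<open>a \<bullet> d \<noteq> 0\<close> in \<open>simp add: inner_right_distrib inner_diff_right\<close>)
next
  case False
  have "((\<lambda>c. a \<bullet> (r + c *\<^sub>R d)) \<longlongrightarrow> a \<bullet> (r + 0 *\<^sub>R d)) (at_right 0)"
    "((\<lambda>c. a \<bullet> (r - c *\<^sub>R d)) \<longlongrightarrow> a \<bullet> (r - 0 *\<^sub>R d)) (at_right 0)"
    by (intro tendsto_intros)+
  then have "\<forall>\<^sub>F c in at_right 0. a \<bullet> (r + c *\<^sub>R d) \<noteq> b" "\<forall>\<^sub>F c in at_right 0. a \<bullet> (r - c *\<^sub>R d) \<noteq> b"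
    using False by (auto intro!: tendsto_imp_eventually_ne)
  then show ?thesis by (rule eventually_conj)
qed

lemma generic_near:
  assumes "finite T" "\<And>t. t \<in> T \<Longrightarrow> full_simplex t" "generic_for T (r + d)"
  shows "\<forall>\<^sub>F c in at_right 0. generic_for T (r + c *\<^sub>R d) \<and> generic_for T (r - c *\<^sub>R d)"
proof -
  have "\<forall>\<^sub>F c in at_right 0. bary t v (r + c *\<^sub>R d) \<noteq> 0 \<and> bary t v (r - c *\<^sub>R d) \<noteq> 0"
    if tv: "t \<in> T" "v \<in> t" for t v
  proof -
    obtain a b where ab: "\<And>x. bary t v x = a \<bullet> x + b" using bary_inner by metis
    have "a \<bullet> (r + d) \<noteq> - b" using assms(3) tv ab[of "r + d"] by (auto simp: generic_for_def)
    from avoid_hyperplane_near[OF this] show ?thesis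
      by eventually_elim (simp add: ab eq_neg_iff_add_eq_0)
  qed
  then have "\<forall>\<^sub>F c in at_right 0. \<forall>t\<in>T. \<forall>v\<in>t. bary t v (r + c *\<^sub>R d) \<noteq> 0 \<and> bary t v (r - c *\<^sub>R d) \<noteq> 0"
    using assms full_simplex_finite by (intro eventually_ball_finite ballI) auto
  then show ?thesis by eventually_elim (auto simp: generic_for_def)
qed

lemma generic_avoiding:
  fixes S :: "'a::euclidean_space set"
  assumes "finite T" "\<And>t. t \<in> T \<Longrightarrow> full_simplex t" "finite H" "\<And>A. A \<in> H \<Longrightarrow> aff_dim A < DIM('a)"
    "open S" "S \<noteq> {}"
  obtains x where "x \<in> S" "generic_for T x" "\<And>A. A \<in> H \<Longrightarrow> x \<notin> A"
proof -
  define P where "P = {A. \<exists>t\<in>T. \<exists>v\<in>t. A = {z. bary t v z = 0}}"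
  have fin: "finite (P \<union> H)" using finite_planes[OF assms(1,2)] assms(3) by (simp add: P_def)
  have dim: "aff_dim A < DIM('a)" if "A \<in> P \<union> H" for A
  proof (cases "A \<in> H")
    case False
    then obtain t v where "t \<in> T" "v \<in> t" "A = {z. bary t v z = 0}" using \<open>A \<in> P \<union> H\<close> P_def by blast
    then show ?thesis using assms(2) bary_hyperplane_aff_dim(2)[of t v] by simp
  qed (use assms(4) in blast)
  obtain x where x: "x \<in> S" "\<And>A. A \<in> P \<union> H \<Longrightarrow> x \<notin> A"
    using avoid_lowdim[OF fin dim assms(5,6)] by metis
  have "generic_for T x" unfolding generic_for_def
  proof (intro ballI)
    fix t v assume "t \<in> T" "v \<in> t"
    then have "{z. bary t v z = 0} \<in> P" unfolding P_def by blast
    then show "bary t v x \<noteq> 0" using x(2)[of "{z. bary t v z = 0}"] by simp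
  qed
  then show thesis using x by (intro that) auto
qed

lemma simplex_finite: "simplicial_complex K \<Longrightarrow> \<sigma> \<in> K \<Longrightarrow> finite \<sigma>"
  and simplex_nonempty: "simplicial_complex K \<Longrightarrow> \<sigma> \<in> K \<Longrightarrow> \<sigma> \<noteq> {}"
  and simplex_affine_independent: "simplicial_complex K \<Longrightarrow> \<sigma> \<in> K \<Longrightarrow> \<not> affine_dependent \<sigma>"
  and simplex_face: "simplicial_complex K \<Longrightarrow> \<sigma> \<in> K \<Longrightarrow> \<tau> \<subseteq> \<sigma> \<Longrightarrow> \<tau> \<noteq> {} \<Longrightarrow> \<tau> \<in> K"
  and simplicial_complex_finite: "simplicial_complex K \<Longrightarrow> finite K"
  unfolding simplicial_complex_def by blast+

definition tets :: "'a set set \<Rightarrow> 'a set set" where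
  "tets K = {t\<in>K. card t = 4}"

lemma tets_full_simplex:
  assumes "simplicial_complex K" "t \<in> tets K" shows "full_simplex t"
proof -
  have "t \<in> K" "card t = 4" using assms(2) by (auto simp: tets_def)
  moreover from this have "\<not> affine_dependent t" using assms(1) unfolding simplicial_complex_def by blast
  ultimately show ?thesis by (simp add: full_simplex_def)
qed

lemma simplicial_complex_tets_finite:
  assumes "simplicial_complex K" shows "finite (tets K)"
proof -
  have "finite K" using assms unfolding simplicial_complex_def by blast
  then show ?thesis by (simp add: tets_def)
qed

text \<open>A point of \<open>s\<close> with no vanishing coordinate lies on no proper face of
  \<open>s\<close>. As it lies in the hull of the common face \<open>s \<inter> t\<close>, that face
  is all of \<open>s\<close>.\<close>

lemma bary_pos_subset:
  assumes K: "simplicial_complex K" "s \<in> K" "t \<in> K"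
    and x: "x \<in> convex hull s" "x \<in> convex hull t" "\<forall>v\<in>s. bary s v x \<noteq> 0"
  shows "s \<subseteq> t"
proof
  fix v assume v: "v \<in> s"
  have "x \<in> convex hull (s \<inter> t)" "\<not> affine_dependent s"
    using assms unfolding simplicial_complex_def by blast+
  then show "v \<in> t" using bary_eq_0_on_face[of s "s \<inter> t" x v] x(3) v by blast
qed

lemma core_tet_unique:
  assumes K: "simplicial_complex K" "\<forall>\<sigma>\<in>K. card \<sigma> \<le> 4" and t: "t \<in> tets K" "x \<in> core t"
    and t': "t' \<in> K" "x \<in> convex hull t'"
  shows "t' = t"
proof -
  have full: "full_simplex t" using tets_full_simplex[OF K(1) t(1)] .
  have "t \<subseteq> t'"
    using bary_pos_subset[OF K(1), of t t' x] t t' core_subset_convex_hull[OF full]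
    by (force simp: tets_def core_def)
  moreover have "finite t'" using K(1) t'(1) unfolding simplicial_complex_def by blast
  moreover have "card t' \<le> card t" using K(2) t'(1) t(1) by (simp add: tets_def)
  ultimately show ?thesis by (metis card_seteq)
qed

lemma cover_count_core:
  assumes K: "simplicial_complex K" "\<forall>\<sigma>\<in>K. card \<sigma> \<le> 4" and S: "S \<subseteq> tets K"
    and t: "t \<in> tets K" "x \<in> core t"
  shows "cover_count S x = (if t \<in> S then 1 else 0)"
proof -
  have "{s \<in> S. x \<in> convex hull s} = S \<inter> {t}"
    using core_tet_unique[OF K t] S core_subset_convex_hull[OF tets_full_simplex[OF K(1) t(1)]] t(2)
    by (auto simp: tets_def)
  then show ?thesis by (simp add: cover_count_def)
qed

lemma bounded_cover:
  fixes T :: "'a::euclidean_space set set"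
  assumes "finite T" "\<And>t. t \<in> T \<Longrightarrow> finite t"
  shows "bounded (\<Union>t\<in>T. convex hull t)"
  using assms by (intro bounded_UN ballI bounded_convex_hull) (auto intro: finite_imp_bounded)

text \<open>The reference point for parities, covered by nothing.\<close>

lemma far_generic_point:
  fixes T :: "'a::euclidean_space set set"
  assumes "finite T" "\<And>t. t \<in> T \<Longrightarrow> full_simplex t" "bounded B"
  obtains y where "y \<notin> B" "generic_for T y" "cover_count T y = 0"
proof -
  have "bounded (\<Union>t\<in>T. convex hull t)"
    by (rule bounded_cover[OF assms(1) full_simplex_finite[OF assms(2)]])
  then have "bounded (B \<union> (\<Union>t\<in>T. convex hull t))"
    by (simp only: bounded_Un assms(3))
  then obtain R where R: "B \<union> (\<Union>t\<in>T. convex hull t) \<subseteq> ball 0 R" using bounded_subset_ballD by blast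
  have "open (- cball (0::'a) R)" by (simp add: open_Compl)
  moreover have "- cball (0::'a) R \<noteq> {}"
    using not_bounded_UNIV[where 'a='a] bounded_cball[of "0::'a" R] by (metis double_complement Compl_empty_eq)
  ultimately obtain y where y: "y \<in> - cball 0 R" "generic_for T y"
    using generic_avoiding[OF assms(1,2), of "{}" "- cball 0 R"] by (metis empty_iff finite.emptyI)
  have "y \<notin> ball 0 R" using y(1) by simp
  then have "y \<notin> B" "{s \<in> T. y \<in> convex hull s} = {}" using R by blast+
  then show thesis using y(2) that by (metis card.empty cover_count_def)
qed

text \<open>There are no nonzero 3-cycles modulo 2 in space: if all facets were even, the parity of
  the covering number would be constant on generic points, but it is odd inside a tetrahedron of
  \<open>S\<close> and even far away.\<close>

lemma exists_odd_facet:
  assumes K: "simplicial_complex K" "\<forall>\<sigma>\<in>K. card \<sigma> \<le> 4" and S: "S \<subseteq> tets K" "S \<noteq> {}"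
  shows "\<exists>t\<in>S. \<exists>v\<in>t. odd (card {t' \<in> S. t - {v} \<subset> t'})"
proof (rule ccontr)
  assume "\<not> ?thesis"
  then have ev: "\<And>t v. t \<in> S \<Longrightarrow> v \<in> t \<Longrightarrow> even (card {t' \<in> S. t - {v} \<subset> t'})" by blast
  have fin: "finite S" using S(1) simplicial_complex_tets_finite[OF K(1)] finite_subset by blast
  have full: "\<And>t. t \<in> S \<Longrightarrow> full_simplex t" using tets_full_simplex[OF K(1)] S(1) by blast
  obtain t where t: "t \<in> S" using S(2) by blast
  have "core t \<noteq> {}" "open (core t)"
    using barycenter_in_core open_core full_simplex_finite full[OF t] by blast+
  then obtain x where x: "x \<in> core t" "generic_for S x"
    using generic_avoiding[OF fin full, of "{}" "core t"] by (metis empty_iff finite.emptyI)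
  obtain y where y: "generic_for S y" "cover_count S y = 0"
    using far_generic_point[OF fin full bounded_empty] by metis
  have "cover_count S x = 1"
    using cover_count_core[OF K S(1) _ x(1)] t S(1) by auto
  moreover have "even (cover_count S x) \<longleftrightarrow> even (cover_count S y)"
    by (rule cover_count_parity_connected[OF fin full open_UNIV connected_UNIV]) (use ev x y in auto)
  ultimately show False using y(2) by simp
qed

text \<open>Every tetrahedron over the triangle contains points just off its barycentre on one of the two sides,
  and a generic point lies in at most one tetrahedron.\<close>
lemma card_tets_over_triangle:
  assumes K: "simplicial_complex K" "\<forall>\<sigma>\<in>K. card \<sigma> \<le> 4" and f: "f \<in> triangles K"
  shows "card {t \<in> tets K. f \<subset> t} \<le> 2"
proof -
  let ?T = "{t \<in> tets K. f \<subset> t}" and ?r = "barycenter f"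
  have fin: "finite (tets K)" using simplicial_complex_tets_finite[OF K(1)] .
  note full = tets_full_simplex[OF K(1)]
  have f': "finite f" "f \<noteq> {}" "card f = 3" using f by (auto simp: triangles_def intro: card_ge_0_finite)
  obtain z where z: "generic_for (tets K) z"
    using generic_avoiding[OF fin full, of "{}" UNIV] by (metis UNIV_not_empty empty_iff finite.emptyI open_UNIV)
  \<comment> \<open>Directed at a generic point, the line through the barycentre lies in no facet
    plane of a tetrahedron.\<close>
  let ?d = "z - ?r"
  have gen: "\<forall>\<^sub>F c in at_right 0. generic_for (tets K) (?r + c *\<^sub>R ?d) \<and> generic_for (tets K) (?r - c *\<^sub>R ?d)"
    using generic_near[OF fin full, of ?r ?d] z by simp
  have "\<forall>\<^sub>F c in at_right 0. ?r + c *\<^sub>R ?d \<in> convex hull t \<or> ?r - c *\<^sub>R ?d \<in> convex hull t" if "t \<in> ?T" for t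
  proof -
    have t: "t \<in> tets K" "f \<subset> t" using that by auto
    note ind = full_simplex_affine_independent[OF full[OF t(1)]]
    have bf: "bary t v ?r = (if v \<in> f then 1 / 3 else 0)" if "v \<in> t" for v
      using bary_barycenter[OF ind _ f'(2) that] t(2) f'(3) by auto
    have "card (t - f) = 1"
      using t f' by (subst card_Diff_subset) (auto simp: tets_def)
    then obtain u where u: "t - f = {u}" by (rule card_1_singletonE)
    have "?r \<in> convex hull t"
      using barycenter_in_convex_hull[OF f'(1,2)] hull_mono[of f t] t(2) by blast
    moreover have "u \<in> t" "u \<notin> f" using u by blast+
    ultimately have "on_boundary t ?r" unfolding on_boundary_def using bf by auto
    moreover have "\<forall>v\<in>t. \<forall>w\<in>t. bary t v ?r = 0 \<longrightarrow> bary t w ?r = 0 \<longrightarrow> v = w"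
      using bf u by (metis DiffI divide_eq_0_iff one_neq_zero singletonD zero_neq_numeral)
    moreover have "bary t v (?r + ?d) \<noteq> 0" if "v \<in> t" for v
      using z t(1) that by (simp add: generic_for_def)
    ultimately obtain \<beta> \<gamma> where bg:
      "\<forall>\<^sub>F c in at_right 0. ((?r + c *\<^sub>R ?d \<in> convex hull t) = \<beta>) \<and> ((?r - c *\<^sub>R ?d \<in> convex hull t) = \<gamma>)"
      "\<beta> \<noteq> \<gamma>"
      using full_simplex_sides[OF full[OF t(1)], of ?r ?d] by auto
    from bg(1) show ?thesis by eventually_elim (use bg(2) in auto)
  qed
  then have "\<forall>\<^sub>F c in at_right 0. \<forall>t\<in>?T. ?r + c *\<^sub>R ?d \<in> convex hull t \<or> ?r - c *\<^sub>R ?d \<in> convex hull t"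
    using fin by (intro eventually_ball_finite) auto
  with gen have "\<forall>\<^sub>F c in at_right 0. (generic_for (tets K) (?r + c *\<^sub>R ?d) \<and> generic_for (tets K) (?r - c *\<^sub>R ?d)) \<and>
      (\<forall>t\<in>?T. ?r + c *\<^sub>R ?d \<in> convex hull t \<or> ?r - c *\<^sub>R ?d \<in> convex hull t)"
    by (rule eventually_conj)
  then obtain c where c: "generic_for (tets K) (?r + c *\<^sub>R ?d)" "generic_for (tets K) (?r - c *\<^sub>R ?d)"
      "\<forall>t\<in>?T. ?r + c *\<^sub>R ?d \<in> convex hull t \<or> ?r - c *\<^sub>R ?d \<in> convex hull t"
    using eventually_happens trivial_limit_at_right_real by blast
  have le1: "card {t \<in> tets K. x \<in> convex hull t} \<le> 1" if "generic_for (tets K) x" for x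
  proof (cases "\<exists>t\<in>tets K. x \<in> convex hull t")
    case True
    then obtain t where t: "t \<in> tets K" "x \<in> convex hull t" by blast
    then have "x \<in> core t" using generic_in_core[OF full[OF t(1)] t(2)] that by (simp add: generic_for_def)
    then show ?thesis
      using cover_count_core[OF K subset_refl t(1)] by (simp add: cover_count_def)
  next
    case False
    then have "{t \<in> tets K. x \<in> convex hull t} = {}" by blast
    then show ?thesis by (simp only: card.empty)
  qed
  have "card ?T \<le> card ({t \<in> tets K. ?r + c *\<^sub>R ?d \<in> convex hull t} \<union> {t \<in> tets K. ?r - c *\<^sub>R ?d \<in> convex hull t})"
    using c(3) fin by (intro card_mono) auto
  also have "\<dots> \<le> 1 + 1"
    by (rule order_trans[OF card_Un_le add_mono[OF le1[OF c(1)] le1[OF c(2)]]])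
  finally show ?thesis by simp
qed

section \<open>Cycles of triangles bound\<close>

lemma barycenter_on_face:
  assumes K: "simplicial_complex K" "s \<in> K" "t \<in> K" and "barycenter s \<in> convex hull t"
  shows "s \<subseteq> t"
proof (rule bary_pos_subset[OF K _ assms(4)])
  have s: "finite s" "s \<noteq> {}" "\<not> affine_dependent s"
    using K simplex_finite simplex_nonempty simplex_affine_independent by blast+
  then show "barycenter s \<in> convex hull s" by (intro barycenter_in_convex_hull)
  show "\<forall>v\<in>s. bary s v (barycenter s) \<noteq> 0"
    using bary_barycenter[OF s(3) subset_refl s(2)] s(1,2) by simp
qed

text \<open>The first condition keeps the cone simplices apart from those of \<open>K\<close>, and
  the second makes the cone over a triangle a full simplex. The third keeps the walls over edges
  away from the barycentres of triangles, which later serve as test points.\<close>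

lemma cone_apex:
  assumes K: "simplicial_complex K"
  obtains q :: pt where "q \<notin> \<Union>K" "\<And>f. f \<in> triangles K \<Longrightarrow> q \<notin> affine hull f"
    "\<And>e f. e \<in> edges K \<Longrightarrow> f \<in> triangles K \<Longrightarrow> q \<notin> affine hull (insert (barycenter f) e)"
proof -
  let ?H = "(\<lambda>v. {v}) ` (\<Union>K) \<union> (\<lambda>f. affine hull f) ` triangles K \<union>
    (\<lambda>(e, f). affine hull (insert (barycenter f) e)) ` (edges K \<times> triangles K)"
  have fin: "finite ?H"
    using simplicial_complex_finite[OF K] simplex_finite[OF K] by (auto simp: triangles_def edges_def)
  have dim: "aff_dim A < DIM(pt)" if A: "A \<in> ?H" for A
  proof -
    consider v where "A = {v}" | f where "f \<in> triangles K" "A = affine hull f"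
      | e f where "e \<in> edges K" "f \<in> triangles K" "A = affine hull (insert (barycenter f) e)"
      using A by auto
    then show ?thesis
    proof cases
      case (2 f)
      then have "finite f" "card f = 3" by (auto simp: triangles_def intro: card_ge_0_finite)
      then have "aff_dim f \<le> 2" using aff_dim_le_card[of f] by simp
      then show ?thesis using 2 by simp
    next
      case (3 e f)
      then have "finite e" "card e = 2" by (auto simp: edges_def intro: card_ge_0_finite)
      then have "aff_dim e \<le> 1" using aff_dim_le_card[of e] by simp
      then show ?thesis using 3 by (simp add: aff_dim_insert)
    qed simp
  qed
  obtain q where q: "\<And>A. A \<in> ?H \<Longrightarrow> q \<notin> A"
    using avoid_lowdim[OF fin dim open_UNIV UNIV_not_empty] by metis
  show thesis
  proof (rule that)
    show "q \<notin> \<Union>K"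
    proof
      assume "q \<in> \<Union>K"
      then have "{q} \<in> ?H" by blast
      from q[OF this] show False by simp
    qed
    show "q \<notin> affine hull f" if "f \<in> triangles K" for f using that by (intro q) blast
    show "q \<notin> affine hull (insert (barycenter f) e)" if "e \<in> edges K" "f \<in> triangles K" for e f
      using that by (intro q) blast
  qed
qed

lemma facet_edge:
  assumes K: "simplicial_complex K" and f: "f \<in> triangles K" "v \<in> f"
  shows "f - {v} \<in> edges K"
proof -
  have "card (f - {v}) = 2" "f \<in> K" using f by (auto simp: triangles_def)
  moreover from this have "f - {v} \<noteq> {}" by force
  ultimately show ?thesis using simplex_face[OF K] by (auto simp: edges_def)
qed

text \<open>The cone over the cycle from a generic apex has the cycle as its boundary, so the number of cone
  simplices over a point is, modulo 2, locally constant off the cycle. It vanishes outside the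
  polyhedron, whose complement is connected; the tetrahedra where it is odd form the chain sought.\<close>
lemma cycle_is_boundary:
  assumes K: "simplicial_complex K" "\<forall>\<sigma>\<in>K. card \<sigma> \<le> 4" and conn: "connected (- polyhedron K)"
    and Z: "Z \<subseteq> triangles K" and cycle: "\<And>e. e \<in> edges K \<Longrightarrow> even (card {f \<in> Z. e \<subset> f})"
  shows "\<exists>S\<subseteq>tets K. \<forall>f\<in>triangles K. f \<in> Z \<longleftrightarrow> odd (card {t \<in> S. f \<subset> t})"
proof -
  obtain q where q: "q \<notin> \<Union>K" "\<And>f. f \<in> triangles K \<Longrightarrow> q \<notin> affine hull f"
    "\<And>e f. e \<in> edges K \<Longrightarrow> f \<in> triangles K \<Longrightarrow> q \<notin> affine hull (insert (barycenter f) e)"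
    using cone_apex[OF K(1)] by metis
  have tri: "f \<in> K" "finite f" "card f = 3" "f \<noteq> {}" "\<not> affine_dependent f" "q \<notin> f" if "f \<in> triangles K" for f
    using that simplex_finite[OF K(1)] simplex_nonempty[OF K(1)] simplex_affine_independent[OF K(1)] q(1)
    by (auto simp: triangles_def)
  have finK: "finite K" using simplicial_complex_finite[OF K(1)] .
  have finZ: "finite Z" by (rule finite_subset[OF Z]) (simp add: triangles_def finK)
  define T where "T = insert q ` Z"
  have finT: "finite T" using finZ by (simp add: T_def)
  have fullT: "full_simplex t" if "t \<in> T" for t
  proof -
    obtain f where f: "f \<in> Z" "t = insert q f" using \<open>t \<in> T\<close> by (auto simp: T_def)
    then have "f \<in> triangles K" using Z by blast
    note f' = tri[OF this] q(2)[OF this]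
    show ?thesis using affine_independent_insert[OF f'(5,7)] f'(2,3,6) by (simp add: full_simplex_def f(2))
  qed
  \<comment> \<open>A facet through the apex is a wall over an edge and is shared by evenly many
    cone simplices, \<open>Z\<close> being a cycle. Only the facets opposite the apex, which are the
    triangles of \<open>Z\<close>, can be odd.\<close>
  have oddT: "t - {v} \<in> Z" if t: "t \<in> T" and v: "v \<in> t" and odd: "odd (card {t' \<in> T. t - {v} \<subset> t'})" for t v
  proof -
    obtain f where f: "f \<in> Z" "t = insert q f" using t by (auto simp: T_def)
    have ftri: "f \<in> triangles K" using f Z by blast
    show ?thesis
    proof (cases "v = q")
      case True
      then show ?thesis using f tri(6)[OF ftri] by simp
    next
      case False
      then have vf: "v \<in> f" using v f by simp
      have "{t' \<in> T. t - {v} \<subset> t'} = insert q ` {f' \<in> Z. f - {v} \<subset> f'}"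
      proof -
        have iff: "(t - {v} \<subset> insert q f') = (f - {v} \<subset> f')" if "f' \<in> Z" for f'
        proof -
          have "q \<notin> f'" "q \<notin> f" using tri(6) Z that ftri by blast+
          moreover have "t - {v} = insert q (f - {v})" using False f(2) by auto
          ultimately show ?thesis by (simp add: psubset_eq subset_insert insert_eq_iff)
        qed
        have "{t' \<in> T. t - {v} \<subset> t'} = insert q ` {f' \<in> Z. t - {v} \<subset> insert q f'}"
          unfolding T_def by blast
        also have "{f' \<in> Z. t - {v} \<subset> insert q f'} = {f' \<in> Z. f - {v} \<subset> f'}"
          using iff by (simp cong: conj_cong)
        finally show ?thesis .
      qed
      moreover have "inj_on (insert q) {f' \<in> Z. f - {v} \<subset> f'}"
      proof (rule inj_onI)
        fix x y assume "x \<in> {f' \<in> Z. f - {v} \<subset> f'}" "y \<in> {f' \<in> Z. f - {v} \<subset> f'}" "insert q x = insert q y"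
        then show "x = y" using tri(6) Z by (metis (mono_tags, lifting) insert_ident mem_Collect_eq subsetD)
      qed
      ultimately have "card {t' \<in> T. t - {v} \<subset> t'} = card {f' \<in> Z. f - {v} \<subset> f'}"
        by (simp add: card_image)
      then show ?thesis using odd cycle[OF facet_edge[OF K(1) ftri vf]] by simp
    qed
  qed
  have degT: "{t \<in> T. f \<subset> t} = (if f \<in> Z then {insert q f} else {})" if f: "f \<in> triangles K" for f
  proof -
    have "(f \<subset> insert q f') = (f' = f)" if "f' \<in> Z" for f'
    proof -
      have f': "f' \<in> triangles K" using Z that by blast
      have "f \<subset> insert q f' \<longleftrightarrow> f \<subseteq> f'" using tri(6)[OF f] tri(6)[OF f'] by blast
      also have "\<dots> \<longleftrightarrow> f' = f" using tri(2,3)[OF f] tri(2,3)[OF f'] by (metis card_subset_eq order_refl)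
      finally show ?thesis .
    qed
    then show ?thesis unfolding T_def by auto
  qed
  have in_poly: "convex hull \<sigma> \<subseteq> polyhedron K" if "\<sigma> \<in> K" for \<sigma>
    using that by (auto simp: polyhedron_def)
  have compact: "compact (polyhedron K)"
    unfolding polyhedron_def using finK simplex_finite[OF K(1)]
    by (intro compact_Union finite_imageI) (auto intro: compact_convex_hull finite_imp_compact)
  have outside: "even (cover_count T x)" if x: "x \<notin> polyhedron K" "generic_for T x" for x
  proof -
    obtain y where y: "y \<notin> polyhedron K" "generic_for T y" "cover_count T y = 0"
      using far_generic_point[OF finT fullT compact_imp_bounded[OF compact]] by metis
    have "even (cover_count T x) \<longleftrightarrow> even (cover_count T y)"
    proof (rule cover_count_parity_connected[OF finT fullT _ conn])
      show "open (- polyhedron K)" using compact by (simp add: compact_imp_closed open_Compl)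
      fix t v assume "t \<in> T" "v \<in> t" "odd (card {t' \<in> T. t - {v} \<subset> t'})"
      then have "t - {v} \<in> K" using oddT Z tri(1) by blast
      then show "- polyhedron K \<inter> convex hull (t - {v}) = {}" using in_poly by blast
    qed (use x y in auto)
    then show ?thesis using y(3) by simp
  qed
  \<comment> \<open>The tetrahedra over which the cone lies an odd number of times. One generic
    interior point decides, because no triangle of \<open>K\<close> meets the interior of a
    tetrahedron.\<close>
  define S where "S = {t \<in> tets K. \<exists>x\<in>core t. generic_for T x \<and> odd (cover_count T x)}"
  have S: "S \<subseteq> tets K" by (auto simp: S_def)
  note fullK = tets_full_simplex[OF K(1)]
  have inside: "odd (cover_count T x) \<longleftrightarrow> t \<in> S" if t: "t \<in> tets K" and x: "x \<in> core t" "generic_for T x" for x t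
  proof -
    have const: "even (cover_count T x) \<longleftrightarrow> even (cover_count T y)" if y: "y \<in> core t" "generic_for T y" for y
    proof (rule cover_count_parity_connected[OF finT fullT open_core _ _ x y])
      show "finite t" using full_simplex_finite[OF fullK[OF t]] .
      show "connected (core t)" using convex_core convex_connected by blast
      fix s v assume "s \<in> T" "v \<in> s" "odd (card {t' \<in> T. s - {v} \<subset> t'})"
      then have f: "s - {v} \<in> triangles K" using oddT Z by blast
      show "core t \<inter> convex hull (s - {v}) = {}"
      proof (rule ccontr)
        assume "core t \<inter> convex hull (s - {v}) \<noteq> {}"
        then obtain z where "z \<in> core t" "z \<in> convex hull (s - {v})" by blast
        then have "s - {v} = t" using core_tet_unique[OF K t] tri(1)[OF f] by blast
        then show False using f t by (simp add: triangles_def tets_def)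
      qed
    qed
    show ?thesis
    proof
      assume "odd (cover_count T x)"
      then show "t \<in> S" unfolding S_def using t x by blast
    next
      assume "t \<in> S"
      then obtain y where "y \<in> core t" "generic_for T y" "odd (cover_count T y)" unfolding S_def by blast
      then show "odd (cover_count T x)" using const by simp
    qed
  qed
  have disj: "T \<inter> S = {}"
  proof -
    have "q \<in> t" if "t \<in> T" for t using that by (auto simp: T_def)
    moreover have "q \<notin> t" if "t \<in> S" for t using that S q(1) by (auto simp: tets_def)
    ultimately show ?thesis by blast
  qed
  let ?W = "T \<union> S"
  have finS: "finite S" using finite_subset[OF S] simplicial_complex_tets_finite[OF K(1)] by blast
  have finW: "finite ?W" using finT finS by simp
  have fullW: "full_simplex t" if "t \<in> ?W" for t using that fullT fullK S by blast
  \<comment> \<open>A simplex of lower dimension need not lie in a facet plane of a tetrahedron or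
    of a cone simplex. It is put into some hyperplane, to be avoided by the test points as
    well.\<close>
  have low: "\<exists>a b. a \<noteq> 0 \<and> convex hull \<sigma> \<subseteq> {x. a \<bullet> x = b}" if "\<sigma> \<in> K" "card \<sigma> \<noteq> 4" for \<sigma>
  proof -
    have "card \<sigma> \<le> 3" using K(2) that by fastforce
    then have "aff_dim \<sigma> < DIM(pt)" using aff_dim_le_card[OF simplex_finite[OF K(1) that(1)]] by simp
    then obtain a b where "a \<noteq> 0" "\<sigma> \<subseteq> {x. a \<bullet> x = b}" using aff_lowdim_subset_hyperplane by blast
    then have "convex hull \<sigma> \<subseteq> {x. a \<bullet> x = b}" by (intro hull_minimal convex_hyperplane)
    then show ?thesis using \<open>a \<noteq> 0\<close> by blast
  qed
  define low where "low = {\<sigma> \<in> K. card \<sigma> \<noteq> 4}"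
  have "\<forall>\<sigma>\<in>low. \<exists>p. fst p \<noteq> 0 \<and> convex hull \<sigma> \<subseteq> {x. fst p \<bullet> x = snd p}"
    using low by (simp add: low_def)
  then obtain p where p: "\<forall>\<sigma>\<in>low. fst (p \<sigma>) \<noteq> 0 \<and> convex hull \<sigma> \<subseteq> {x. fst (p \<sigma>) \<bullet> x = snd (p \<sigma>)}"
    by (rule bchoice[THEN exE])
  define a where "a \<sigma> = fst (p \<sigma>)" for \<sigma>
  define b where "b \<sigma> = snd (p \<sigma>)" for \<sigma>
  have ab: "a \<sigma> \<noteq> 0" "convex hull \<sigma> \<subseteq> {x. a \<sigma> \<bullet> x = b \<sigma>}" if "\<sigma> \<in> low" for \<sigma>
    using p that by (auto simp: a_def b_def)
  have finlow: "finite low" using finK by (simp add: low_def)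
  \<comment> \<open>Adding \<open>S\<close> cancels the cone modulo 2: inside a tetrahedron by the
    choice of \<open>S\<close>, and outside the polyhedron because the cone count is even and
    \<open>S\<close> covers nothing there.\<close>
  have evenW: "even (cover_count ?W x)"
    if gen: "generic_for (?W \<union> tets K) x" and off: "\<And>\<sigma>. \<sigma> \<in> low \<Longrightarrow> a \<sigma> \<bullet> x \<noteq> b \<sigma>" for x
  proof -
    have genT: "generic_for T x" using gen by (auto simp: generic_for_def)
    have "{t \<in> ?W. x \<in> convex hull t} = {t \<in> T. x \<in> convex hull t} \<union> {t \<in> S. x \<in> convex hull t}" by blast
    then have sum: "cover_count ?W x = cover_count T x + cover_count S x"
      unfolding cover_count_def using finT finS disj by (simp add: card_Un_disjoint disjoint_iff)
    show ?thesis
    proof (cases "x \<in> polyhedron K")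
      case True
      then obtain \<sigma> where \<sigma>: "\<sigma> \<in> K" "x \<in> convex hull \<sigma>" by (auto simp: polyhedron_def)
      then have "\<sigma> \<notin> low" using ab off by blast
      then have tet: "\<sigma> \<in> tets K" using \<sigma> by (simp add: low_def tets_def)
      have "x \<in> core \<sigma>"
        using generic_in_core[OF fullK[OF tet] \<sigma>(2)] gen tet by (simp add: generic_for_def)
      then show ?thesis
        using inside[OF tet _ genT] cover_count_core[OF K S tet] sum by (auto split: if_splits)
    next
      case False
      have "{t \<in> S. x \<in> convex hull t} = {}"
        using False in_poly S by (auto simp: tets_def)
      then have "cover_count S x = 0" by (simp only: cover_count_def card.empty)
      then show ?thesis using outside[OF False genT] sum by simp
    qed
  qed
  \<comment> \<open>On both sides of the barycentre of \<open>f\<close> the covering number of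
    \<open>?W\<close> is even, so evenly many simplices of \<open>?W\<close> contain
    \<open>f\<close>. A cone simplex is among them exactly if \<open>f \<in> Z\<close>, and then it
    is the cone over \<open>f\<close> alone.\<close>
  have boundary: "f \<in> Z \<longleftrightarrow> odd (card {t \<in> S. f \<subset> t})" if f: "f \<in> triangles K" for f
  proof -
    let ?r = "barycenter f"
    note f' = tri[OF f]
    have finWK: "finite (?W \<union> tets K)" using finW simplicial_complex_tets_finite[OF K(1)] by simp
    have fullWK: "full_simplex t" if "t \<in> ?W \<union> tets K" for t using that fullW fullK by blast
    define H where "H = (\<lambda>\<sigma>. {x. a \<sigma> \<bullet> x = b \<sigma>}) ` low"
    have finH: "finite H" using finlow by (simp add: H_def)
    have dimH: "aff_dim A < DIM(pt)" if "A \<in> H" for A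
      using that ab by (auto simp: H_def)
    obtain z where z: "generic_for (?W \<union> tets K) z" "\<And>A. A \<in> H \<Longrightarrow> z \<notin> A"
      using generic_avoiding[OF finWK fullWK finH dimH open_UNIV UNIV_not_empty] by metis
    have z_off: "a \<sigma> \<bullet> z \<noteq> b \<sigma>" if "\<sigma> \<in> low" for \<sigma>
      using z(2)[of "{x. a \<sigma> \<bullet> x = b \<sigma>}"] that by (auto simp: H_def)
    let ?d = "z - ?r"
    have r_hull: "?r \<in> convex hull f" using barycenter_in_convex_hull f' by blast
    \<comment> \<open>For a simplex of \<open>S\<close> or the base of a cone this holds since the
      barycentre is on no proper face of \<open>f\<close>; a wall over an edge is excluded by the
      third condition on the apex.\<close>
    have above: "f \<subset> t" if t: "t \<in> ?W" and bd: "on_boundary t ?r" for t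
    proof (cases "t \<in> S")
      case True
      then have tK: "t \<in> K" "card t = 4" using S by (auto simp: tets_def)
      have "f \<subseteq> t" using barycenter_on_face[OF K(1) f'(1) tK(1)] bd by (simp add: on_boundary_def)
      then show ?thesis using tK f' by auto
    next
      case False
      then obtain f2 where f2: "f2 \<in> Z" "t = insert q f2" using t by (auto simp: T_def)
      then have f2t: "f2 \<in> triangles K" using Z by blast
      obtain v where v: "v \<in> t" "?r \<in> convex hull t" "bary t v ?r = 0" using bd by (auto simp: on_boundary_def)
      then have rv: "?r \<in> convex hull (t - {v})" using convex_hull_facet[OF fullW[OF t]] by blast
      show ?thesis
      proof (cases "v = q")
        case True
        then have "t - {v} = f2" using f2 tri(6)[OF f2t] by simp
        then have "f \<subseteq> f2" using barycenter_on_face[OF K(1) f'(1) tri(1)[OF f2t]] rv by simp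
        then show ?thesis using f2(2) tri(6)[OF f2t] by blast
      next
        case False
        then have vf: "v \<in> f2" using v f2 by simp
        define e where "e = f2 - {v}"
        have e: "e \<in> edges K" unfolding e_def by (rule facet_edge[OF K(1) f2t vf])
        then have eK: "e \<in> K" "card e = 2" "e \<noteq> {}" by (auto simp: edges_def)
        have "t - {v} = insert q e" using f2 False by (auto simp: e_def)
        then obtain u c y where uc: "0 \<le> u" "0 \<le> c" "u + c = 1" "y \<in> convex hull e" "?r = u *\<^sub>R q + c *\<^sub>R y"
          using rv convex_hull_insert[OF eK(3), of q] by auto
        show ?thesis
        proof (cases "u = 0")
          case True
          then have "?r \<in> convex hull e" using uc by simp
          then have "f \<subseteq> e" using barycenter_on_face[OF K(1) f'(1) eK(1)] by simp
          then have "card f \<le> card e" using eK simplex_finite[OF K(1)] card_mono by blast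
          then show ?thesis using f' eK by simp
        next
          case False
          have "u *\<^sub>R q = ?r - c *\<^sub>R y" using uc(5) by simp
          then have "q = (1 / u) *\<^sub>R (?r - c *\<^sub>R y)"
            using False by (metis divide_self_if one_neq_zero scaleR_one scaleR_scaleR times_divide_eq_left mult_1)
          also have "\<dots> = (1 / u) *\<^sub>R ?r + (- c / u) *\<^sub>R y" by (simp add: algebra_simps)
          also have "\<dots> \<in> affine hull (insert ?r e)"
          proof (rule mem_affine[OF affine_affine_hull])
            show "?r \<in> affine hull insert ?r e" by (simp add: hull_inc)
            show "y \<in> affine hull insert ?r e"
              using uc(4) convex_hull_subset_affine_hull[of e] hull_mono[of e "insert ?r e" affine] by blast
            show "1 / u + - c / u = 1" using False uc(3) by (simp add: field_simps)
          qed
          finally show ?thesis using q(3)[OF e f] by blast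
        qed
      qed
    qed
    have below: "on_boundary t ?r \<and> (\<forall>v\<in>t. \<forall>w\<in>t. bary t v ?r = 0 \<longrightarrow> bary t w ?r = 0 \<longrightarrow> v = w)"
      if t: "t \<in> ?W" and ft: "f \<subset> t" for t
    proof -
      note ind = full_simplex_affine_independent[OF fullW[OF t]]
      have bf: "bary t v ?r = (if v \<in> f then 1 / 3 else 0)" if "v \<in> t" for v
        using bary_barycenter[OF ind _ f'(4) that] ft f'(3) by auto
      have "card (t - f) = 1"
        using fullW[OF t] ft f' by (subst card_Diff_subset) (auto simp: full_simplex_def)
      then obtain u where u: "t - f = {u}" by (rule card_1_singletonE)
      have "?r \<in> convex hull t" using r_hull hull_mono[of f t] ft by blast
      moreover have "u \<in> t" "u \<notin> f" using u by blast+
      ultimately have "on_boundary t ?r" unfolding on_boundary_def using bf by auto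
      moreover have "\<forall>v\<in>t. \<forall>w\<in>t. bary t v ?r = 0 \<longrightarrow> bary t w ?r = 0 \<longrightarrow> v = w"
        using bf u by (metis DiffI divide_eq_0_iff one_neq_zero singletonD zero_neq_numeral)
      ultimately show ?thesis by blast
    qed
    have trans: "bary t v (?r + ?d) \<noteq> 0" if "t \<in> ?W" "v \<in> t" for t v
      using z(1) that by (simp add: generic_for_def)
    have single: "\<forall>v\<in>t. \<forall>w\<in>t. bary t v ?r = 0 \<longrightarrow> bary t w ?r = 0 \<longrightarrow> v = w"
      if t: "t \<in> ?W" "?r \<in> convex hull t" for t
      using above[OF t(1)] below[OF t(1)] t(2) by (auto simp: on_boundary_def)
    obtain m n where mn:
      "\<forall>\<^sub>F c in at_right 0. cover_count ?W (?r + c *\<^sub>R ?d) = m \<and> cover_count ?W (?r - c *\<^sub>R ?d) = n"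
      "even (m + n) \<longleftrightarrow> even (card {t \<in> ?W. on_boundary t ?r})"
      by (rule cover_count_sides[of ?W ?r ?d]) (use finW fullW trans single in simp_all)
    have "\<forall>\<^sub>F c in at_right 0. \<forall>\<sigma>\<in>low. a \<sigma> \<bullet> (?r + c *\<^sub>R ?d) \<noteq> b \<sigma> \<and> a \<sigma> \<bullet> (?r - c *\<^sub>R ?d) \<noteq> b \<sigma>"
      using finlow z_off by (intro eventually_ball_finite ballI avoid_hyperplane_near) simp_all
    moreover have "\<forall>\<^sub>F c in at_right 0. generic_for (?W \<union> tets K) (?r + c *\<^sub>R ?d) \<and> generic_for (?W \<union> tets K) (?r - c *\<^sub>R ?d)"
      using generic_near[OF finWK fullWK, of ?r ?d] z(1) by simp
    ultimately have "\<forall>\<^sub>F c in at_right (0::real). even m \<and> even n"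
      using mn(1)
    proof eventually_elim
      case (elim c)
      then show ?case using evenW[of "?r + c *\<^sub>R ?d"] evenW[of "?r - c *\<^sub>R ?d"] by metis
    qed
    then have "even m \<and> even n" by simp
    then have "even (card {t \<in> ?W. on_boundary t ?r})" using mn(2) by simp
    moreover have "{t \<in> ?W. on_boundary t ?r} = {t \<in> T. f \<subset> t} \<union> {t \<in> S. f \<subset> t}"
      using above below by blast
    moreover have "card ({t \<in> T. f \<subset> t} \<union> {t \<in> S. f \<subset> t}) = card {t \<in> T. f \<subset> t} + card {t \<in> S. f \<subset> t}"
      using finT finS disj by (intro card_Un_disjoint) auto
    ultimately have "even (card {t \<in> T. f \<subset> t} + card {t \<in> S. f \<subset> t})" by simp
    then show ?thesis unfolding degT[OF f] by (auto split: if_splits)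
  qed
  show ?thesis by (intro exI[of _ S] conjI ballI S boundary)
qed

section \<open>Acyclic matchings and the incidence matrix\<close>

text \<open>The combinatorial part of \<open>simplicial_complex\<close>, over any vertex type:
  collapses are treated without the embedding.\<close>

definition abstract_complex :: "'a set set \<Rightarrow> bool" where
  "abstract_complex K \<longleftrightarrow> finite K \<and> (\<forall>\<sigma>\<in>K. finite \<sigma> \<and> \<sigma> \<noteq> {} \<and> (\<forall>\<tau>. \<tau> \<subseteq> \<sigma> \<and> \<tau> \<noteq> {} \<longrightarrow> \<tau> \<in> K))"

lemma abstract_complexD:
  assumes "abstract_complex K"
  shows "finite K" "\<sigma> \<in> K \<Longrightarrow> finite \<sigma>" "\<sigma> \<in> K \<Longrightarrow> \<sigma> \<noteq> {}"
    "\<sigma> \<in> K \<Longrightarrow> \<tau> \<subseteq> \<sigma> \<Longrightarrow> \<tau> \<noteq> {} \<Longrightarrow> \<tau> \<in> K"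
  using assms unfolding abstract_complex_def by blast+

lemma elem_collapseI:
  "\<lbrakk>\<sigma> \<in> K; \<tau> \<in> K; \<sigma> \<subset> \<tau>; card \<tau> = card \<sigma> + 1; \<forall>\<rho>\<in>K. \<sigma> \<subset> \<rho> \<longrightarrow> \<rho> = \<tau>\<rbrakk> \<Longrightarrow> elem_collapse K (K - {\<sigma>, \<tau>})"
  unfolding elem_collapse_def by blast

lemma abstract_complex_collapse:
  assumes K: "abstract_complex K" and col: "\<sigma> \<subset> \<tau>" "\<forall>\<rho>\<in>K. \<sigma> \<subset> \<rho> \<longrightarrow> \<rho> = \<tau>"
  shows "abstract_complex (K - {\<sigma>, \<tau>})"
  unfolding abstract_complex_def
proof (intro conjI ballI allI impI)
  fix \<rho> \<rho>' assume \<rho>: "\<rho> \<in> K - {\<sigma>, \<tau>}" and \<rho>': "\<rho>' \<subseteq> \<rho> \<and> \<rho>' \<noteq> {}"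
  then have "\<rho>' \<in> K" using abstract_complexD(4)[OF K] by blast
  moreover have "\<rho>' \<noteq> \<sigma>" "\<rho>' \<noteq> \<tau>" using \<rho> \<rho>' col by blast+
  ultimately show "\<rho>' \<in> K - {\<sigma>, \<tau>}" by blast
qed (use abstract_complexD[OF K] in auto)

text \<open>Without a source every edge would lead on to a different triangle of \<open>N\<close>,
  and by finiteness such a walk closes up to a forbidden cycle. A source acts as a pivot: its edge
  meets no other triangle of \<open>N\<close>, so the equation at this edge isolates one
  unknown.\<close>

lemma acyclic_matching_source:
  assumes snd_inj: "inj_on snd M" and acyc: "acyclic_matching M"
    and N: "finite N" "N \<subseteq> M" "N \<noteq> {}"
  shows "\<exists>e f. (e, f) \<in> N \<and> (\<forall>e' f'. (e', f') \<in> N \<longrightarrow> e \<subset> f' \<longrightarrow> f' = f)"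
proof (rule ccontr)
  assume no_source: "\<not> ?thesis"
  have "\<forall>p\<in>N. \<exists>p'. p' \<in> N \<and> fst p \<subset> snd p' \<and> snd p' \<noteq> snd p"
  proof (intro ballI)
    fix p assume p: "p \<in> N"
    show "\<exists>p'. p' \<in> N \<and> fst p \<subset> snd p' \<and> snd p' \<noteq> snd p"
    proof (rule ccontr)
      assume none: "\<not> (\<exists>p'. p' \<in> N \<and> fst p \<subset> snd p' \<and> snd p' \<noteq> snd p)"
      have "f' = snd p" if "(e', f') \<in> N" "fst p \<subset> f'" for e' f'
        using none[simplified, rule_format, of f' e'] that by simp
      then have "\<exists>e f. (e, f) \<in> N \<and> (\<forall>e' f'. (e', f') \<in> N \<longrightarrow> e \<subset> f' \<longrightarrow> f' = f)"
        using p by (intro exI[of _ "fst p"] exI[of _ "snd p"]) simp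
      then show False using no_source by simp
    qed
  qed
  then obtain nx where nx: "\<forall>p\<in>N. nx p \<in> N \<and> fst p \<subset> snd (nx p) \<and> snd (nx p) \<noteq> snd p"
    by (rule bchoice[THEN exE])
  obtain p0 where p0: "p0 \<in> N" using N(3) by blast
  define s where "s i = (nx ^^ i) p0" for i :: nat
  have sN: "s i \<in> N" for i by (induction i) (use p0 nx in \<open>auto simp: s_def\<close>)
  have s_Suc: "s (Suc i) = nx (s i)" for i by (simp add: s_def)
  have "\<not> inj s"
  proof
    assume "inj s"
    moreover have "finite (range s)" using sN N(1) by (meson finite_subset image_subsetI)
    ultimately show False using finite_imageD infinite_UNIV_nat by blast
  qed
  then obtain i j where "i < j" "s i = s j" unfolding inj_def by (metis linorder_neqE_nat)
  then have ex: "\<exists>h. 0 < h \<and> (\<exists>i. s (i + h) = s i)"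
    by (intro exI[of _ "j - i"] conjI exI[of _ i]) auto
  \<comment> \<open>The shortest return over all starting points, so that the triangles on the loop
    are distinct. The value 1 cannot occur because each step changes the triangle.\<close>
  define h where "h = (LEAST h. 0 < h \<and> (\<exists>i. s (i + h) = s i))"
  obtain i where h: "0 < h" "s (i + h) = s i" using LeastI_ex[OF ex] unfolding h_def[symmetric] by blast
  have least: "h \<le> h'" if "0 < h'" "s (i' + h') = s i'" for h' i'
    unfolding h_def using that by (intro Least_le) blast
  have step: "fst (s k) \<subset> snd (s (Suc k))" "snd (s (Suc k)) \<noteq> snd (s k)" for k
    using nx sN by (auto simp: s_Suc)
  have "h \<noteq> 1" using h(2) step(2)[of i] by auto
  then have c1: "2 \<le> h" using h(1) by simp
  have c2: "\<forall>k<h. s (i + k) \<in> M" using sN N(2) by blast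
  have c3: "inj_on (\<lambda>k. snd (s (i + k))) {..<h}"
  proof -
    have "snd (s (i + k)) \<noteq> snd (s (i + l))" if "k < l" "l < h" for k l
    proof
      assume "snd (s (i + k)) = snd (s (i + l))"
      then have "s (i + k) = s (i + l)" using snd_inj sN N(2) by (meson inj_onD subsetD)
      then have "s ((i + k) + (l - k)) = s (i + k)" using that by simp
      then show False using least[of "l - k" "i + k"] that by simp
    qed
    then show ?thesis by (intro inj_onI) (metis lessThan_iff linorder_neqE_nat)
  qed
  have c4: "\<forall>k<h. fst (s (i + k)) \<subset> snd (s (i + Suc k mod h))"
  proof (intro allI impI)
    fix k assume "k < h"
    show "fst (s (i + k)) \<subset> snd (s (i + Suc k mod h))"
    proof (cases "Suc k = h")
      case True
      then show ?thesis using step(1)[of "i + k"] h(2) by auto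
    next
      case False
      then show ?thesis using step(1)[of "i + k"] \<open>k < h\<close> by simp
    qed
  qed
  show False using acyc unfolding acyclic_matching_def
    by (elim notE, intro exI[of _ h] exI[of _ "\<lambda>k. s (i + k)"] conjI c1 c2 c3 c4)
qed

section \<open>Incidence signs and the boundary relation\<close>

lemma lex_less_linear:
  "v \<noteq> w \<Longrightarrow> lex_less v w \<or> lex_less w v" "lex_less v w \<Longrightarrow> \<not> lex_less w v" "\<not> lex_less v v"
  by (auto simp: lex_less_def vec_eq_iff forall_3)

lemma incidence_eq_0: "\<not> e \<subset> f \<Longrightarrow> incidence f e = 0"
  by (simp add: incidence_def)

lemma incidence_cases: "e \<subset> f \<Longrightarrow> incidence f e = 1 \<or> incidence f e = -1"
  by (simp add: incidence_def minus_one_power_iff)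

lemma incidence_facet:
  assumes "y \<in> f"
  shows "incidence f (f - {y}) = (-1) ^ card {z\<in>f. lex_less z y}"
proof -
  have "f - (f - {y}) = {y}" "f - {y} \<subset> f" using assms by auto
  then show ?thesis unfolding incidence_def by simp
qed

text \<open>Only the two faces omitting one of the vertices outside \<open>e\<close> contribute, and
  they cancel: deleting the smaller vertex \<open>a\<close> lowers the position of \<open>b\<close>
  by one, whereas deleting \<open>b\<close> leaves the position of \<open>a\<close>
  unchanged.\<close>

lemma boundary_of_boundary:
  assumes \<tau>: "finite \<tau>" "card \<tau> = 4" and e: "card e = 2"
  shows "(\<Sum>v\<in>\<tau>. (-1) ^ card {x\<in>\<tau>. lex_less x v} * incidence (\<tau> - {v}) e) = 0"
proof (cases "e \<subseteq> \<tau>")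
  case False
  then show ?thesis by (intro sum.neutral ballI) (auto simp: incidence_def)
next
  case True
  have "card (\<tau> - e) = 2" using True \<tau> e finite_subset[OF True] by (subst card_Diff_subset) auto
  then obtain a' b' where ab': "\<tau> - e = {a', b'}" "a' \<noteq> b'" by (auto simp: card_2_iff)
  then obtain a b where ab: "\<tau> - e = {a, b}" "a \<noteq> b" "lex_less a b"
    using lex_less_linear(1)[OF ab'(2)] by (metis insert_commute)
  have abt: "a \<in> \<tau>" "b \<in> \<tau>" "a \<notin> e" "b \<notin> e" using ab by blast+
  let ?s = "\<lambda>v. (-1::real) ^ card {x\<in>\<tau>. lex_less x v}"
  have "(\<Sum>v\<in>\<tau>. ?s v * incidence (\<tau> - {v}) e) = (\<Sum>v\<in>{a, b}. ?s v * incidence (\<tau> - {v}) e)"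
  proof (rule sum.mono_neutral_right)
    show "\<forall>v\<in>\<tau> - {a, b}. ?s v * incidence (\<tau> - {v}) e = 0"
    proof
      fix v assume "v \<in> \<tau> - {a, b}"
      then have "v \<in> e" using ab by blast
      then have "\<not> e \<subset> \<tau> - {v}" by blast
      then show "?s v * incidence (\<tau> - {v}) e = 0" by (simp add: incidence_eq_0)
    qed
  qed (use \<tau> abt in auto)
  also have "\<dots> = ?s a * incidence (\<tau> - {a}) e + ?s b * incidence (\<tau> - {b}) e" using ab by simp
  also have "incidence (\<tau> - {a}) e = - ?s b"
  proof -
    have "e = (\<tau> - {a}) - {b}" using ab True by blast
    then have "incidence (\<tau> - {a}) e = (-1) ^ card {z\<in>\<tau> - {a}. lex_less z b}"
      using incidence_facet[of b "\<tau> - {a}"] abt ab by simp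
    moreover have "{x\<in>\<tau>. lex_less x b} = insert a {z\<in>\<tau> - {a}. lex_less z b}" using ab abt by auto
    then have "card {x\<in>\<tau>. lex_less x b} = Suc (card {z\<in>\<tau> - {a}. lex_less z b})" using \<tau> by simp
    ultimately show ?thesis by simp
  qed
  also have "incidence (\<tau> - {b}) e = ?s a"
  proof -
    have "e = (\<tau> - {b}) - {a}" using ab True by blast
    then have "incidence (\<tau> - {b}) e = (-1) ^ card {z\<in>\<tau> - {b}. lex_less z a}"
      using incidence_facet[of a "\<tau> - {b}"] abt ab by simp
    moreover have "{x\<in>\<tau>. lex_less x a} = {z\<in>\<tau> - {b}. lex_less z a}"
      using lex_less_linear(2)[OF ab(3)] by auto
    ultimately show ?thesis by simp
  qed
  finally show ?thesis by simp
qed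

section \<open>Rank as the largest number of independent columns\<close>

definition indep_triangles :: "pt set set \<Rightarrow> pt set set \<Rightarrow> bool" where
  "indep_triangles K T \<longleftrightarrow> T \<subseteq> triangles K \<and>
     (\<forall>c :: pt set \<Rightarrow> real. (\<forall>e\<in>edges K. (\<Sum>f\<in>T. c f * incidence f e) = 0) \<longrightarrow> (\<forall>f\<in>T. c f = 0))"

lemma incidence_rank_eq: "incidence_rank K = Max (card ` {T. indep_triangles K T})"
  unfolding incidence_rank_def indep_triangles_def
  by (rule arg_cong[where f = Max]) auto

lemma indep_triangles_finite: "finite K \<Longrightarrow> indep_triangles K T \<Longrightarrow> finite T"
  unfolding indep_triangles_def triangles_def by (auto intro: finite_subset)

lemma finite_indep_triangles: "finite K \<Longrightarrow> finite {T. indep_triangles K T}"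
  by (rule finite_subset[of _ "Pow K"]) (auto simp: indep_triangles_def triangles_def)

lemma card_le_incidence_rank:
  assumes "finite K" "indep_triangles K T" shows "card T \<le> incidence_rank K"
  unfolding incidence_rank_eq using assms finite_indep_triangles by (intro Max_ge) auto

lemma incidence_rank_attained:
  assumes "finite K" obtains T where "indep_triangles K T" "card T = incidence_rank K"
proof -
  have "indep_triangles K {}" by (simp add: indep_triangles_def)
  then have "Max (card ` {T. indep_triangles K T}) \<in> card ` {T. indep_triangles K T}"
    using finite_indep_triangles[OF assms] by (intro Max_in) auto
  then show thesis using that unfolding incidence_rank_eq by auto
qed

lemma incidence_rank_le:
  assumes "finite K" "\<And>T. indep_triangles K T \<Longrightarrow> card T \<le> n" shows "incidence_rank K \<le> n"
  using incidence_rank_attained[OF assms(1)] assms(2) by metis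

lemma indep_triangles_subset:
  assumes "finite K" "indep_triangles K T" "T' \<subseteq> T" shows "indep_triangles K T'"
  unfolding indep_triangles_def
proof (intro conjI allI impI ballI)
  fix c f assume c: "\<forall>e\<in>edges K. (\<Sum>f\<in>T'. c f * incidence f e) = 0" and f: "f \<in> T'"
  have fin: "finite T" using indep_triangles_finite assms by blast
  let ?c = "\<lambda>f. if f \<in> T' then c f else 0"
  have "(\<Sum>f\<in>T. ?c f * incidence f e) = (\<Sum>f\<in>T'. c f * incidence f e)" for e
    using fin assms(3) by (intro sum.mono_neutral_cong_right) auto
  then have "\<forall>f\<in>T. ?c f = 0" using assms(2) c unfolding indep_triangles_def
    by (elim conjE allE[of _ ?c]) simp
  from bspec[OF this, of f] show "c f = 0" using f assms(3) by auto
qed (use assms in \<open>auto simp: indep_triangles_def\<close>)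

text \<open>Steinitz exchange among columns: if no member of \<open>F\<close> outside
  \<open>T\<close> could replace \<open>\<sigma>\<close>, all of \<open>F\<close> would lie in the
  span of \<open>T - {\<sigma>}\<close>, and by \<open>rel\<close> so would \<open>\<sigma>\<close>,
  against independence.\<close>

lemma indep_triangles_exchange:
  assumes K: "finite K" and T: "indep_triangles K T" and \<sigma>: "\<sigma> \<in> T"
    and F: "finite F" "F \<subseteq> triangles K" "\<sigma> \<notin> F"
    and rel: "\<And>e. e \<in> edges K \<Longrightarrow> incidence \<sigma> e = (\<Sum>f\<in>F. a f * incidence f e)"
  obtains f where "f \<in> F" "f \<notin> T" "indep_triangles K (insert f (T - {\<sigma>}))"
proof (rule ccontr)
  assume no: "\<not> thesis"
  let ?T = "T - {\<sigma>}"
  have fin: "finite T" using indep_triangles_finite K T by blast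
  have T': "indep_triangles K ?T" using indep_triangles_subset[OF K T] by blast
  have "\<forall>f\<in>F. \<exists>b. \<forall>e\<in>edges K. incidence f e = (\<Sum>g\<in>?T. b g * incidence g e)"
  proof
    fix f assume f: "f \<in> F"
    show "\<exists>b. \<forall>e\<in>edges K. incidence f e = (\<Sum>g\<in>?T. b g * incidence g e)"
    proof (cases "f \<in> T")
      case True
      then have "f \<in> ?T" using f F(3) by blast
      then show ?thesis
        using fin by (intro exI[of _ "\<lambda>g. if g = f then 1 else 0"]) (simp add: if_distrib[of "\<lambda>x. x * _"] cong: if_cong)
    next
      case False
      then have "\<not> indep_triangles K (insert f ?T)" using no f that by blast
      moreover have "insert f ?T \<subseteq> triangles K" using f F T by (auto simp: indep_triangles_def)
      ultimately obtain c where c: "\<forall>e\<in>edges K. (\<Sum>g\<in>insert f ?T. c g * incidence g e) = 0"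
        "\<not> (\<forall>g\<in>insert f ?T. c g = 0)" unfolding indep_triangles_def by blast
      have sum: "c f * incidence f e + (\<Sum>g\<in>?T. c g * incidence g e) = 0" if "e \<in> edges K" for e
        using c(1) that fin False by simp
      have "c f \<noteq> 0"
      proof
        assume "c f = 0"
        then have "\<forall>g\<in>?T. c g = 0" using sum T' unfolding indep_triangles_def by simp
        then show False using c(2) \<open>c f = 0\<close> by blast
      qed
      have "incidence f e = (\<Sum>g\<in>?T. (- c g / c f) * incidence g e)" if "e \<in> edges K" for e
      proof -
        have "(\<Sum>g\<in>?T. (- c g / c f) * incidence g e) = - (\<Sum>g\<in>?T. c g * incidence g e) / c f"
          by (simp add: sum_divide_distrib sum_negf)
        also have "\<dots> = incidence f e" using sum[OF that] \<open>c f \<noteq> 0\<close> by (simp add: field_simps)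
        finally show ?thesis by simp
      qed
      then show ?thesis by (intro exI[of _ "\<lambda>g. - c g / c f"]) blast
    qed
  qed
  then obtain B where B: "\<forall>f\<in>F. \<forall>e\<in>edges K. incidence f e = (\<Sum>g\<in>?T. B f g * incidence g e)"
    by (rule bchoice[THEN exE])
  \<comment> \<open>The dependence obtained by substituting the expansions \<open>B\<close> into
    \<open>rel\<close>, with coefficient 1 at \<open>\<sigma>\<close>.\<close>
  define c where "c g = (if g = \<sigma> then 1 else - (\<Sum>f\<in>F. a f * B f g))" for g
  have "(\<Sum>g\<in>T. c g * incidence g e) = 0" if e: "e \<in> edges K" for e
  proof -
    have "(\<Sum>g\<in>T. c g * incidence g e) = incidence \<sigma> e + (\<Sum>g\<in>?T. c g * incidence g e)"
      using fin \<sigma> by (simp add: sum.remove c_def)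
    also have "(\<Sum>g\<in>?T. c g * incidence g e) = (\<Sum>g\<in>?T. - (\<Sum>f\<in>F. a f * B f g * incidence g e))"
      by (intro sum.cong refl) (auto simp: c_def sum_distrib_right)
    also have "\<dots> = - (\<Sum>f\<in>F. \<Sum>g\<in>?T. a f * B f g * incidence g e)"
      by (simp add: sum_negf sum.swap[of _ F])
    also have "(\<Sum>f\<in>F. \<Sum>g\<in>?T. a f * B f g * incidence g e) = (\<Sum>f\<in>F. a f * incidence f e)"
      using B e by (intro sum.cong refl) (simp add: sum_distrib_left mult.assoc)
    finally show ?thesis using rel[OF e] by simp
  qed
  then have "c \<sigma> = 0" using T \<sigma> unfolding indep_triangles_def by blast
  then show False by (simp add: c_def)
qed

section \<open>Collapses and the incidence rank\<close>

text \<open>Rows that vanish on every triangle impose no condition on the coefficients.\<close>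

lemma incidence_rank_cong:
  assumes "triangles K' = triangles K" "edges K' \<subseteq> edges K"
    and "\<And>e f. e \<in> edges K - edges K' \<Longrightarrow> f \<in> triangles K \<Longrightarrow> incidence f e = 0"
  shows "incidence_rank K' = incidence_rank K"
proof -
  have "(\<forall>e\<in>edges K. (\<Sum>f\<in>T. c f * incidence f e) = 0) \<longleftrightarrow> (\<forall>e\<in>edges K'. (\<Sum>f\<in>T. c f * incidence f e) = 0)"
    if T: "T \<subseteq> triangles K" for T and c :: "pt set \<Rightarrow> real"
  proof -
    have "(\<Sum>f\<in>T. c f * incidence f e) = 0" if "e \<in> edges K - edges K'" for e
      using assms(3)[OF that] T by (intro sum.neutral) auto
    then show ?thesis using assms(2) by blast
  qed
  then have "indep_triangles K' = indep_triangles K"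
    unfolding indep_triangles_def assms(1) by (intro ext conj_cong refl all_cong) simp
  then show ?thesis by (simp add: incidence_rank_eq)
qed

text \<open>As \<open>\<sigma>\<close> is free, its row has a single nonzero entry, in the column of
  \<open>\<tau>\<close>. Deleting this row and this column lowers the rank by exactly one.\<close>

lemma incidence_rank_collapse_edge:
  assumes K: "abstract_complex K" and col: "\<sigma> \<in> K" "\<tau> \<in> K" "\<sigma> \<subset> \<tau>" "\<forall>\<rho>\<in>K. \<sigma> \<subset> \<rho> \<longrightarrow> \<rho> = \<tau>"
    and card: "card \<sigma> = 2" "card \<tau> = 3"
  shows "incidence_rank K = Suc (incidence_rank (K - {\<sigma>, \<tau>}))"
proof -
  let ?K = "K - {\<sigma>, \<tau>}"
  have finK: "finite K" "finite ?K" using abstract_complexD(1)[OF K] by auto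
  have E: "edges K = insert \<sigma> (edges ?K)" using col(1) card by (auto simp: edges_def)
  have F: "triangles K = insert \<tau> (triangles ?K)" "\<tau> \<notin> triangles ?K"
    using col(2) card by (auto simp: triangles_def)
  have zero: "incidence f \<sigma> = 0" if "f \<in> triangles ?K" for f
  proof -
    have "f \<in> K" "f \<noteq> \<tau>" using that by (auto simp: triangles_def)
    then show ?thesis using col(4) by (intro incidence_eq_0) blast
  qed
  have "incidence_rank K \<le> Suc (incidence_rank ?K)"
  proof (rule incidence_rank_le[OF finK(1)])
    fix T assume T: "indep_triangles K T"
    then have finT: "finite T" using indep_triangles_finite finK by blast
    have T': "T - {\<tau>} \<subseteq> triangles ?K" using T F by (auto simp: indep_triangles_def)
    have "indep_triangles ?K (T - {\<tau>})"
      unfolding indep_triangles_def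
    proof (intro conjI T' allI impI)
      fix c assume c: "\<forall>e\<in>edges ?K. (\<Sum>f\<in>T - {\<tau>}. c f * incidence f e) = 0"
      have "(\<Sum>f\<in>T - {\<tau>}. c f * incidence f \<sigma>) = 0"
        using zero T' by (intro sum.neutral) auto
      then have "\<forall>e\<in>edges K. (\<Sum>f\<in>T - {\<tau>}. c f * incidence f e) = 0" using c E by simp
      then show "\<forall>f\<in>T - {\<tau>}. c f = 0"
        using indep_triangles_subset[OF finK(1) T, of "T - {\<tau>}"] unfolding indep_triangles_def by blast
    qed
    then have "card (T - {\<tau>}) \<le> incidence_rank ?K" using card_le_incidence_rank finK by blast
    then show "card T \<le> Suc (incidence_rank ?K)"
      using finT by (metis Suc_le_mono card_Suc_Diff1 Diff_empty Diff_insert0 le_SucI)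
  qed
  moreover have "Suc (incidence_rank ?K) \<le> incidence_rank K"
  proof -
    obtain T where T: "indep_triangles ?K T" "card T = incidence_rank ?K"
      using incidence_rank_attained[OF finK(2)] by metis
    have finT: "finite T" using indep_triangles_finite[OF finK(2) T(1)] .
    have TF: "T \<subseteq> triangles ?K" using T by (simp add: indep_triangles_def)
    then have \<tau>T: "\<tau> \<notin> T" using F by blast
    have "indep_triangles K (insert \<tau> T)"
      unfolding indep_triangles_def
    proof (intro conjI allI impI)
      fix c assume c: "\<forall>e\<in>edges K. (\<Sum>f\<in>insert \<tau> T. c f * incidence f e) = 0"
      then have s: "c \<tau> * incidence \<tau> e + (\<Sum>f\<in>T. c f * incidence f e) = 0" if "e \<in> edges K" for e
        using that finT \<tau>T by simp
      have "(\<Sum>f\<in>T. c f * incidence f \<sigma>) = 0" using zero TF by (intro sum.neutral) auto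
      then have "c \<tau> = 0" using s[of \<sigma>] E incidence_cases[OF col(3)] by auto
      then have "\<forall>f\<in>T. c f = 0" using s T(1) E unfolding indep_triangles_def by simp
      then show "\<forall>f\<in>insert \<tau> T. c f = 0" using \<open>c \<tau> = 0\<close> by simp
    qed (use TF F in auto)
    then show ?thesis using card_le_incidence_rank[OF finK(1)] T(2) finT \<tau>T by fastforce
  qed
  ultimately show ?thesis by simp
qed

text \<open>The removed column is a combination of the columns of the other three faces of the tetrahedron.\<close>
lemma incidence_rank_collapse_triangle:
  assumes K: "abstract_complex K" and col: "\<sigma> \<in> K" "\<tau> \<in> K" "\<sigma> \<subset> \<tau>"
    and card: "card \<sigma> = 3" "card \<tau> = 4"
  shows "incidence_rank K = incidence_rank (K - {\<sigma>, \<tau>})"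
proof -
  let ?K = "K - {\<sigma>, \<tau>}"
  have finK: "finite K" "finite ?K" using abstract_complexD(1)[OF K] by auto
  have E: "edges ?K = edges K" using card by (auto simp: edges_def)
  have F: "triangles ?K = triangles K - {\<sigma>}" using card by (auto simp: triangles_def)
  have fin\<tau>: "finite \<tau>" using abstract_complexD(2)[OF K] col by blast
  have same: "indep_triangles ?K T \<longleftrightarrow> indep_triangles K T" if "\<sigma> \<notin> T" for T
    using that unfolding indep_triangles_def E F by blast
  have "incidence_rank K \<le> incidence_rank ?K"
  proof (rule incidence_rank_le[OF finK(1)])
    fix T assume T: "indep_triangles K T"
    then have finT: "finite T" using indep_triangles_finite finK by blast
    show "card T \<le> incidence_rank ?K"
    proof (cases "\<sigma> \<in> T")
      case False
      then show ?thesis using same[OF False] T card_le_incidence_rank[OF finK(2)] by simp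
    next
      case True
      have "card (\<tau> - \<sigma>) = 1" using col(3) card fin\<tau> finite_subset[of \<sigma> \<tau>] by (subst card_Diff_subset) auto
      then obtain v0 where v0: "\<tau> - \<sigma> = {v0}" by (rule card_1_singletonE)
      then have \<sigma>v: "\<sigma> = \<tau> - {v0}" "v0 \<in> \<tau>" using col(3) by blast+
      define s where "s v = (-1::real) ^ card {x\<in>\<tau>. lex_less x v}" for v
      define Fc where "Fc = (\<lambda>v. \<tau> - {v}) ` (\<tau> - {v0})"
      \<comment> \<open>\<open>the_elem (\<tau> - f)\<close> recovers the vertex omitted by the face
        \<open>f\<close>. The relation between the four faces is solved for the one omitting
        \<open>v0\<close>; the sign \<open>s v0\<close> is its own inverse.\<close>
      define a where "a f = - s v0 * s (the_elem (\<tau> - f))" for f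
      have the: "the_elem (\<tau> - (\<tau> - {v})) = v" if "v \<in> \<tau>" for v
      proof -
        have "\<tau> - (\<tau> - {v}) = {v}" using that by blast
        then show ?thesis by simp
      qed
      have inj: "inj_on (\<lambda>v. \<tau> - {v}) (\<tau> - {v0})" by (rule inj_onI) blast
      have FcK: "Fc \<subseteq> triangles K"
      proof
        fix f assume "f \<in> Fc"
        then obtain v where v: "v \<in> \<tau>" "f = \<tau> - {v}" by (auto simp: Fc_def)
        then have "card f = 3" using card fin\<tau> by simp
        moreover from this have "f \<noteq> {}" by force
        ultimately show "f \<in> triangles K"
          using abstract_complexD(4)[OF K col(2), of f] v by (auto simp: triangles_def)
      qed
      have rel: "incidence \<sigma> e = (\<Sum>f\<in>Fc. a f * incidence f e)" if e: "e \<in> edges K" for e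
      proof -
        have "(\<Sum>v\<in>\<tau>. s v * incidence (\<tau> - {v}) e) = 0"
          unfolding s_def using boundary_of_boundary[OF fin\<tau> card(2)] e by (simp add: edges_def)
        then have "s v0 * incidence \<sigma> e = - (\<Sum>v\<in>\<tau> - {v0}. s v * incidence (\<tau> - {v}) e)"
          using sum.remove[OF fin\<tau> \<sigma>v(2), of "\<lambda>v. s v * incidence (\<tau> - {v}) e"] \<sigma>v(1) by simp
        then have "s v0 * (s v0 * incidence \<sigma> e) = (\<Sum>v\<in>\<tau> - {v0}. - s v0 * s v * incidence (\<tau> - {v}) e)"
          by (simp add: sum_distrib_left sum_negf mult.assoc)
        moreover have "s v0 * s v0 = 1" by (simp add: s_def flip: power_add)
        ultimately have "incidence \<sigma> e = (\<Sum>v\<in>\<tau> - {v0}. - s v0 * s v * incidence (\<tau> - {v}) e)"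
          by (simp flip: mult.assoc)
        also have "\<dots> = (\<Sum>f\<in>Fc. a f * incidence f e)"
          unfolding Fc_def sum.reindex[OF inj] by (intro sum.cong refl) (simp add: a_def the)
        finally show ?thesis .
      qed
      have "\<sigma> \<notin> Fc" using \<sigma>v unfolding Fc_def by blast
      then obtain f where f: "f \<in> Fc" "f \<notin> T" "indep_triangles K (insert f (T - {\<sigma>}))"
        using indep_triangles_exchange[OF finK(1) T True _ FcK _ rel] fin\<tau> by (auto simp: Fc_def)
      have "\<sigma> \<notin> insert f (T - {\<sigma>})" using \<open>\<sigma> \<notin> Fc\<close> f(1) by blast
      then have "card (insert f (T - {\<sigma>})) \<le> incidence_rank ?K"
        using same[of "insert f (T - {\<sigma>})"] f(3) card_le_incidence_rank[OF finK(2)] by metis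
      moreover have "card (insert f (T - {\<sigma>})) = card T"
        using finT f(2) card_Suc_Diff1[OF finT True] by simp
      ultimately show ?thesis by simp
    qed
  qed
  moreover have "incidence_rank ?K \<le> incidence_rank K"
  proof (rule incidence_rank_le[OF finK(2)])
    fix T assume T: "indep_triangles ?K T"
    then have "T \<subseteq> triangles ?K" by (simp add: indep_triangles_def)
    then have "\<sigma> \<notin> T" using F by blast
    then show "card T \<le> incidence_rank K" using same[of T] T card_le_incidence_rank[OF finK(1)] by metis
  qed
  ultimately show ?thesis by simp
qed

text \<open>The case of interest is a vertex removed together with an edge: that edge lies in no
  triangle, so its row is zero.\<close>

lemma incidence_rank_collapse_other:
  assumes col: "\<sigma> \<subset> \<tau>" "\<forall>\<rho>\<in>K. \<sigma> \<subset> \<rho> \<longrightarrow> \<rho> = \<tau>"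
    and card: "card \<sigma> \<noteq> 2" "card \<sigma> \<noteq> 3" "card \<tau> = card \<sigma> + 1"
  shows "incidence_rank K = incidence_rank (K - {\<sigma>, \<tau>})"
proof (rule incidence_rank_cong[symmetric])
  show "triangles (K - {\<sigma>, \<tau>}) = triangles K" "edges (K - {\<sigma>, \<tau>}) \<subseteq> edges K"
    using card by (auto simp: triangles_def edges_def)
  fix e f assume e: "e \<in> edges K - edges (K - {\<sigma>, \<tau>})" and f: "f \<in> triangles K"
  then have "e = \<tau>" using card by (auto simp: edges_def)
  moreover have "f \<in> K" using f by (simp add: triangles_def)
  ultimately have "\<not> e \<subset> f" using col by blast
  then show "incidence f e = 0" by (rule incidence_eq_0)
qed

section \<open>The matching read off from a collapse\<close>

lemma matching1D:
  assumes "matching1 K M"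
  shows "(e, f) \<in> M \<Longrightarrow> e \<in> edges K" "(e, f) \<in> M \<Longrightarrow> f \<in> triangles K" "(e, f) \<in> M \<Longrightarrow> e \<subset> f"
    "p \<in> M \<Longrightarrow> q \<in> M \<Longrightarrow> fst p = fst q \<Longrightarrow> p = q" "p \<in> M \<Longrightarrow> q \<in> M \<Longrightarrow> snd p = snd q \<Longrightarrow> p = q"
  using assms unfolding matching1_def by blast+

lemma matching1I:
  assumes "\<And>e f. (e, f) \<in> M \<Longrightarrow> e \<in> edges K \<and> f \<in> triangles K \<and> e \<subset> f"
    and "\<And>p q. p \<in> M \<Longrightarrow> q \<in> M \<Longrightarrow> fst p = fst q \<Longrightarrow> p = q"
    and "\<And>p q. p \<in> M \<Longrightarrow> q \<in> M \<Longrightarrow> snd p = snd q \<Longrightarrow> p = q"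
  shows "matching1 K M"
  unfolding matching1_def
proof (intro conjI ballI impI)
  fix p assume "p \<in> M"
  then show "case p of (e, f) \<Rightarrow> e \<in> edges K \<and> f \<in> triangles K \<and> e \<subset> f"
    using assms(1)[of "fst p" "snd p"] by (simp add: split_beta)
qed (rule assms; assumption)+

lemma matching1_finite:
  assumes "finite K" "matching1 K M" shows "finite M"
proof (rule finite_subset)
  show "M \<subseteq> edges K \<times> triangles K" using matching1D(1,2)[OF assms(2)] by auto
qed (use assms(1) in \<open>simp add: edges_def triangles_def\<close>)

lemma matching1_inj_on_snd: "matching1 K M \<Longrightarrow> inj_on snd M"
  using matching1D(5) by (rule inj_onI)

text \<open>On a cycle through the new pair the triangle following \<open>\<sigma>\<close> must
  contain \<open>\<sigma>\<close>. Among the matched triangles only \<open>\<tau>\<close> can do so,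
  and the cycle would have length one.\<close>

lemma acyclic_matching_insert:
  assumes acyc: "acyclic_matching M" and free: "\<And>e f. (e, f) \<in> M \<Longrightarrow> \<not> \<sigma> \<subset> f"
  shows "acyclic_matching (insert (\<sigma>, \<tau>) M)"
  unfolding acyclic_matching_def
proof (rule notI, elim exE conjE)
  fix h :: nat and ef :: "nat \<Rightarrow> 'a set \<times> 'a set"
  assume h: "2 \<le> h" and ef: "\<forall>i<h. ef i \<in> insert (\<sigma>, \<tau>) M" and inj: "inj_on (\<lambda>i. snd (ef i)) {..<h}"
    and cyc: "\<forall>i<h. fst (ef i) \<subset> snd (ef (Suc i mod h))"
  have "ef i \<in> M" if i: "i < h" for i
  proof (rule ccontr)
    assume "ef i \<notin> M"
    then have efi: "ef i = (\<sigma>, \<tau>)" using ef i by blast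
    let ?j = "Suc i mod h"
    have j: "?j < h" using h by simp
    have "\<sigma> \<subset> snd (ef ?j)" using cyc i efi by force
    then have "ef ?j = (\<sigma>, \<tau>)" using ef j free[of "fst (ef ?j)" "snd (ef ?j)"] by (metis insertE prod.collapse)
    then have "?j = i" using inj i j efi unfolding inj_on_def by auto
    then show False using h i by (metis Suc_lessI mod_less mod_self n_not_Suc_n One_nat_def Suc_1 Suc_n_not_le_n)
  qed
  then show False using acyc h inj cyc unfolding acyclic_matching_def by blast
qed

lemma collapse_matching:
  assumes K: "abstract_complex K" and col: "\<sigma> \<in> K" "\<tau> \<in> K" "\<sigma> \<subset> \<tau>" "\<forall>\<rho>\<in>K. \<sigma> \<subset> \<rho> \<longrightarrow> \<rho> = \<tau>"
    and card: "card \<tau> = card \<sigma> + 1"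
    and M: "matching1 (K - {\<sigma>, \<tau>}) M" "acyclic_matching M" "complete_matching (K - {\<sigma>, \<tau>}) M"
  shows "\<exists>M. matching1 K M \<and> acyclic_matching M \<and> complete_matching K M"
proof -
  let ?K = "K - {\<sigma>, \<tau>}"
  note M' = matching1D[OF M(1)]
  have sub: "edges ?K \<subseteq> edges K" "triangles ?K \<subseteq> triangles K" by (auto simp: edges_def triangles_def)
  have M1: "matching1 K M"
  proof (rule matching1I)
    fix e f assume "(e, f) \<in> M"
    then show "e \<in> edges K \<and> f \<in> triangles K \<and> e \<subset> f" using M'(1-3) sub by blast
  qed (rule M'(4,5); assumption)+
  show ?thesis
  proof (cases "card \<sigma> = 2")
    case False
    have "incidence_rank K = incidence_rank ?K"
    proof (cases "card \<sigma> = 3")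
      case True
      then show ?thesis using incidence_rank_collapse_triangle[OF K col(1-3)] card by simp
    next
      case f: False
      show ?thesis by (rule incidence_rank_collapse_other[OF col(3,4) False f card])
    qed
    then have "complete_matching K M" using M(3) by (simp add: complete_matching_def)
    then show ?thesis using M1 M(2) by blast
  next
    case True
    have mem: "e \<in> edges ?K" "f \<in> triangles ?K" if "(e, f) \<in> M" for e f
      using that M'(1,2) by auto
    have free: "\<not> \<sigma> \<subset> f" if "(e, f) \<in> M" for e f
    proof -
      have "f \<in> K" "f \<noteq> \<tau>" using mem(2)[OF that] by (auto simp: triangles_def)
      then show ?thesis using col(4) by blast
    qed
    have ne: "e \<noteq> \<sigma>" "f \<noteq> \<tau>" if "(e, f) \<in> M" for e f
      using mem[OF that] by (auto simp: edges_def triangles_def)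
    have "matching1 K (insert (\<sigma>, \<tau>) M)"
    proof (rule matching1I)
      fix e f assume "(e, f) \<in> insert (\<sigma>, \<tau>) M"
      then consider "(e, f) = (\<sigma>, \<tau>)" | "(e, f) \<in> M" by blast
      then show "e \<in> edges K \<and> f \<in> triangles K \<and> e \<subset> f"
      proof cases
        assume "(e, f) = (\<sigma>, \<tau>)"
        then show ?thesis using col(1-3) card True by (simp add: edges_def triangles_def)
      next
        assume "(e, f) \<in> M"
        then show ?thesis using matching1D(1-3)[OF M1] by blast
      qed
    next
      fix p q assume pq: "p \<in> insert (\<sigma>, \<tau>) M" "q \<in> insert (\<sigma>, \<tau>) M"
      have ne': "fst p \<noteq> \<sigma>" "snd p \<noteq> \<tau>" if "p \<in> M" for p
        using ne[of "fst p" "snd p"] that by simp_all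
      show "p = q" if "fst p = fst q"
        using pq that ne'(1) M'(4) by (metis fst_conv insertE)
      show "p = q" if "snd p = snd q"
        using pq that ne'(2) M'(5) by (metis snd_conv insertE)
    qed
    moreover have "acyclic_matching (insert (\<sigma>, \<tau>) M)" using acyclic_matching_insert[OF M(2) free] .
    moreover have "complete_matching K (insert (\<sigma>, \<tau>) M)"
    proof -
      have "finite M" using matching1_finite[OF abstract_complexD(1)[OF K] M1] .
      moreover have "(\<sigma>, \<tau>) \<notin> M" using ne by blast
      ultimately show ?thesis
        using M(3) incidence_rank_collapse_edge[OF K col True] card True by (simp add: complete_matching_def)
    qed
    ultimately show ?thesis by blast
  qed
qed

lemma collapsible_imp_complete_acyclic_matching:
  assumes "abstract_complex K" "collapsible K"
  shows "\<exists>M. matching1 K M \<and> acyclic_matching M \<and> complete_matching K M"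
proof -
  obtain v where v: "elem_collapse\<^sup>*\<^sup>* K {{v}}" using assms(2) unfolding collapsible_def by blast
  then show ?thesis using assms(1)
  proof (induction rule: converse_rtranclp_induct)
    case base
    have "triangles {{v}} = {}" by (auto simp: triangles_def)
    then have "incidence_rank {{v}} \<le> 0"
      by (intro incidence_rank_le) (auto simp: indep_triangles_def)
    then have "complete_matching {{v}} {}" by (simp add: complete_matching_def)
    moreover have "acyclic_matching ({} :: (pt set \<times> pt set) set)"
      unfolding acyclic_matching_def by (intro notI, elim exE conjE) (auto dest: spec[of _ 0])
    moreover have "matching1 {{v}} {}" by (rule matching1I) auto
    ultimately show ?case by blast
  next
    case (step K K')
    obtain \<sigma> \<tau> where st: "\<sigma> \<in> K" "\<tau> \<in> K" "\<sigma> \<subset> \<tau>" "card \<tau> = card \<sigma> + 1"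
      "\<forall>\<rho>\<in>K. \<sigma> \<subset> \<rho> \<longrightarrow> \<rho> = \<tau>" "K' = K - {\<sigma>, \<tau>}"
      using step.hyps(1) unfolding elem_collapse_def by blast
    have "abstract_complex K'" using abstract_complex_collapse[OF step.prems st(3,5)] st(6) by simp
    then show ?case using step.IH collapse_matching[OF step.prems st(1-3,5,4)] st(6) by blast
  qed
qed

section \<open>Integral cocycles and graphs\<close>

text \<open>Simplicial 1-cocycles in alternating form. On a triple with repeated vertices the sum
  condition follows from antisymmetry, so its content concerns triangles.\<close>

definition cocycle :: "'a set set \<Rightarrow> ('a \<Rightarrow> 'a \<Rightarrow> int) \<Rightarrow> bool" where
  "cocycle K \<phi> \<longleftrightarrow> (\<forall>a b. \<phi> b a = - \<phi> a b) \<and> (\<forall>a b c. {a, b, c} \<in> K \<longrightarrow> \<phi> a b + \<phi> b c + \<phi> c a = 0)"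

text \<open>In cohomological terms, the map from integral to real first cohomology is zero. Real
  values are what the logarithm of a circle-valued map supplies.\<close>

definition cocycles_exact :: "'a set set \<Rightarrow> bool" where
  "cocycles_exact K \<longleftrightarrow> (\<forall>\<phi>. cocycle K \<phi> \<longrightarrow>
     (\<exists>g :: 'a \<Rightarrow> real. \<forall>a b. {a, b} \<in> K \<longrightarrow> of_int (\<phi> a b) = g b - g a))"

text \<open>Stated through sets closed under adjacency, so that a collapse is treated by adjusting
  such a set instead of manipulating paths.\<close>

definition edge_connected :: "'a set set \<Rightarrow> bool" where
  "edge_connected K \<longleftrightarrow> (\<forall>A. (\<forall>a b. {a, b} \<in> K \<longrightarrow> a \<in> A \<longrightarrow> b \<in> A) \<longrightarrow>
     (\<forall>v w. {v} \<in> K \<longrightarrow> {w} \<in> K \<longrightarrow> v \<in> A \<longrightarrow> w \<in> A))"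

lemma card_le_2_cases: "card {x, y, z} \<le> 2 \<Longrightarrow> x = y \<or> y = z \<or> z = x"
  by (rule ccontr) auto

lemma antisym_degenerate_triple:
  fixes \<phi> :: "'a \<Rightarrow> 'a \<Rightarrow> int"
  assumes anti: "\<And>a b. \<phi> b a = - \<phi> a b" and "card {x, y, z} \<le> 2"
  shows "\<phi> x y + \<phi> y z + \<phi> z x = 0"
proof -
  have "\<phi> a a = 0" for a using anti[of a a] by simp
  then show ?thesis using card_le_2_cases[OF assms(2)] anti[of x y] anti[of y z] anti[of z x] by auto
qed

text \<open>A cocycle of the smaller complex extends: the value on a restored edge is forced by its
  triangle, and the condition on a restored triangle follows from the other three faces of its
  tetrahedron. A primitive of the extension restricts back.\<close>

lemma cocycles_exact_collapse:
  assumes K: "abstract_complex K" and col: "\<sigma> \<in> K" "\<tau> \<in> K" "\<sigma> \<subset> \<tau>" "\<forall>\<rho>\<in>K. \<sigma> \<subset> \<rho> \<longrightarrow> \<rho> = \<tau>"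
    and card: "card \<tau> = card \<sigma> + 1" and ex: "cocycles_exact K"
  shows "cocycles_exact (K - {\<sigma>, \<tau>})"
  unfolding cocycles_exact_def
proof (intro allI impI)
  let ?K = "K - {\<sigma>, \<tau>}"
  fix \<phi> assume \<phi>: "cocycle ?K \<phi>"
  have anti: "\<phi> b a = - \<phi> a b" for a b using \<phi> unfolding cocycle_def by blast
  have tri: "\<phi> a b + \<phi> b c + \<phi> c a = 0" if "{a, b, c} \<in> ?K" for a b c
    using \<phi> that unfolding cocycle_def by blast
  have fin\<tau>: "finite \<tau>" using abstract_complexD(2)[OF K col(2)] .
  have "card (\<tau> - \<sigma>) = 1" using col(3) card fin\<tau> finite_subset[of \<sigma> \<tau>] by (subst card_Diff_subset) auto
  then obtain d where d: "\<tau> - \<sigma> = {d}" by (rule card_1_singletonE)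
  then have \<tau>: "\<tau> = insert d \<sigma>" "d \<notin> \<sigma>" using col(3) by blast+
  obtain \<phi>' where \<phi>': "cocycle K \<phi>'" "\<And>x y. {x, y} \<in> ?K \<Longrightarrow> \<phi>' x y = \<phi> x y"
  proof (cases "card \<sigma> = 2")
    case True
    then obtain a b where ab: "\<sigma> = {a, b}" "a \<noteq> b" by (auto simp: card_2_iff)
    define \<phi>' where "\<phi>' x y = (if x = a \<and> y = b then \<phi> a d + \<phi> d b
      else if x = b \<and> y = a then - (\<phi> a d + \<phi> d b) else \<phi> x y)" for x y
    have anti': "\<phi>' y x = - \<phi>' x y" for x y using anti[of x y] ab(2) by (auto simp: \<phi>'_def)
    have same: "\<phi>' x y = \<phi> x y" if "{x, y} \<noteq> \<sigma>" for x y using that ab by (auto simp: \<phi>'_def)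
    have "cocycle K \<phi>'"
      unfolding cocycle_def
    proof (intro conjI allI impI anti')
      fix x y z assume xyz: "{x, y, z} \<in> K"
      consider "card {x, y, z} \<le> 2" | "{x, y, z} = \<tau>" "card {x, y, z} = 3" | "{x, y, z} \<in> ?K"
        using xyz True card by fastforce
      then show "\<phi>' x y + \<phi>' y z + \<phi>' z x = 0"
      proof cases
        case 1
        then show ?thesis using antisym_degenerate_triple[of \<phi>' x y z] anti' by blast
      next
        case 2
        have dist: "x \<noteq> y" "y \<noteq> z" "z \<noteq> x" using 2(2) by (auto simp: card_insert_if split: if_splits)
        have da: "d \<noteq> a" "d \<noteq> b" using \<tau>(2) ab(1) by auto
        have "{x, y, z} = {d, a, b}" using 2(1) \<tau>(1) ab(1) by simp
        have "x = d \<and> y = a \<and> z = b \<or> x = d \<and> y = b \<and> z = a \<or> x = a \<and> y = d \<and> z = b \<or>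
            x = a \<and> y = b \<and> z = d \<or> x = b \<and> y = d \<and> z = a \<or> x = b \<and> y = a \<and> z = d"
        proof -
          have "x \<in> {d, a, b}" "y \<in> {d, a, b}" "z \<in> {d, a, b}"
            using \<open>{x, y, z} = {d, a, b}\<close> by (metis insertI1 insertI2)+
          then show ?thesis using dist by auto
        qed
        moreover have "\<phi>' a b = \<phi> a d + \<phi> d b" "\<phi>' b a = - (\<phi> a d + \<phi> d b)"
          "\<phi>' d a = - \<phi> a d" "\<phi>' a d = \<phi> a d" "\<phi>' d b = \<phi> d b" "\<phi>' b d = - \<phi> d b"
          using ab(2) da anti[of a d] anti[of d b] by (auto simp: \<phi>'_def)
        ultimately show ?thesis by (elim disjE) simp_all
      next
        case 3
        have "\<not> \<sigma> \<subseteq> {x, y, z}" using 3 col(4) by blast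
        then have "{x, y} \<noteq> \<sigma>" "{y, z} \<noteq> \<sigma>" "{z, x} \<noteq> \<sigma>" by blast+
        then show ?thesis using tri[OF 3] same by simp
      qed
    qed
    then show thesis using that[of \<phi>'] same by blast
  next
    case False
    have "cocycle K \<phi>"
      unfolding cocycle_def
    proof (intro conjI allI impI anti)
      fix x y z assume xyz: "{x, y, z} \<in> K"
      have "card {x, y, z} \<le> 3" by (simp add: card_insert_if)
      then consider "card {x, y, z} \<le> 2" | "{x, y, z} = \<sigma>" "card \<sigma> = 3" | "{x, y, z} \<in> ?K"
        using xyz False card by fastforce
      then show "\<phi> x y + \<phi> y z + \<phi> z x = 0"
      proof cases
        case 1
        then show ?thesis using antisym_degenerate_triple[of \<phi> x y z] anti by blast
      next
        case 2
        have face: "{u, w, d} \<in> ?K" if "u \<in> \<sigma>" "w \<in> \<sigma>" for u w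
        proof -
          have "{u, w, d} \<in> K" using abstract_complexD(4)[OF K col(2), of "{u, w, d}"] that \<tau>(1) by blast
          moreover have "card {u, w, d} \<le> 3" by (simp add: card_insert_if)
          then have "{u, w, d} \<noteq> \<tau>" using card 2(2) by auto
          moreover have "{u, w, d} \<noteq> \<sigma>" using \<tau>(2) by blast
          ultimately show ?thesis by blast
        qed
        have "x \<in> \<sigma>" "y \<in> \<sigma>" "z \<in> \<sigma>" using 2(1) by blast+
        then show ?thesis
          using tri[OF face[of x y]] tri[OF face[of y z]] tri[OF face[of z x]]
            anti[of x d] anti[of y d] anti[of z d] by simp
      next
        case 3
        then show ?thesis by (rule tri)
      qed
    qed
    then show thesis using that[of \<phi>] by blast
  qed
  obtain g :: "'a \<Rightarrow> real" where g: "\<forall>a b. {a, b} \<in> K \<longrightarrow> of_int (\<phi>' a b) = g b - g a"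
    using ex[unfolded cocycles_exact_def, rule_format, OF \<phi>'(1)] by (rule exE)
  show "\<exists>g :: 'a \<Rightarrow> real. \<forall>a b. {a, b} \<in> ?K \<longrightarrow> of_int (\<phi> a b) = g b - g a"
  proof (intro exI[of _ g] allI impI)
    fix a b assume "{a, b} \<in> ?K"
    then show "of_int (\<phi> a b) = g b - g a" using g[rule_format, of a b] \<phi>'(2)[of a b] by auto
  qed
qed

text \<open>Adjacency is touched in the two lowest dimensions only. A restored vertex hangs on a
  single neighbour; a restored edge can be bypassed through the third vertex of its
  triangle.\<close>

lemma edge_connected_collapse:
  assumes K: "abstract_complex K" and col: "\<sigma> \<in> K" "\<tau> \<in> K" "\<sigma> \<subset> \<tau>" "\<forall>\<rho>\<in>K. \<sigma> \<subset> \<rho> \<longrightarrow> \<rho> = \<tau>"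
    and card: "card \<tau> = card \<sigma> + 1" and conn: "edge_connected K"
  shows "edge_connected (K - {\<sigma>, \<tau>})"
  unfolding edge_connected_def
proof (intro allI impI)
  let ?K = "K - {\<sigma>, \<tau>}"
  fix A v w assume A: "\<forall>a b. {a, b} \<in> ?K \<longrightarrow> a \<in> A \<longrightarrow> b \<in> A"
    and v: "{v} \<in> ?K" and w: "{w} \<in> ?K" and vA: "v \<in> A"
  have conn': "w \<in> B" if "\<And>a b. {a, b} \<in> K \<Longrightarrow> a \<in> B \<Longrightarrow> b \<in> B" "v \<in> B" for B
    using conn that v w unfolding edge_connected_def by blast
  have fin\<tau>: "finite \<tau>" using abstract_complexD(2)[OF K col(2)] .
  have "card (\<tau> - \<sigma>) = 1" using col(3) card fin\<tau> finite_subset[of \<sigma> \<tau>] by (subst card_Diff_subset) auto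
  then obtain d where d: "\<tau> - \<sigma> = {d}" by (rule card_1_singletonE)
  then have \<tau>: "\<tau> = insert d \<sigma>" "d \<notin> \<sigma>" using col(3) by blast+
  have "finite \<sigma>" "\<sigma> \<noteq> {}" using abstract_complexD(2,3)[OF K col(1)] by auto
  then have "0 < card \<sigma>" by (simp add: card_gt_0_iff)
  then consider "card \<sigma> = 1" | "card \<sigma> = 2" | "3 \<le> card \<sigma>" by linarith
  then show "w \<in> A"
  proof cases
    case 1
    then obtain u where u: "\<sigma> = {u}" by (rule card_1_singletonE)
    have uvw: "v \<noteq> u" "w \<noteq> u" using v w u by auto
    \<comment> \<open>Membership of \<open>u\<close> is made to agree with that of its only
      neighbour \<open>d\<close>, which keeps the set closed under adjacency in the larger
      complex.\<close>
    have "w \<in> (A - {u}) \<union> (if d \<in> A then {u} else {})"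
    proof (rule conn')
      fix a b assume ab: "{a, b} \<in> K" "a \<in> (A - {u}) \<union> (if d \<in> A then {u} else {})"
      consider "a = b" | "{a, b} = \<tau>" "a \<noteq> b" | "{a, b} \<in> ?K" "u \<noteq> a" "u \<noteq> b"
        using ab(1) col(4) u by (metis Diff_iff empty_iff insertCI insertE insert_absorb2 psubsetI singleton_insert_inj_eq' subset_insertI insert_commute)
      then show "b \<in> (A - {u}) \<union> (if d \<in> A then {u} else {})"
      proof cases
        case 2
        then have "a = u \<and> b = d \<or> a = d \<and> b = u" using \<tau> u by (metis doubleton_eq_iff)
        then show ?thesis using ab(2) \<tau>(2) u by (auto split: if_splits)
      next
        case 3
        then have "a \<in> A" using ab(2) by (auto split: if_splits)
        then have "b \<in> A" using A 3 by blast
        then show ?thesis using 3 by blast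
      qed (use ab(2) in simp)
    qed (use vA uvw in simp)
    then show ?thesis using uvw by (auto split: if_splits)
  next
    case 2
    then obtain a b where ab: "\<sigma> = {a, b}" "a \<noteq> b" by (auto simp: card_2_iff)
    have face: "{x, d} \<in> ?K" "{d, x} \<in> ?K" if "x \<in> \<sigma>" for x
    proof -
      have "{x, d} \<in> K" using abstract_complexD(4)[OF K col(2), of "{x, d}"] that \<tau>(1) by blast
      moreover have "card {x, d} \<le> 2" by (simp add: card_insert_if)
      then have "{x, d} \<noteq> \<tau>" using card 2 by auto
      moreover have "{x, d} \<noteq> \<sigma>" using \<tau>(2) by blast
      ultimately show "{x, d} \<in> ?K" by blast
      then show "{d, x} \<in> ?K" by (simp add: insert_commute)
    qed
    show ?thesis
    proof (rule conn'[OF _ vA])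
      fix x y assume xy: "{x, y} \<in> K" "x \<in> A"
      have "card {x, y} \<le> 2" by (simp add: card_insert_if)
      then have "{x, y} \<noteq> \<tau>" using card 2 by auto
      show "y \<in> A"
      proof (cases "{x, y} = \<sigma>")
        case True
        then have "x \<in> \<sigma>" "y \<in> \<sigma>" by blast+
        then have "d \<in> A" using A[rule_format, OF face(1) xy(2)] by simp
        then show ?thesis using A[rule_format, OF face(2)[OF \<open>y \<in> \<sigma>\<close>]] by simp
      next
        case False
        then show ?thesis using A xy \<open>{x, y} \<noteq> \<tau>\<close> by blast
      qed
    qed
  next
    case 3
    show ?thesis
    proof (rule conn'[OF _ vA])
      fix x y assume xy: "{x, y} \<in> K" "x \<in> A"
      have "card {x, y} \<le> 2" by (simp add: card_insert_if)
      then have "{x, y} \<noteq> \<tau>" "{x, y} \<noteq> \<sigma>" using card 3 by auto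
      then show "y \<in> A" using A xy by blast
    qed
  qed
qed

lemma collapse_preserves:
  assumes "elem_collapse\<^sup>*\<^sup>* K L" "abstract_complex K" "cocycles_exact K" "edge_connected K"
  shows "abstract_complex L \<and> cocycles_exact L \<and> edge_connected L"
  using assms
proof (induction rule: rtranclp_induct)
  case (step L L')
  then have L: "abstract_complex L" "cocycles_exact L" "edge_connected L" by blast+
  obtain \<sigma> \<tau> where st: "\<sigma> \<in> L" "\<tau> \<in> L" "\<sigma> \<subset> \<tau>" "\<forall>\<rho>\<in>L. \<sigma> \<subset> \<rho> \<longrightarrow> \<rho> = \<tau>" "card \<tau> = card \<sigma> + 1"
    "L' = L - {\<sigma>, \<tau>}"
    using step.hyps(2) unfolding elem_collapse_def by blast
  show ?case unfolding st(6)
    using abstract_complex_collapse[OF L(1) st(3,4)] cocycles_exact_collapse[OF L(1) st(1-5) L(2)]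
      edge_connected_collapse[OF L(1) st(1-5) L(3)] by blast
qed blast

text \<open>On a graph every alternating function is a cocycle, in particular the one supported on a
  single edge. Its primitive jumps across this edge and is constant along all others, so the edge is
  a bridge.\<close>

lemma exact_graph_separating_function:
  assumes card: "\<forall>\<sigma>\<in>G. card \<sigma> \<le> 2" and ex: "cocycles_exact G" and e: "{a, b} \<in> G" "a \<noteq> b"
  shows "\<exists>g :: 'a \<Rightarrow> real. g b = g a + 1 \<and> (\<forall>x y. {x, y} \<in> G \<longrightarrow> {x, y} \<noteq> {a, b} \<longrightarrow> g x = g y)"
proof -
  define \<phi> where "\<phi> x y = (if x = a \<and> y = b then 1 else if x = b \<and> y = a then - 1 else 0 :: int)" for x y
  have anti: "\<phi> y x = - \<phi> x y" for x y using e(2) by (auto simp: \<phi>_def)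
  have "cocycle G \<phi>"
    unfolding cocycle_def
  proof (intro conjI allI impI anti)
    fix x y z assume "{x, y, z} \<in> G"
    then show "\<phi> x y + \<phi> y z + \<phi> z x = 0" using card antisym_degenerate_triple[of \<phi>] anti by blast
  qed
  then obtain g :: "'a \<Rightarrow> real" where g: "\<forall>x y. {x, y} \<in> G \<longrightarrow> of_int (\<phi> x y) = g y - g x"
    using ex unfolding cocycles_exact_def by blast
  have "g b = g a + 1" using g e(1) by (force simp: \<phi>_def)
  moreover have "g x = g y" if "{x, y} \<in> G" "{x, y} \<noteq> {a, b}" for x y
  proof -
    have "\<phi> x y = 0" using that(2) by (auto simp: \<phi>_def)
    then show ?thesis using g that(1) by force
  qed
  ultimately show ?thesis by blast
qed

text \<open>Removing an edge splits the graph in two; an edge whose far side is smallest ends in a leaf.\<close>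
lemma exact_graph_leaf:
  assumes G: "abstract_complex G" and card: "\<forall>\<sigma>\<in>G. card \<sigma> \<le> 2"
    and ex: "cocycles_exact G" and conn: "edge_connected G" and edge: "{a0, b0} \<in> G" "a0 \<noteq> b0"
  obtains a b where "{a, b} \<in> G" "a \<noteq> b" "\<And>c. {b, c} \<in> G \<Longrightarrow> c = b \<or> c = a"
proof -
  define R where "R p \<longleftrightarrow> (case p of (a, b, g :: 'a \<Rightarrow> real) \<Rightarrow> {a, b} \<in> G \<and> a \<noteq> b \<and> g b = g a + 1 \<and>
    (\<forall>x y. {x, y} \<in> G \<longrightarrow> {x, y} \<noteq> {a, b} \<longrightarrow> g x = g y))" for p
  \<comment> \<open>The number of vertices on the far side of the edge, where \<open>g\<close> has
    the same value as at \<open>b\<close>.\<close>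
  define m where "m p = (case p of (a :: 'a, b, g :: 'a \<Rightarrow> real) \<Rightarrow> card {v. {v} \<in> G \<and> g v = g b})" for p
  have finV: "finite {v. {v} \<in> G \<and> P v}" for P
  proof -
    have "finite (\<Union>G)" using abstract_complexD(1,2)[OF G] by blast
    moreover have "{v. {v} \<in> G \<and> P v} \<subseteq> \<Union>G" by blast
    ultimately show ?thesis by (rule rev_finite_subset)
  qed
  obtain g0 where "R (a0, b0, g0)"
    using exact_graph_separating_function[OF card ex edge] edge by (auto simp: R_def)
  then obtain p where p: "R p" "\<And>p'. R p' \<Longrightarrow> m p \<le> m p'"
    using ex_has_least_nat[of R _ m] by blast
  obtain a b g where abg: "p = (a, b, g)" by (cases p) auto
  have R: "{a, b} \<in> G" "a \<noteq> b" "g b = g a + 1" "\<And>x y. {x, y} \<in> G \<Longrightarrow> {x, y} \<noteq> {a, b} \<Longrightarrow> g x = g y"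
    using p(1) by (auto simp: R_def abg)
  have bG: "{b} \<in> G" using abstract_complexD(4)[OF G R(1), of "{b}"] by blast
  have "c = b \<or> c = a" if bc: "{b, c} \<in> G" for c
  proof (rule ccontr)
    assume c: "\<not> (c = b \<or> c = a)"
    then have ne: "{b, c} \<noteq> {a, b}" using R(2) by (metis doubleton_eq_iff)
    have gc: "g c = g b" using R(4)[OF bc ne] by simp
    have "b \<noteq> c" using c by blast
    obtain g' where g': "g' c = g' b + 1" "\<And>x y. {x, y} \<in> G \<Longrightarrow> {x, y} \<noteq> {b, c} \<Longrightarrow> g' x = (g' y :: real)"
      using exact_graph_separating_function[OF card ex bc \<open>b \<noteq> c\<close>] by blast
    have "R (b, c, g')" using g' bc \<open>b \<noteq> c\<close> by (auto simp: R_def)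
    then have "m p \<le> m (b, c, g')" by (rule p(2))
    moreover have "{v. {v} \<in> G \<and> g' v = g' c} \<subset> {v. {v} \<in> G \<and> g v = g b}"
    proof
      show "{v. {v} \<in> G \<and> g' v = g' c} \<noteq> {v. {v} \<in> G \<and> g v = g b}" using bG g'(1) by force
      show "{v. {v} \<in> G \<and> g' v = g' c} \<subseteq> {v. {v} \<in> G \<and> g v = g b}"
      proof (rule ccontr)
        assume "\<not> ?thesis"
        then obtain v where v: "{v} \<in> G" "g' v = g' c" "g v \<noteq> g b" by blast
        \<comment> \<open>The vertices off both far levels, that of \<open>b\<close> under
          \<open>g\<close> and that of \<open>b\<close> under \<open>g'\<close>. None of
          \<open>a\<close>, \<open>b\<close>, \<open>c\<close> is among them, so no adjacency leaves
          \<open>X\<close>; yet \<open>X\<close> would contain \<open>v\<close> and not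
          \<open>b\<close>, against connectedness.\<close>
        define X where "X = {x. g x \<noteq> g b \<and> g' x \<noteq> g' b}"
        have "y \<in> X" if xy: "{x, y} \<in> G" "x \<in> X" for x y
        proof -
          have x: "g x \<noteq> g b" "g' x \<noteq> g' b" using xy(2) by (auto simp: X_def)
          have "g' a = g' b" using g'(2)[OF R(1)] ne by blast
          then have "x \<noteq> a" "x \<noteq> b" "x \<noteq> c" using x gc by auto
          then have "{x, y} \<noteq> {a, b}" "{x, y} \<noteq> {b, c}" by (auto simp: doubleton_eq_iff)
          then have "g x = g y" "g' x = g' y" using R(4)[OF xy(1)] g'(2)[OF xy(1)] by blast+
          then show ?thesis using x by (simp add: X_def)
        qed
        moreover have "v \<in> X" using v g'(1) by (simp add: X_def)
        ultimately have "b \<in> X" using conn v(1) bG unfolding edge_connected_def by blast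
        then show False by (simp add: X_def)
      qed
    qed
    then have "m (b, c, g') < m p" unfolding m_def abg using finV by (simp add: psubset_card_mono)
    ultimately show False by simp
  qed
  then show thesis using that R(1,2) by blast
qed

text \<open>As long as there is an edge, a leaf collapses with its edge; without edges,
  connectedness leaves one vertex.\<close>

lemma exact_graph_collapsible:
  assumes "abstract_complex G" "G \<noteq> {}" "\<forall>\<sigma>\<in>G. card \<sigma> \<le> 2" "cocycles_exact G" "edge_connected G"
  shows "collapsible G"
  using assms
proof (induction "card G" arbitrary: G rule: less_induct)
  case less
  note G = abstract_complexD[OF less.prems(1)]
  show ?case
  proof (cases "\<exists>e\<in>G. card e = 2")
    case False
    have single: "\<exists>v. \<sigma> = {v}" if "\<sigma> \<in> G" for \<sigma>
    proof -
      have "card \<sigma> \<le> 2" "card \<sigma> \<noteq> 2" "card \<sigma> \<noteq> 0" using less.prems(3) False that G(2,3) by auto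
      then have "card \<sigma> = 1" by linarith
      then show ?thesis by (metis card_1_singletonE)
    qed
    obtain v where v: "{v} \<in> G" using less.prems(2) single by blast
    have "w = v" if "{w} \<in> G" for w
    proof -
      have "b \<in> {v}" if "{a, b} \<in> G" "a \<in> {v}" for a b using single[OF that(1)] that(2) by auto
      then have "w \<in> {v}" using less.prems(5) v that unfolding edge_connected_def by blast
      then show ?thesis by simp
    qed
    then have "G = {{v}}" using single v by blast
    then show ?thesis unfolding collapsible_def by blast
  next
    case True
    then obtain a0 b0 where e0: "{a0, b0} \<in> G" "a0 \<noteq> b0" by (auto simp: card_2_iff)
    obtain a b where ab: "{a, b} \<in> G" "a \<noteq> b" "\<And>c. {b, c} \<in> G \<Longrightarrow> c = b \<or> c = a"
      using exact_graph_leaf[OF less.prems(1,3-5) e0] by metis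
    have bG: "{b} \<in> G" "{a} \<in> G" using G(4)[OF ab(1)] by auto
    have sub: "{b} \<subset> {a, b}" using ab(2) by auto
    have uniq: "\<forall>\<rho>\<in>G. {b} \<subset> \<rho> \<longrightarrow> \<rho> = {a, b}"
    proof (intro ballI impI)
      fix \<rho> assume \<rho>: "\<rho> \<in> G" "{b} \<subset> \<rho>"
      then have "card {b} < card \<rho>" using G(2) by (intro psubset_card_mono)
      then have "card \<rho> = 2" using less.prems(3) \<rho>(1) by fastforce
      then obtain c where "\<rho> = {b, c}" "c \<noteq> b" using \<rho>(2) by (auto simp: card_2_iff)
      then show "\<rho> = {a, b}" using ab(3) \<rho>(1) by blast
    qed
    let ?G = "G - {{b}, {a, b}}"
    have card2: "card {a, b} = card {b} + 1" using ab(2) by simp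
    have col: "elem_collapse G ?G"
      by (rule elem_collapseI[OF bG(1) ab(1) sub card2 uniq])
    have "?G \<subset> G" using bG by blast
    then have "card ?G < card G" using G(1) by (rule psubset_card_mono[rotated])
    moreover have "abstract_complex ?G \<and> cocycles_exact ?G \<and> edge_connected ?G"
      using collapse_preserves[OF r_into_rtranclp[of elem_collapse, OF col] less.prems(1,4,5)] .
    moreover have "{a} \<in> ?G" using bG ab(2) by auto
    moreover have "\<forall>\<sigma>\<in>?G. card \<sigma> \<le> 2" using less.prems(3) by blast
    ultimately have "collapsible ?G" using less.hyps[of ?G] by blast
    then show ?thesis unfolding collapsible_def using col by (meson converse_rtranclp_into_rtranclp)
  qed
qed

section \<open>Cohomology of contractible polyhedra\<close>

lemma simplicial_complex_abstract: "simplicial_complex K \<Longrightarrow> abstract_complex K"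
  unfolding abstract_complex_def
  using simplicial_complex_finite simplex_finite simplex_nonempty simplex_face by metis

lemma convex_hull_inter_eq:
  "simplicial_complex K \<Longrightarrow> \<sigma> \<in> K \<Longrightarrow> \<tau> \<in> K \<Longrightarrow> convex hull \<sigma> \<inter> convex hull \<tau> = convex hull (\<sigma> \<inter> \<tau>)"
  unfolding simplicial_complex_def by blast

lemma closed_simplex: "simplicial_complex K \<Longrightarrow> \<sigma> \<in> K \<Longrightarrow> closed (convex hull \<sigma>)"
  using simplex_finite finite_imp_compact_convex_hull compact_imp_closed by blast

text \<open>A set closed under adjacency contains or misses the vertices of each simplex entirely.
  The two families of simplices have disjoint closed unions, which would separate the
  polyhedron.\<close>

lemma connected_imp_edge_connected:
  assumes K: "simplicial_complex K" and conn: "connected (polyhedron K)"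
  shows "edge_connected K"
  unfolding edge_connected_def
proof (intro allI impI, rule ccontr)
  fix A v w assume A: "\<forall>a b. {a, b} \<in> K \<longrightarrow> a \<in> A \<longrightarrow> b \<in> A"
    and vw: "{v} \<in> K" "{w} \<in> K" "v \<in> A" "w \<notin> A"
  have finK: "finite K" using simplicial_complex_finite[OF K] .
  define U where "U = (\<Union>\<sigma>\<in>{\<sigma>\<in>K. \<sigma> \<subseteq> A}. convex hull \<sigma>)"
  define V where "V = (\<Union>\<sigma>\<in>{\<sigma>\<in>K. \<sigma> \<inter> A = {}}. convex hull \<sigma>)"
  have closed: "closed U" "closed V"
    unfolding U_def V_def using finK closed_simplex[OF K] by (auto intro!: closed_UN)
  have "\<sigma> \<subseteq> A \<or> \<sigma> \<inter> A = {}" if \<sigma>: "\<sigma> \<in> K" for \<sigma>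
  proof (rule ccontr)
    assume "\<not> ?thesis"
    then obtain a b where "a \<in> \<sigma>" "a \<in> A" "b \<in> \<sigma>" "b \<notin> A" by blast
    moreover from this have "{a, b} \<in> K" using simplex_face[OF K \<sigma>, of "{a, b}"] by blast
    ultimately show False using A by blast
  qed
  then have cover: "polyhedron K \<subseteq> U \<union> V" unfolding polyhedron_def U_def V_def by blast
  have "convex hull \<sigma> \<inter> convex hull \<tau> = {}" if "\<sigma> \<in> K" "\<sigma> \<subseteq> A" "\<tau> \<in> K" "\<tau> \<inter> A = {}" for \<sigma> \<tau>
  proof -
    have "\<sigma> \<inter> \<tau> = {}" using that by blast
    then show ?thesis using convex_hull_inter_eq[OF K that(1,3)] by simp
  qed
  then have disj: "U \<inter> V \<inter> polyhedron K = {}" unfolding U_def V_def by blast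
  have poly: "u \<in> polyhedron K" if "{u} \<in> K" for u
    unfolding polyhedron_def using that by (intro UN_I[of "{u}"]) auto
  have "v \<in> U" "w \<in> V" unfolding U_def V_def using vw by (auto intro!: UN_I[of "{v}"] UN_I[of "{w}"])
  then show False
    using connected_closedD[OF conn disj cover closed] poly[OF vw(1)] poly[OF vw(2)] by blast
qed

text \<open>An integer cocycle is locally the differential of an affine function that is well defined modulo 1,
  which yields a map to the circle; its logarithm is a global primitive.\<close>
lemma contractible_imp_cocycles_exact:
  assumes K: "simplicial_complex K" and contr: "contractible (polyhedron K)"
  shows "cocycles_exact K"
  unfolding cocycles_exact_def
proof (intro allI impI)
  fix \<phi> :: "pt \<Rightarrow> pt \<Rightarrow> int" assume \<phi>: "cocycle K \<phi>"
  have anti: "\<phi> b a = - \<phi> a b" for a b using \<phi> unfolding cocycle_def by blast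
  have tri: "\<phi> a b + \<phi> b c + \<phi> c a = 0" if "{a, b, c} \<in> K" for a b c
    using \<phi> that unfolding cocycle_def by blast
  have diag: "\<phi> a a = 0" for a using anti[of a a] by simp
  \<comment> \<open>Normalises the local primitive to vanish at one vertex; another choice changes
    it by an integer.\<close>
  define base where "base \<sigma> = (SOME v. v \<in> \<sigma>)" for \<sigma> :: "pt set"
  have base: "base \<sigma> \<in> \<sigma>" if "\<sigma> \<in> K" for \<sigma>
    using simplex_nonempty[OF K that] unfolding base_def by (simp add: some_in_eq)
  have "\<forall>\<sigma>\<in>K. \<exists>p. \<forall>w\<in>\<sigma>. fst p \<bullet> w + snd p = real_of_int (\<phi> (base \<sigma>) w)"
    using affine_interpolation[OF simplex_affine_independent[OF K]] by simp
  then obtain p where p: "\<forall>\<sigma>\<in>K. \<forall>w\<in>\<sigma>. fst (p \<sigma>) \<bullet> w + snd (p \<sigma>) = real_of_int (\<phi> (base \<sigma>) w)"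
    by (rule bchoice[THEN exE])
  define \<psi> where "\<psi> \<sigma> x = fst (p \<sigma>) \<bullet> x + snd (p \<sigma>)" for \<sigma> x
  have \<psi>: "\<psi> \<sigma> w = \<phi> (base \<sigma>) w" if "\<sigma> \<in> K" "w \<in> \<sigma>" for \<sigma> w using p that by (simp add: \<psi>_def)
  define h where "h \<sigma> x = exp (\<i> * complex_of_real (2 * pi * \<psi> \<sigma> x))" for \<sigma> x
  have conth: "continuous_on S (h \<sigma>)" for S \<sigma>
    unfolding h_def \<psi>_def by (intro continuous_intros)
  \<comment> \<open>At the common vertices the two local primitives differ by one integer
    \<open>k\<close>, hence by affinity on the whole common face, and the exponential does not see
    it.\<close>
  have agree: "h \<sigma> x = h \<tau> x" if st: "\<sigma> \<in> K" "\<tau> \<in> K" and x: "x \<in> convex hull \<sigma>" "x \<in> convex hull \<tau>" for \<sigma> \<tau> x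
  proof -
    have x': "x \<in> convex hull (\<sigma> \<inter> \<tau>)" using convex_hull_inter_eq[OF K st] x by blast
    then have "\<sigma> \<inter> \<tau> \<noteq> {}" by auto
    then obtain u where u: "u \<in> \<sigma>" "u \<in> \<tau>" by blast
    have shift: "\<phi> (base \<rho>) w = \<phi> (base \<rho>) u + \<phi> u w" if "\<rho> \<in> K" "u \<in> \<rho>" "w \<in> \<rho>" for \<rho> w
    proof -
      have "{base \<rho>, u, w} \<in> K" using simplex_face[OF K that(1), of "{base \<rho>, u, w}"] base that by blast
      then show ?thesis using tri[of "base \<rho>" u w] anti[of w "base \<rho>"] by simp
    qed
    define k where "k = \<phi> (base \<sigma>) u - \<phi> (base \<tau>) u"
    have "\<sigma> \<inter> \<tau> \<subseteq> {x. (fst (p \<sigma>) - fst (p \<tau>)) \<bullet> x = real_of_int k - snd (p \<sigma>) + snd (p \<tau>)}"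
    proof
      fix w assume w: "w \<in> \<sigma> \<inter> \<tau>"
      then have "\<psi> \<sigma> w - \<psi> \<tau> w = k"
        using \<psi>[OF st(1)] \<psi>[OF st(2)] shift[OF st(1) u(1)] shift[OF st(2) u(2)] by (simp add: k_def)
      then show "w \<in> {x. (fst (p \<sigma>) - fst (p \<tau>)) \<bullet> x = real_of_int k - snd (p \<sigma>) + snd (p \<tau>)}"
        by (simp add: \<psi>_def inner_diff_left)
    qed
    then have "convex hull (\<sigma> \<inter> \<tau>) \<subseteq> {x. (fst (p \<sigma>) - fst (p \<tau>)) \<bullet> x = real_of_int k - snd (p \<sigma>) + snd (p \<tau>)}"
      by (intro hull_minimal convex_hyperplane)
    then have "\<psi> \<sigma> x = \<psi> \<tau> x + k" using x' by (auto simp: \<psi>_def inner_diff_left)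
    then show ?thesis unfolding h_def exp_eq by (intro exI[of _ k]) (simp add: algebra_simps)
  qed
  obtain H where H: "continuous_map (top_of_set (polyhedron K)) euclidean H"
    "\<And>x \<sigma>. \<sigma> \<in> K \<Longrightarrow> x \<in> topspace (top_of_set (polyhedron K)) \<inter> convex hull \<sigma> \<Longrightarrow> H x = h \<sigma> x"
  proof (rule pasting_lemma_exists_closed[of K "top_of_set (polyhedron K)" "\<lambda>\<sigma>. convex hull \<sigma>" euclidean h])
    show "finite K" using simplicial_complex_finite[OF K] .
    show "topspace (top_of_set (polyhedron K)) \<subseteq> (\<Union>\<sigma>\<in>K. convex hull \<sigma>)" by (simp add: polyhedron_def)
    fix \<sigma> assume \<sigma>: "\<sigma> \<in> K"
    have sub: "convex hull \<sigma> \<subseteq> polyhedron K" using \<sigma> by (auto simp: polyhedron_def)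
    then show "closedin (top_of_set (polyhedron K)) (convex hull \<sigma>)"
      using closed_simplex[OF K \<sigma>] by (simp add: closed_subset)
    show "continuous_map (subtopology (top_of_set (polyhedron K)) (convex hull \<sigma>)) euclidean (h \<sigma>)"
      using conth by (simp add: subtopology_subtopology)
  next
    fix \<sigma> \<tau> x
    assume "\<sigma> \<in> K" "\<tau> \<in> K" "x \<in> topspace (top_of_set (polyhedron K)) \<inter> convex hull \<sigma> \<inter> convex hull \<tau>"
    then show "h \<sigma> x = h \<tau> x" by (intro agree) auto
  qed blast
  have H_eq: "H x = h \<sigma> x" if "\<sigma> \<in> K" "x \<in> convex hull \<sigma>" for \<sigma> x
    using H(2)[OF that(1)] that by (auto simp: polyhedron_def)
  have contH: "continuous_on (polyhedron K) H" using H(1) by simp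
  have H0: "H x \<noteq> 0" if x: "x \<in> polyhedron K" for x
  proof -
    obtain \<sigma> where "\<sigma> \<in> K" "x \<in> convex hull \<sigma>" using x by (auto simp: polyhedron_def)
    then show ?thesis using H_eq by (simp add: h_def)
  qed
  obtain L where L: "continuous_on (polyhedron K) L" "\<And>x. x \<in> polyhedron K \<Longrightarrow> H x = exp (L x)"
    using continuous_logarithm_on_contractible[OF contH contr H0] by metis
  define \<theta> where "\<theta> x = Im (L x) / (2 * pi)" for x
  \<comment> \<open>Along an edge the lifted angle and the local primitive differ by a continuous
    integer-valued function, hence by a constant, and so have the same increment.\<close>
  have "of_int (\<phi> a b) = \<theta> b - \<theta> a" if ab: "{a, b} \<in> K" for a b
  proof -
    let ?\<sigma> = "{a, b}" and ?S = "convex hull {a, b}"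
    have S: "?S \<subseteq> polyhedron K" using ab by (auto simp: polyhedron_def)
    let ?f = "\<lambda>x. \<theta> x - \<psi> ?\<sigma> x"
    have int: "?f x \<in> \<int>" if "x \<in> ?S" for x
    proof -
      have "exp (L x) = exp (\<i> * complex_of_real (2 * pi * \<psi> ?\<sigma> x))"
        using H_eq[OF ab that] L(2)[of x] S that by (auto simp: h_def)
      then obtain n :: int where "L x = \<i> * complex_of_real (2 * pi * \<psi> ?\<sigma> x) + (of_int (2 * n) * pi) * \<i>"
        unfolding exp_eq by blast
      then have "Im (L x) = 2 * pi * \<psi> ?\<sigma> x + 2 * n * pi" by simp
      then have "\<theta> x = \<psi> ?\<sigma> x + n" by (simp add: \<theta>_def field_simps)
      then show ?thesis by simp
    qed
    have cont: "continuous_on ?S ?f"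
      unfolding \<theta>_def \<psi>_def using continuous_on_subset[OF L(1) S] by (intro continuous_intros) auto
    have "?f constant_on ?S"
    proof (rule continuous_discrete_range_constant[OF _ cont])
      show "connected ?S" by (simp add: convex_connected)
      fix x assume x: "x \<in> ?S"
      have "1 \<le> norm (?f y - ?f x)" if "y \<in> ?S" "?f y \<noteq> ?f x" for y
      proof -
        have "?f y - ?f x \<in> \<int>" using int[OF that(1)] int[OF x] by (rule Ints_diff)
        moreover have "?f y - ?f x \<noteq> 0" using that(2) by simp
        ultimately show ?thesis using Ints_nonzero_abs_ge1 by (metis real_norm_def)
      qed
      then show "\<exists>e>0. \<forall>y. y \<in> ?S \<and> ?f y \<noteq> ?f x \<longrightarrow> e \<le> norm (?f y - ?f x)"
        by (intro exI[of _ 1]) auto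
    qed
    moreover have "a \<in> ?S" "b \<in> ?S" by (simp_all add: hull_inc)
    ultimately have "?f a = ?f b" unfolding constant_on_def by metis
    then have "\<theta> b - \<theta> a = \<psi> ?\<sigma> b - \<psi> ?\<sigma> a" by simp
    also have "\<dots> = \<phi> (base ?\<sigma>) b - \<phi> (base ?\<sigma>) a" using \<psi>[OF ab] by simp
    also have "\<dots> = \<phi> a b" using base[OF ab] anti[of a b] diag by auto
    finally show ?thesis by simp
  qed
  then show "\<exists>g :: pt \<Rightarrow> real. \<forall>a b. {a, b} \<in> K \<longrightarrow> of_int (\<phi> a b) = g b - g a" by blast
qed

section \<open>Collapsing along a matching\<close>

lemma card_filter_eq_sum: "finite A \<Longrightarrow> card {x\<in>A. P x} = (\<Sum>x\<in>A. if P x then 1 else 0)"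
  by (simp add: sum.If_cases Int_def)

text \<open>The boundary of a boundary vanishes modulo 2, since an edge of a tetrahedron lies in
  exactly two of its triangles. The incident pairs of a triangle over \<open>e\<close> and a
  tetrahedron of \<open>S\<close> are counted in two ways.\<close>

lemma even_boundary_degree:
  assumes K: "abstract_complex K" and S: "S \<subseteq> tets K" and e: "e \<in> edges K"
  shows "even (card {f\<in>triangles K. odd (card {t\<in>S. f \<subset> t}) \<and> e \<subset> f})"
proof -
  let ?B = "{f\<in>triangles K. e \<subset> f}"
  have finK: "finite K" using abstract_complexD(1)[OF K] .
  have finB: "finite ?B" using finK by (simp add: triangles_def)
  have finS: "finite S" by (rule finite_subset[OF S]) (simp add: tets_def finK)
  have "even (card {f\<in>?B. f \<subset> t})" if t: "t \<in> S" for t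
  proof -
    have tK: "t \<in> K" "card t = 4" using t S by (auto simp: tets_def)
    have fint: "finite t" using abstract_complexD(2)[OF K tK(1)] .
    have e': "card e = 2" using e by (simp add: edges_def)
    then have fine: "finite e" by (simp add: card_ge_0_finite)
    show ?thesis
    proof (cases "e \<subseteq> t")
      case False
      then have "{f\<in>?B. f \<subset> t} = {}" by blast
      then show ?thesis by (simp only: card.empty) simp
    next
      case True
      have "card (t - e) = 2" using True tK e' fine by (subst card_Diff_subset) auto
      then obtain x y where xy: "t - e = {x, y}" "x \<noteq> y" by (auto simp: card_2_iff)
      then have xy': "x \<in> t" "y \<in> t" "x \<notin> e" "y \<notin> e" by blast+
      have "{f\<in>?B. f \<subset> t} = {insert x e, insert y e}"
      proof (intro equalityI subsetI)
        fix f assume "f \<in> {f\<in>?B. f \<subset> t}"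
        then have f: "card f = 3" "e \<subset> f" "f \<subset> t" by (auto simp: triangles_def)
        have "card (f - e) = 1" using f e' fine by (subst card_Diff_subset) auto
        then obtain z where z: "f - e = {z}" by (rule card_1_singletonE)
        then have "f = insert z e" "z \<in> t - e" using f by blast+
        then show "f \<in> {insert x e, insert y e}" using xy by auto
      next
        fix f assume f: "f \<in> {insert x e, insert y e}"
        then have c: "card f = 3" using xy' e' fine by auto
        have "f \<subseteq> t" "e \<subset> f" using f xy' True by auto
        moreover have "f \<in> K" using abstract_complexD(4)[OF K tK(1) \<open>f \<subseteq> t\<close>] f by blast
        moreover have "f \<noteq> t" using c tK(2) by auto
        ultimately show "f \<in> {f\<in>?B. f \<subset> t}" using c by (auto simp: triangles_def)
      qed
      moreover have "insert x e \<noteq> insert y e" using xy xy' by auto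
      ultimately show ?thesis by simp
    qed
  qed
  then have "even (\<Sum>t\<in>S. card {f\<in>?B. f \<subset> t})" by (intro dvd_sum)
  also have "(\<Sum>t\<in>S. card {f\<in>?B. f \<subset> t}) = (\<Sum>t\<in>S. \<Sum>f\<in>?B. if f \<subset> t then 1 else 0)"
    using card_filter_eq_sum[OF finB] by simp
  also have "\<dots> = (\<Sum>f\<in>?B. \<Sum>t\<in>S. if f \<subset> t then 1 else 0)" by (rule sum.swap)
  also have "\<dots> = (\<Sum>f\<in>?B. card {t\<in>S. f \<subset> t})"
    using card_filter_eq_sum[OF finS] by simp
  finally have "even (card {f\<in>?B. odd (card {t\<in>S. f \<subset> t})})" unfolding even_sum_iff[OF finB] .
  moreover have "{f\<in>?B. odd (card {t\<in>S. f \<subset> t})} = {f\<in>triangles K. odd (card {t\<in>S. f \<subset> t}) \<and> e \<subset> f}" by blast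
  ultimately show ?thesis by simp
qed

text \<open>Let \<open>F\<close> be the nonempty boundary of \<open>S\<close> modulo 2. Were all of
  it matched, a source would give an edge in exactly one triangle of \<open>F\<close>, against the
  even degrees. An unmatched triangle of \<open>F\<close> has odd degree, and this is 1 because at
  most two tetrahedra share a triangle.\<close>

lemma free_unmatched_triangle:
  assumes K: "simplicial_complex K" "\<forall>\<sigma>\<in>K. card \<sigma> \<le> 4"
    and M: "matching1 K M" "acyclic_matching M" and S: "S \<subseteq> tets K" "S \<noteq> {}"
  shows "\<exists>f\<in>triangles K. \<exists>t\<in>S. f \<notin> snd ` M \<and> f \<subset> t \<and> (\<forall>t'\<in>S. f \<subset> t' \<longrightarrow> t' = t)"
proof -
  note ac = simplicial_complex_abstract[OF K(1)]
  define F where "F = {f\<in>triangles K. odd (card {t\<in>S. f \<subset> t})}"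
  have "\<exists>f\<in>F. f \<notin> snd ` M"
  proof (rule ccontr)
    assume "\<not> ?thesis"
    then have no: "\<exists>e. (e, f) \<in> M" if "f \<in> F" for f using that by force
    obtain t v where tv: "t \<in> S" "v \<in> t" "odd (card {t' \<in> S. t - {v} \<subset> t'})"
      using exists_odd_facet[OF K S] by blast
    have tK: "t \<in> K" "card t = 4" using tv(1) S(1) by (auto simp: tets_def)
    have c: "card (t - {v}) = 3" using tv(2) tK(2) by simp
    then have "t - {v} \<noteq> {}" by (metis card.empty zero_neq_numeral)
    then have "t - {v} \<in> K" using simplex_face[OF K(1) tK(1), of "t - {v}"] by blast
    then have "t - {v} \<in> F" using c tv(3) by (simp add: triangles_def F_def)
    define N where "N = {p\<in>M. snd p \<in> F}"
    obtain e1 where "(e1, t - {v}) \<in> M" using no[OF \<open>t - {v} \<in> F\<close>] by blast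
    then have "(e1, t - {v}) \<in> N" using \<open>t - {v} \<in> F\<close> by (simp add: N_def)
    then have "N \<noteq> {}" by blast
    moreover have "N \<subseteq> M" "finite N" unfolding N_def using matching1_finite[OF simplicial_complex_finite[OF K(1)] M(1)] by auto
    ultimately obtain e f where ef: "(e, f) \<in> N" "\<forall>e' f'. (e', f') \<in> N \<longrightarrow> e \<subset> f' \<longrightarrow> f' = f"
      using acyclic_matching_source[OF matching1_inj_on_snd[OF M(1)] M(2), of N] by blast
    have efM: "(e, f) \<in> M" "f \<in> F" using ef(1) by (auto simp: N_def)
    have "{f'\<in>triangles K. odd (card {t\<in>S. f' \<subset> t}) \<and> e \<subset> f'} = {f}"
    proof (intro equalityI subsetI)
      fix f' assume f': "f' \<in> {f'\<in>triangles K. odd (card {t\<in>S. f' \<subset> t}) \<and> e \<subset> f'}"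
      then have "f' \<in> F" "e \<subset> f'" by (auto simp: F_def)
      moreover from this obtain e' where "(e', f') \<in> M" using no by blast
      ultimately show "f' \<in> {f}" using ef(2)[rule_format, of e' f'] by (simp add: N_def)
    next
      fix f' assume "f' \<in> {f}"
      then show "f' \<in> {f'\<in>triangles K. odd (card {t\<in>S. f' \<subset> t}) \<and> e \<subset> f'}"
        using efM matching1D(3)[OF M(1) efM(1)] by (simp add: F_def)
    qed
    then show False
      using even_boundary_degree[OF ac S(1) matching1D(1)[OF M(1) efM(1)]] by simp
  qed
  then obtain f where f: "f \<in> triangles K" "odd (card {t\<in>S. f \<subset> t})" "f \<notin> snd ` M" unfolding F_def by blast
  have "card {t\<in>S. f \<subset> t} \<le> card {t\<in>tets K. f \<subset> t}"
    using S(1) simplicial_complex_tets_finite[OF K(1)] by (intro card_mono) auto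
  also have "\<dots> \<le> 2" using card_tets_over_triangle[OF K f(1)] .
  finally have "card {t\<in>S. f \<subset> t} = 1" using f(2) by (simp add: le_Suc_eq numeral_2_eq_2) presburger
  then obtain t where "{t\<in>S. f \<subset> t} = {t}" by (rule card_1_singletonE)
  then have "t \<in> S" "f \<subset> t" "\<forall>t'\<in>S. f \<subset> t' \<longrightarrow> t' = t" by blast+
  then show ?thesis using f(1,3) by blast
qed

text \<open>The last clause records that no nonzero chain of tetrahedra has its boundary modulo 2 in the
  remaining complex once all tetrahedra have been removed.\<close>
definition tet_collapse_inv :: "pt set set \<Rightarrow> (pt set \<times> pt set) set \<Rightarrow> pt set set \<Rightarrow> bool" where
  "tet_collapse_inv K M L \<longleftrightarrow> abstract_complex L \<and> L \<subseteq> K \<and> elem_collapse\<^sup>*\<^sup>* K L \<and>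
     (\<forall>\<sigma>\<in>K. card \<sigma> \<le> 2 \<longrightarrow> \<sigma> \<in> L) \<and> snd ` M \<subseteq> L \<and>
     (\<forall>S\<subseteq>tets K. \<not> S \<subseteq> tets L \<longrightarrow> (\<exists>f\<in>triangles K. f \<notin> L \<and> odd (card {t\<in>S. f \<subset> t})))"

lemma collapse_tets:
  assumes K: "simplicial_complex K" "\<forall>\<sigma>\<in>K. card \<sigma> \<le> 4"
    and M: "matching1 K M" "acyclic_matching M" and L: "tet_collapse_inv K M L"
  shows "\<exists>L'. tet_collapse_inv K M L' \<and> tets L' = {}"
  using L
proof (induction "card (tets L)" arbitrary: L rule: less_induct)
  case less
  show ?case
  proof (cases "tets L = {}")
    case False
    have L: "abstract_complex L" "L \<subseteq> K" "elem_collapse\<^sup>*\<^sup>* K L" "\<forall>\<sigma>\<in>K. card \<sigma> \<le> 2 \<longrightarrow> \<sigma> \<in> L" "snd ` M \<subseteq> L"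
      and odd: "\<And>S. S \<subseteq> tets K \<Longrightarrow> \<not> S \<subseteq> tets L \<Longrightarrow> \<exists>f\<in>triangles K. f \<notin> L \<and> odd (card {t\<in>S. f \<subset> t})"
      using less.prems unfolding tet_collapse_inv_def by blast+
    have "tets L \<subseteq> tets K" using L(2) by (auto simp: tets_def)
    then obtain f t where ft: "f \<in> triangles K" "f \<notin> snd ` M" "t \<in> tets L" "f \<subset> t"
      "\<forall>t'\<in>tets L. f \<subset> t' \<longrightarrow> t' = t"
      using free_unmatched_triangle[OF K M _ False] by blast
    have t: "t \<in> L" "card t = 4" using ft(3) by (auto simp: tets_def)
    have f: "card f = 3" "f \<noteq> {}" using ft(1) by (auto simp: triangles_def)
    then have fL: "f \<in> L" using abstract_complexD(4)[OF L(1) t(1)] ft(4) by blast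
    have uniq: "\<forall>\<rho>\<in>L. f \<subset> \<rho> \<longrightarrow> \<rho> = t"
    proof (intro ballI impI)
      fix \<rho> assume \<rho>: "\<rho> \<in> L" "f \<subset> \<rho>"
      then have "card f < card \<rho>" using abstract_complexD(2)[OF L(1)] by (intro psubset_card_mono)
      then have "card \<rho> = 4" using K(2) L(2) \<rho>(1) f(1) by fastforce
      then show "\<rho> = t" using ft(5) \<rho> by (simp add: tets_def)
    qed
    let ?L = "L - {f, t}"
    have col: "elem_collapse L ?L"
      by (rule elem_collapseI[OF fL t(1) ft(4) _ uniq]) (simp add: t(2) f(1))
    have inv': "tet_collapse_inv K M ?L"
      unfolding tet_collapse_inv_def
    proof (intro conjI allI impI ballI)
      show "abstract_complex ?L" using abstract_complex_collapse[OF L(1) ft(4) uniq] .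
      show "elem_collapse\<^sup>*\<^sup>* K ?L" using L(3) col by (rule rtranclp.rtrancl_into_rtrancl)
      show "\<sigma> \<in> ?L" if "\<sigma> \<in> K" "card \<sigma> \<le> 2" for \<sigma> using L(4) that f t by auto
      have "t \<notin> snd ` M"
      proof
        assume "t \<in> snd ` M"
        then obtain e where "(e, t) \<in> M" by force
        then have "card t = 3" using matching1D(2)[OF M(1)] by (auto simp: triangles_def)
        then show False using t(2) by simp
      qed
      then show "snd ` M \<subseteq> ?L" using L(5) ft(2) by blast
      fix S assume S: "S \<subseteq> tets K" "\<not> S \<subseteq> tets ?L"
      \<comment> \<open>A set \<open>S\<close> that fits into \<open>L\<close> but no longer into
        \<open>?L\<close> contains \<open>t\<close>, and then \<open>f\<close> is its odd triangle,
        \<open>t\<close> being the only tetrahedron of \<open>S\<close> above it. For the other sets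
        the former witness stays removed.\<close>
      show "\<exists>f\<in>triangles K. f \<notin> ?L \<and> odd (card {t\<in>S. f \<subset> t})"
      proof (cases "S \<subseteq> tets L")
        case True
        have "tets ?L = tets L - {t}" using f by (auto simp: tets_def)
        then have "t \<in> S" using S(2) True by blast
        then have "{t'\<in>S. f \<subset> t'} = {t}" using True ft(4,5) by blast
        then show ?thesis using ft(1) by (intro bexI[of _ f]) auto
      next
        case F: False
        then show ?thesis using odd[OF S(1)] by blast
      qed
    qed (use L(2) in blast)
    have "tets ?L \<subseteq> tets L" "t \<notin> tets ?L" by (auto simp: tets_def)
    then have "tets ?L \<subset> tets L" using ft(3) by blast
    moreover have "finite (tets L)" using abstract_complexD(1)[OF L(1)] by (simp add: tets_def)
    ultimately have "card (tets ?L) < card (tets L)" by (rule psubset_card_mono[rotated])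
    from less.hyps[OF this inv'] show ?thesis .
  qed (use less.prems in blast)
qed

lemma sum_unique_nonzero:
  assumes "finite T" "f \<in> T" "\<And>g. g \<in> T \<Longrightarrow> g \<noteq> f \<Longrightarrow> u g = 0"
  shows "sum u T = u f"
  using assms by (simp add: sum.remove)

text \<open>By completeness an unmatched triangle is a real combination of the matched ones. Acyclicity makes
  this system unitriangular, so the coefficients are integers and can be reduced modulo 2.\<close>
lemma unmatched_triangle_cycle:
  assumes K: "abstract_complex K" and M: "matching1 K M" "acyclic_matching M" "complete_matching K M"
    and f0: "f0 \<in> triangles K" "f0 \<notin> snd ` M"
  shows "\<exists>Z. f0 \<in> Z \<and> Z \<subseteq> insert f0 (snd ` M) \<and> (\<forall>e\<in>edges K. even (card {f \<in> Z. e \<subset> f}))"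
proof -
  have finK: "finite K" using abstract_complexD(1)[OF K] .
  have finM: "finite M" using matching1_finite[OF finK M(1)] .
  let ?T = "insert f0 (snd ` M)"
  have finT: "finite ?T" using finM by simp
  have TK: "?T \<subseteq> triangles K" using f0(1) matching1D(2)[OF M(1)] by auto
  \<comment> \<open>One column more than the rank, hence a dependent set.\<close>
  have "card ?T = Suc (incidence_rank K)"
    using f0(2) finM M(3) matching1_inj_on_snd[OF M(1)] by (simp add: card_image complete_matching_def)
  then have "\<not> indep_triangles K ?T" using card_le_incidence_rank[OF finK, of ?T] by auto
  then obtain c where c: "\<forall>e\<in>edges K. (\<Sum>f\<in>?T. c f * incidence f e) = 0" "\<exists>f\<in>?T. c f \<noteq> 0"
    using TK unfolding indep_triangles_def by blast
  note source = acyclic_matching_source[OF matching1_inj_on_snd[OF M(1)] M(2)]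
  \<comment> \<open>Otherwise the relation involves matched triangles only; at the edge of a source
    with nonzero coefficient just one term survives, which is impossible.\<close>
  have "c f0 \<noteq> 0"
  proof
    assume c0: "c f0 = 0"
    define N where "N = {p\<in>M. c (snd p) \<noteq> 0}"
    have "N \<noteq> {}" using c(2) c0 unfolding N_def by blast
    moreover have "finite N" "N \<subseteq> M" using finM by (auto simp: N_def)
    ultimately obtain e f where ef: "(e, f) \<in> N" "\<forall>e' f'. (e', f') \<in> N \<longrightarrow> e \<subset> f' \<longrightarrow> f' = f"
      using source[of N] by blast
    have efM: "(e, f) \<in> M" "c f \<noteq> 0" using ef(1) by (auto simp: N_def)
    have "(\<Sum>g\<in>?T. c g * incidence g e) = c f * incidence f e"
    proof (rule sum_unique_nonzero[OF finT])
      show "f \<in> ?T" using efM(1) by force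
      fix g assume g: "g \<in> ?T" "g \<noteq> f"
      show "c g * incidence g e = 0"
      proof (rule ccontr)
        assume nz: "c g * incidence g e \<noteq> 0"
        then have "e \<subset> g" using incidence_eq_0[of e g] by (cases "e \<subset> g") auto
        moreover have "g \<noteq> f0" using nz c0 by auto
        then obtain e' where "(e', g) \<in> M" using g(1) by force
        ultimately show False using ef(2)[rule_format, of e' g] nz g(2) by (simp add: N_def)
      qed
    qed
    then have "c f * incidence f e = 0" using c(1) matching1D(1)[OF M(1) efM(1)] by simp
    then show False using efM(2) incidence_cases[OF matching1D(3)[OF M(1) efM(1)]] by auto
  qed
  define d where "d f = c f / c f0" for f
  have d0: "d f0 = 1" using \<open>c f0 \<noteq> 0\<close> by (simp add: d_def)
  have d: "(\<Sum>f\<in>?T. d f * incidence f e) = 0" if "e \<in> edges K" for e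
  proof -
    have "(\<Sum>f\<in>?T. d f * incidence f e) = (\<Sum>f\<in>?T. c f * incidence f e) / c f0"
      unfolding d_def by (simp only: sum_divide_distrib times_divide_eq_left)
    then show ?thesis using c(1) that by simp
  qed
  have int_inc: "incidence f e \<in> \<int>" for f e
    using incidence_cases[of e f] incidence_eq_0[of e f] by (cases "e \<subset> f") auto
  \<comment> \<open>Among the pairs with a nonintegral coefficient, a source yields an equation
    whose other terms are all integers, while its own coefficient is multiplied by 1 or -1.\<close>
  have "d f \<in> \<int>" if f: "f \<in> ?T" for f
  proof (rule ccontr)
    assume nf: "d f \<notin> \<int>"
    define N where "N = {p\<in>M. d (snd p) \<notin> \<int>}"
    have "f \<noteq> f0" using nf d0 by auto
    then have "N \<noteq> {}" using f nf unfolding N_def by blast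
    moreover have "finite N" "N \<subseteq> M" using finM by (auto simp: N_def)
    ultimately obtain e g where eg: "(e, g) \<in> N" "\<forall>e' f'. (e', f') \<in> N \<longrightarrow> e \<subset> f' \<longrightarrow> f' = g"
      using source[of N] by blast
    have egM: "(e, g) \<in> M" "d g \<notin> \<int>" using eg(1) by (auto simp: N_def)
    have gT: "g \<in> ?T" using egM(1) by force
    have "(\<Sum>f\<in>?T - {g}. d f * incidence f e) \<in> \<int>"
    proof (rule Ints_sum)
      fix f' assume f': "f' \<in> ?T - {g}"
      show "d f' * incidence f' e \<in> \<int>"
      proof (cases "e \<subset> f'")
        case True
        have "d f' \<in> \<int>"
        proof (rule ccontr)
          assume nz: "d f' \<notin> \<int>"
          then have "f' \<noteq> f0" using d0 by auto
          then obtain e' where "(e', f') \<in> M" using f' by force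
          then show False using eg(2)[rule_format, of e' f'] nz True f' by (simp add: N_def)
        qed
        then show ?thesis using int_inc by (rule Ints_mult)
      qed (simp add: incidence_eq_0)
    qed
    moreover have "d g * incidence g e = - (\<Sum>f\<in>?T - {g}. d f * incidence f e)"
      using d[OF matching1D(1)[OF M(1) egM(1)]] sum.remove[OF finT gT, of "\<lambda>f. d f * incidence f e"] by simp
    ultimately have "d g * incidence g e \<in> \<int>" by simp
    then show False using egM(2) incidence_cases[OF matching1D(3)[OF M(1) egM(1)]] by auto
  qed
  then have "\<forall>f\<in>?T. \<exists>k. d f = of_int k" by (auto elim!: Ints_cases)
  then obtain k where k: "\<forall>f\<in>?T. d f = of_int (k f)" by (rule bchoice[THEN exE])
  \<comment> \<open>Integer-valued incidence numbers, whose parity is the face relation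
    itself.\<close>
  define \<iota> where "\<iota> f e = \<lfloor>incidence f e\<rfloor>" for f e
  have \<iota>: "incidence f e = of_int (\<iota> f e)" for f e using int_inc[of f e] by (auto simp: \<iota>_def elim: Ints_cases)
  have odd_\<iota>: "odd (\<iota> f e) \<longleftrightarrow> e \<subset> f" for f e
  proof (cases "e \<subset> f")
    case True
    then have "\<iota> f e = 1 \<or> \<iota> f e = -1" using incidence_cases[OF True] unfolding \<iota> by linarith
    then show ?thesis using True by auto
  next
    case False
    then show ?thesis by (simp add: \<iota>_def incidence_eq_0)
  qed
  let ?Z = "{f\<in>?T. odd (k f)}"
  have cycle: "even (card {f \<in> ?Z. e \<subset> f})" if e: "e \<in> edges K" for e
  proof -
    have "real_of_int (\<Sum>f\<in>?T. k f * \<iota> f e) = (\<Sum>f\<in>?T. d f * incidence f e)"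
      unfolding of_int_sum of_int_mult
    proof (rule sum.cong[OF refl])
      fix f assume "f \<in> ?T"
      then show "of_int (k f) * of_int (\<iota> f e) = d f * incidence f e" using k \<iota>[of f e] by metis
    qed
    then have "real_of_int (\<Sum>f\<in>?T. k f * \<iota> f e) = 0" using d[OF e] by simp
    then have "(\<Sum>f\<in>?T. k f * \<iota> f e) = 0" by (simp only: of_int_eq_0_iff)
    then have "even (\<Sum>f\<in>?T. k f * \<iota> f e)" by simp
    then have "even (card {f\<in>?T. odd (k f * \<iota> f e)})" unfolding even_sum_iff[OF finT] .
    moreover have "{f\<in>?T. odd (k f * \<iota> f e)} = {f \<in> ?Z. e \<subset> f}" using odd_\<iota> by auto
    ultimately show ?thesis by simp
  qed
  have "f0 \<in> ?Z" using k d0 by auto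
  then show ?thesis by (intro exI[of _ ?Z] conjI ballI cycle) auto
qed

text \<open>As all triangles of \<open>L\<close> are matched, the edge of a source among them is a
  free face of \<open>L\<close>. A vertex of the removed triangle survives, which keeps the complex
  nonempty.\<close>

lemma collapse_triangles:
  assumes M: "acyclic_matching M" "finite M" "inj_on snd M"
      "\<And>e f. (e, f) \<in> M \<Longrightarrow> card e = 2 \<and> e \<subset> f"
    and L: "abstract_complex L" "L \<noteq> {}" "\<forall>\<sigma>\<in>L. card \<sigma> \<le> 3" "triangles L \<subseteq> snd ` M"
  shows "\<exists>G. elem_collapse\<^sup>*\<^sup>* L G \<and> G \<noteq> {} \<and> (\<forall>\<sigma>\<in>G. card \<sigma> \<le> 2)"
  using L
proof (induction "card (triangles L)" arbitrary: L rule: less_induct)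
  case less
  note L = less.prems
  show ?case
  proof (cases "triangles L = {}")
    case True
    have "card \<sigma> \<le> 2" if "\<sigma> \<in> L" for \<sigma>
    proof -
      have "card \<sigma> \<le> 3" "card \<sigma> \<noteq> 3" using L(3) that True by (auto simp: triangles_def)
      then show ?thesis by linarith
    qed
    then show ?thesis using L(2) by (intro exI[of _ L]) auto
  next
    case False
    define N where "N = {p\<in>M. snd p \<in> triangles L}"
    have "N \<noteq> {}" using False L(4) unfolding N_def by blast
    moreover have "finite N" "N \<subseteq> M" using M(2) by (auto simp: N_def)
    ultimately obtain e f where ef: "(e, f) \<in> N" "\<forall>e' f'. (e', f') \<in> N \<longrightarrow> e \<subset> f' \<longrightarrow> f' = f"
      using acyclic_matching_source[OF M(3) M(1), of N] by blast
    have f: "f \<in> L" "card f = 3" "f \<in> triangles L" using ef(1) by (auto simp: triangles_def N_def)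
    have e: "card e = 2" "e \<subset> f" using M(4)[of e f] ef(1) by (auto simp: N_def)
    have "e \<noteq> {}" using e(1) by auto
    then have eL: "e \<in> L" using abstract_complexD(4)[OF L(1) f(1)] e(2) by blast
    have uniq: "\<forall>\<rho>\<in>L. e \<subset> \<rho> \<longrightarrow> \<rho> = f"
    proof (intro ballI impI)
      fix \<rho> assume \<rho>: "\<rho> \<in> L" "e \<subset> \<rho>"
      then have "card e < card \<rho>" using abstract_complexD(2)[OF L(1)] by (intro psubset_card_mono)
      then have "card \<rho> = 3" using L(3) \<rho>(1) e(1) by fastforce
      then have tri: "\<rho> \<in> triangles L" using \<rho> by (simp add: triangles_def)
      then obtain e' where "(e', \<rho>) \<in> M" using L(4) by force
      then show "\<rho> = f" using ef(2)[rule_format, of e' \<rho>] tri \<rho>(2) by (simp add: N_def)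
    qed
    let ?L = "L - {e, f}"
    have col: "elem_collapse L ?L"
      by (rule elem_collapseI[OF eL f(1) e(2) _ uniq]) (simp add: e(1) f(2))
    obtain v where v: "v \<in> f" using f(2) by fastforce
    then have "{v} \<in> L" using abstract_complexD(4)[OF L(1) f(1), of "{v}"] by blast
    moreover have "{v} \<noteq> e" "{v} \<noteq> f" using e(1) f(2) by auto
    ultimately have ne: "?L \<noteq> {}" by blast
    have "triangles ?L \<subset> triangles L" using f(3) by (auto simp: triangles_def)
    then have "card (triangles ?L) < card (triangles L)"
      using abstract_complexD(1)[OF L(1)] by (intro psubset_card_mono) (simp_all add: triangles_def)
    moreover have "triangles ?L \<subseteq> snd ` M" using L(4) by (auto simp: triangles_def)
    moreover have "\<forall>\<sigma>\<in>?L. card \<sigma> \<le> 3" using L(3) by blast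
    ultimately obtain G where G: "elem_collapse\<^sup>*\<^sup>* ?L G" "G \<noteq> {}" "\<forall>\<sigma>\<in>G. card \<sigma> \<le> 2"
      using less.hyps[of ?L] abstract_complex_collapse[OF L(1) e(2) uniq] ne by blast
    have "elem_collapse\<^sup>*\<^sup>* L G" using col G(1) by (rule converse_rtranclp_into_rtranclp)
    then show ?thesis using G by blast
  qed
qed

lemma complete_acyclic_matching_imp_collapsible:
  assumes K: "simplicial_complex K" "\<forall>\<sigma>\<in>K. card \<sigma> \<le> 4" "K \<noteq> {}"
    and top: "connected (- polyhedron K)" "cocycles_exact K" "edge_connected K"
    and M: "matching1 K M" "acyclic_matching M" "complete_matching K M"
  shows "collapsible K"
proof -
  note ac = simplicial_complex_abstract[OF K(1)]
  have "snd ` M \<subseteq> K" using matching1D(2)[OF M(1)] by (auto simp: triangles_def)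
  then have "tet_collapse_inv K M K" unfolding tet_collapse_inv_def using ac by auto
  then obtain L where inv: "tet_collapse_inv K M L" and noL: "tets L = {}"
    using collapse_tets[OF K(1,2) M(1,2)] by blast
  have L: "abstract_complex L" "L \<subseteq> K" "elem_collapse\<^sup>*\<^sup>* K L" "\<forall>\<sigma>\<in>K. card \<sigma> \<le> 2 \<longrightarrow> \<sigma> \<in> L" "snd ` M \<subseteq> L"
    and odd: "\<And>S. S \<subseteq> tets K \<Longrightarrow> \<not> S \<subseteq> tets L \<Longrightarrow> \<exists>f\<in>triangles K. f \<notin> L \<and> odd (card {t\<in>S. f \<subset> t})"
    using inv unfolding tet_collapse_inv_def by blast+
  \<comment> \<open>A leftover unmatched triangle lies on a 2-cycle \<open>Z\<close> inside
    \<open>L\<close>, which bounds a nonempty set \<open>S\<close> of tetrahedra. None of these is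
    left in \<open>L\<close>, so by the invariant some triangle of the boundary \<open>Z\<close>
    lies outside \<open>L\<close>, a contradiction.\<close>
  have matched: "triangles L \<subseteq> snd ` M"
  proof (rule ccontr)
    assume "\<not> ?thesis"
    then obtain f0 where f0: "f0 \<in> triangles L" "f0 \<notin> snd ` M" by blast
    have f0K: "f0 \<in> triangles K" using f0(1) L(2) by (auto simp: triangles_def)
    obtain Z where Z: "f0 \<in> Z" "Z \<subseteq> insert f0 (snd ` M)" "\<forall>e\<in>edges K. even (card {f \<in> Z. e \<subset> f})"
      using unmatched_triangle_cycle[OF ac M f0K f0(2)] by blast
    have "snd ` M \<subseteq> triangles K" using matching1D(2)[OF M(1)] by auto
    then have "Z \<subseteq> triangles K" using Z(2) f0K by blast
    from cycle_is_boundary[OF K(1,2) top(1) this Z(3)[rule_format]]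
    obtain S where S: "S \<subseteq> tets K" "\<forall>f\<in>triangles K. f \<in> Z \<longleftrightarrow> odd (card {t \<in> S. f \<subset> t})"
      by blast
    have "odd (card {t \<in> S. f0 \<subset> t})" using S(2)[rule_format, OF f0K] Z(1) by blast
    then have "S \<noteq> {}" by auto
    then obtain f where f: "f \<in> triangles K" "f \<notin> L" "odd (card {t\<in>S. f \<subset> t})"
      using odd[OF S(1)] noL by blast
    then have "f \<in> Z" using S(2) by blast
    then show False using Z(2) f(2) L(5) f0(1) by (auto simp: triangles_def)
  qed
  obtain \<sigma> where \<sigma>: "\<sigma> \<in> K" using K(3) by blast
  then obtain v where "v \<in> \<sigma>" using abstract_complexD(3)[OF ac] by blast
  then have "{v} \<in> K" using abstract_complexD(4)[OF ac \<sigma>] by blast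
  then have "{v} \<in> L" using L(4) by simp
  then have ne: "L \<noteq> {}" by blast
  have le3: "\<forall>\<sigma>\<in>L. card \<sigma> \<le> 3"
  proof
    fix \<sigma> assume "\<sigma> \<in> L"
    then have "card \<sigma> \<le> 4" "card \<sigma> \<noteq> 4" using K(2) L(2) noL by (auto simp: tets_def)
    then show "card \<sigma> \<le> 3" by linarith
  qed
  have M_edge: "card e = 2 \<and> e \<subset> f" if "(e, f) \<in> M" for e f
    using matching1D(1,3)[OF M(1) that] by (simp add: edges_def)
  have finM: "finite M" using matching1_finite[OF abstract_complexD(1)[OF ac] M(1)] .
  obtain G where G: "elem_collapse\<^sup>*\<^sup>* L G" "G \<noteq> {}" "\<forall>\<sigma>\<in>G. card \<sigma> \<le> 2"
    using collapse_triangles[OF M(2) finM matching1_inj_on_snd[OF M(1)] M_edge L(1) ne le3 matched] by blast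
  have KG: "elem_collapse\<^sup>*\<^sup>* K G" using L(3) G(1) by (rule rtranclp_trans)
  have "collapsible G"
    using exact_graph_collapsible[OF _ G(2,3)] collapse_preserves[OF KG ac top(2,3)] by blast
  then show ?thesis using KG unfolding collapsible_def by (meson rtranclp_trans)
qed

theorem theorem4:
  fixes K :: "(real^3) set set" and \<Omega> :: "(real^3) set"
  assumes "simplicial_complex K" and "dim3_complex K"
    and "polyhedron K = \<Omega>"
    and "closed \<Omega>" and "bounded \<Omega>" and "lipschitz_boundary \<Omega>"
    and "\<Omega> homeomorphic cball (0 :: real^3) 1"
  shows "collapsible K \<longleftrightarrow>
    (\<exists>M. matching1 K M \<and> acyclic_matching M \<and> complete_matching K M)"
proof
  assume "collapsible K"
  then show "\<exists>M. matching1 K M \<and> acyclic_matching M \<and> complete_matching K M"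
    using collapsible_imp_complete_acyclic_matching[OF simplicial_complex_abstract[OF assms(1)]] by blast
next
  assume "\<exists>M. matching1 K M \<and> acyclic_matching M \<and> complete_matching K M"
  then obtain M where M: "matching1 K M" "acyclic_matching M" "complete_matching K M" by blast
  have K: "\<forall>\<sigma>\<in>K. card \<sigma> \<le> 4" "K \<noteq> {}" using assms(2) by (auto simp: dim3_complex_def)
  have contr: "contractible (polyhedron K)"
    using homeomorphic_contractible_eq[OF assms(7)] convex_imp_contractible[OF convex_cball] assms(3) by blast
  \<comment> \<open>A set homeomorphic to a compact convex one does not separate a Euclidean space
    of dimension at least 2.\<close>
  have "connected (- polyhedron K)"
    using connected_complement_homeomorphic_convex_compact[OF assms(7) convex_cball compact_cball] assms(3) by simp
  moreover have "edge_connected K"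
    using connected_imp_edge_connected[OF assms(1) contractible_imp_connected[OF contr]] .
  ultimately show "collapsible K"
    using complete_acyclic_matching_imp_collapsible[OF assms(1) K _ contractible_imp_cocycles_exact[OF assms(1) contr] _ M] by blast
qed

end
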